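(* Let $T>0$, $N_{0},N_{1}\in\mathbb{N}$, $n\in\mathbb{N}$, $s\in\mathbb{R}$, $r\in[0,1]$ and $F\in\mathbb{D}_{2,s+rn}^{(N_{0})}$. Then $$ \left\|\mathrm{Err}_{n}^{(N_{0}N_{1})}(F)\right\|_{2,s}\leq\frac{\|F\|_{2,s+rn}}{\left(\sqrt{n!\,N_{1}^{n}}\right)^{r}}, $$ where $\mathrm{Err}_{n}^{(N)}(F)$ denotes the $n$-th-order error of the discrete-time Clark--Ocone formula with $N$ time steps on $[0,T]$.
   Context: $\mathbb{N}=\{1,2,\ldots\}$, $\mathbb{Z}_{+}=\mathbb{N}\cup\{0\}$. $W=(W_t)_{t\ge 0}$ is a one-dimensional Wiener process on a complete probability space $(\Omega,\mathcal{F},\mathbb{P})$ with $\mathcal{F}$ generated by $W$. $\mathbb{H}:=L_{2}([0,\infty))$ (Lebesgue measure, real-valued) and $W(h):=\int_0^\infty h(t)\,\mathrm{d}W_t$ for $h\in\mathbb{H}$. Hermite polynomials (normalized): $H_{0}\equiv 1$ and $H_{m}(x)=\frac{(-1)^{m}}{\sqrt{m!}}e^{x^{2}/2}\frac{\mathrm{d}^{m}}{\mathrm{d}x^{m}}e^{-x^{2}/2}$ for $m\in\mathbb{N}$. For a multi-index $a=(a_1,\ldots,a_\ell)\in\mathbb{Z}_+^\ell$ (identified with $(a_1,\ldots,a_\ell,0,0,\ldots)$) put $|a|:=\sum_i a_i$, and for an orthonormal system $\mathbf{h}=\{h_i\}_{i\in\mathbb{N}}$ of $\mathbb{H}$ put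 $\mathbf{H}_a(\mathbf{h}):=\prod_{i=1}^\infty H_{a_i}(W(h_i))$. Sobolev-type spaces: $\mathcal{P}$ is the space of real polynomials in finitely many $W(h)$, $h\in\mathbb{H}$; $L$ is the Ornstein--Uhlenbeck operator on $\mathcal{P}$ (so $-L\,\mathbf{H}_a(\mathbf{h})=|a|\,\mathbf{H}_a(\mathbf{h})$). For $s\in\mathbb{R}$, $\langle F,G\rangle_{2,s}:=\mathbb{E}[(I-L)^{s/2}F\,(I-L)^{s/2}G]$, $\|\cdot\|_{2,s}$ is the induced norm, and $\mathbb{D}_{2,s}$ is the completion of $\mathcal{P}$ in this norm ($\mathbb{D}_{2,s'}\subset\mathbb{D}_{2,s}$ for $s'\ge s$). For $F\in\mathbb{D}_{2,s}$, $\mathbb{E}[F\,\mathbf{H}_a(\mathbf{h})]$ is the generalized expectation (duality pairing), i.e. $\mathbb{E}[F\,\mathbf{H}_a(\mathbf{h})]=(1+|a|)^{-s}\langle F,\mathbf{H}_a(\mathbf{h})\rangle_{2,s}$, and $\mathbb{E}[F]:=\mathbb{E}[F\cdot 1]$. Discretization: for $T>0$, $N\in\mathbb{N}$, $i\in\mathbb{N}$, let $\Delta W_i^{(N)}:=W_{iT/N}-W_{(i-1)T/N}$, $h_i^{(N)}:=(T/N)^{-1/2}\mathbf{1}_{(\frac{i-1}{N}T,\frac{i}{N}T]}$ and $\mathbf{h}^{(N)}:=\{h_i^{(N)}\}_{i\in\mathbb{N}}$, an orthonormal system of $\mathbb{H}$. $\mathbb{D}_{2,s}^{(N)}$ is the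 closure in $\mathbb{D}_{2,s}$ of $\mathrm{span}\{\mathbf{H}_a(\mathbf{h}^{(N)}):a\in\mathbb{Z}_+^N\}$; it is a Hilbert space with complete orthonormal system $\{(1+|a|)^{-s/2}\mathbf{H}_a(\mathbf{h}^{(N)}):a\in\mathbb{Z}_+^N\}$. One has $\mathbb{D}_{2,s}^{(N_0)}\subset\mathbb{D}_{2,s}^{(N_0N_1)}$. Generalized conditional expectation: for $0\le\ell\le N$, $\mathbb{E}[F\,|\,\{\Delta W_i^{(N)}\}_{i=1}^{\ell}]:=\sum_{a\in\mathbb{Z}_+^\ell}\mathbb{E}[F\,\mathbf{H}_a(\mathbf{h}^{(N)})]\,\mathbf{H}_a(\mathbf{h}^{(N)})$ (which is $\mathbb{E}[F]$ when $\ell=0$). Derivatives: $D_h$ is the directional derivative along $h\in\mathbb{H}$, $D_h\,p(W(h_1),\ldots,W(h_k))=\sum_i\partial_ip(W(h_1),\ldots,W(h_k))\langle h_i,h\rangle_{\mathbb{H}}$ on $\mathcal{P}$, extended continuously to $\mathbb{D}_{2,s}\to\mathbb{D}_{2,s-1}$. $D_{\Delta W_\ell^{(N)}}$ denotes differentiation with respect to the variable $\Delta W_\ell^{(N)}$, i.e. $D_{\Delta W_\ell^{(N)}}:=(T/N)^{-1/2}D_{h_\ell^{(N)}}$. Error: for $F\in\mathbb{D}_{2,s}^{(N)}$ and $n\in\mathbb{N}$, $$\mathrm{Err}_n^{(N)}(F):=F-\left(\mathbb{E}[F]+\sum_{m=1}^{n}\sum_{\ell=1}^{N}\frac{(T/N)^{m/2}}{\sqrt{m!}}\,\mathbb{E}\left[D_{\Delta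 W_\ell^{(N)}}^{m}F\,\middle|\,\{\Delta W_i^{(N)}\}_{i=1}^{\ell-1}\right]H_m\!\left(\frac{\Delta W_\ell^{(N)}}{\sqrt{T/N}}\right)\right),$$ which equals $$\sum_{m=n+1}^{\infty}\sum_{\ell=1}^{N}\sum_{a\in\mathbb{Z}_+^{\ell-1}}\mathbb{E}\left[F\,\mathbf{H}_{(a,m)}(\mathbf{h}^{(N)})\right]\mathbf{H}_{(a,m)}(\mathbf{h}^{(N)}),$$ where $(a,m):=(a_1,\ldots,a_{\ell-1},m)$ and the series converges in $\mathbb{D}_{2,s}^{(N)}$. *)

theory Defs
  imports "HOL-Probability.Probability"
begin

text \<open>A polynomial in \<open>k\<close> variables is a polynomial function of \<open>x 0, \<dots>, x (k - 1)\<close>;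
  each \<open>a \<in> A\<close> is an exponent vector, of which only the entries below \<open>k\<close> are used.\<close>

definition poly_fun :: "nat \<Rightarrow> ((nat \<Rightarrow> real) \<Rightarrow> real) \<Rightarrow> bool" where
  "poly_fun k p \<longleftrightarrow>
     (\<exists>(A :: (nat \<Rightarrow> nat) set) c. finite A \<and> p = (\<lambda>x. \<Sum>a\<in>A. c a * (\<Prod>i<k. x i ^ a i)))"

definition partial :: "nat \<Rightarrow> ((nat \<Rightarrow> real) \<Rightarrow> real) \<Rightarrow> (nat \<Rightarrow> real) \<Rightarrow> real" where
  "partial i p x = deriv (\<lambda>t. p (x(i := t))) (x i)"

definition hermite :: "nat \<Rightarrow> real \<Rightarrow> real" where
  "hermite m x =
     (-1) ^ m / sqrt (fact m) * exp (x\<^sup>2 / 2) * (deriv ^^ m) (\<lambda>y. exp (- y\<^sup>2 / 2)) x"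

text \<open>Multi-indices are indexed from 1 and padded with zeros; \<open>multi_index l\<close> is the set
  of multi-indices of length \<open>l\<close>.\<close>

definition multi_index :: "nat \<Rightarrow> (nat \<Rightarrow> nat) set" where
  "multi_index l = {a. \<forall>i. i \<notin> {1..l} \<longrightarrow> a i = 0}"

definition weight :: "(nat \<Rightarrow> nat) \<Rightarrow> nat" where
  "weight a = (\<Sum>i | a i \<noteq> 0. a i)"

text \<open>Elements of the Hilbert space are represented by functions; only values on \<open>[0, \<infinity>)\<close>, up to null sets, matter.\<close>

definition half_line :: "real measure" where
  "half_line = restrict_space lborel {0..}"

definition L2H :: "(real \<Rightarrow> real) set" where
  "L2H = {h \<in> borel_measurable half_line. integrable half_line (\<lambda>t. (h t)\<^sup>2)}"

definition innerH :: "(real \<Rightarrow> real) \<Rightarrow> (real \<Rightarrow> real) \<Rightarrow> real" where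
  "innerH g h = (LINT t|half_line. g t * h t)"

text \<open>A list of triples \<open>(c, u, v)\<close> encodes the step function with value \<open>c\<close> on \<open>(u, v]\<close>,
  summed over the list.\<close>

definition valid_steps :: "(real \<times> real \<times> real) list \<Rightarrow> bool" where
  "valid_steps ps \<longleftrightarrow> (\<forall>(c, u, v) \<in> set ps. 0 \<le> u \<and> u \<le> v)"

definition step_fun :: "(real \<times> real \<times> real) list \<Rightarrow> real \<Rightarrow> real" where
  "step_fun ps t = (\<Sum>(c, u, v)\<leftarrow>ps. c * indicator {u<..v} t)"

definition grid_h :: "real \<Rightarrow> nat \<Rightarrow> nat \<Rightarrow> real \<Rightarrow> real" where
  "grid_h T N i =
     (\<lambda>t. (T / N) powr (- 1 / 2) * indicator {(real i - 1) / N * T <.. real i / N * T} t)"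

text \<open>As the space is complete, "generated by \<open>W\<close>" is understood up to null sets.\<close>

locale wiener_space = prob_space M + complete_measure M
  for M :: "'a measure" and W :: "real \<Rightarrow> 'a \<Rightarrow> real" +
  assumes W_measurable: "\<And>t. 0 \<le> t \<Longrightarrow> W t \<in> borel_measurable M"
    and W_zero: "AE \<omega> in M. W 0 \<omega> = 0"
    and W_normal: "\<And>u v. 0 \<le> u \<Longrightarrow> u < v \<Longrightarrow>
      distributed M lborel (\<lambda>\<omega>. W v \<omega> - W u \<omega>) (normal_density 0 (sqrt (v - u)))"
    and W_indep: "\<And>(t :: nat \<Rightarrow> real) k. 0 \<le> t 0 \<Longrightarrow> strict_mono t \<Longrightarrow>
      indep_vars (\<lambda>_. borel) (\<lambda>i \<omega>. W (t (Suc i)) \<omega> - W (t i) \<omega>) {..<k}"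
    and W_continuous: "AE \<omega> in M. continuous_on {0..} (\<lambda>t. W t \<omega>)"
    and W_generates: "sets M = sigma_sets (space M)
      ((\<Union>t\<in>{0..}. {W t -` B \<inter> space M | B. B \<in> sets borel}) \<union> null_sets M)"
begin

definition step_integral :: "(real \<times> real \<times> real) list \<Rightarrow> 'a \<Rightarrow> real" where
  "step_integral ps \<omega> = (\<Sum>(c, u, v)\<leftarrow>ps. c * (W v \<omega> - W u \<omega>))"

text \<open>The stochastic integral of \<open>h\<close> is the mean-square limit of the integrals of step
  functions converging to \<open>h\<close>; it is determined up to null sets.\<close>

definition is_wiener_integral :: "(real \<Rightarrow> real) \<Rightarrow> ('a \<Rightarrow> real) \<Rightarrow> bool" where
  "is_wiener_integral h X \<longleftrightarrow>
     X \<in> borel_measurable M \<and> integrable M (\<lambda>\<omega>. (X \<omega>)\<^sup>2) \<and>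
     (\<exists>ps. (\<forall>k. valid_steps (ps k)) \<and>
        (\<lambda>k. LINT t|half_line. (h t - step_fun (ps k) t)\<^sup>2) \<longlonglongrightarrow> 0 \<and>
        (\<lambda>k. expectation (\<lambda>\<omega>. (X \<omega> - step_integral (ps k) \<omega>)\<^sup>2)) \<longlonglongrightarrow> 0)"

definition WI :: "(real \<Rightarrow> real) \<Rightarrow> 'a \<Rightarrow> real" where
  "WI h = (SOME X. is_wiener_integral h X)"

definition HH :: "(nat \<Rightarrow> real \<Rightarrow> real) \<Rightarrow> (nat \<Rightarrow> nat) \<Rightarrow> 'a \<Rightarrow> real" where
  "HH h a \<omega> = (\<Prod>i | a i \<noteq> 0. hermite (a i) (WI (h i) \<omega>))"

definition poly_rep ::
  "('a \<Rightarrow> real) \<Rightarrow> nat \<Rightarrow> (nat \<Rightarrow> real \<Rightarrow> real) \<Rightarrow> ((nat \<Rightarrow> real) \<Rightarrow> real) \<Rightarrow> bool" where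
  "poly_rep F k h p \<longleftrightarrow> F \<in> borel_measurable M \<and> (\<forall>i<k. h i \<in> L2H) \<and> poly_fun k p \<and>
     (AE \<omega> in M. F \<omega> = p (\<lambda>i. WI (h i) \<omega>))"

definition \<P> :: "('a \<Rightarrow> real) set" where
  "\<P> = {F. \<exists>k h p. poly_rep F k h p}"

text \<open>Up to null sets, the next two operators do not depend on the representation of \<open>F\<close>.\<close>

definition dir_deriv :: "(real \<Rightarrow> real) \<Rightarrow> ('a \<Rightarrow> real) \<Rightarrow> 'a \<Rightarrow> real" where
  "dir_deriv g F = (SOME G. \<exists>k h p. poly_rep F k h p \<and>
     G = (\<lambda>\<omega>. \<Sum>i<k. partial i p (\<lambda>j. WI (h j) \<omega>) * innerH (h i) g))"

definition OU :: "('a \<Rightarrow> real) \<Rightarrow> 'a \<Rightarrow> real" where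
  "OU F = (SOME G. \<exists>k h p. poly_rep F k h p \<and>
     G = (\<lambda>\<omega>. (\<Sum>i<k. \<Sum>j<k. partial i (partial j p) (\<lambda>l. WI (h l) \<omega>) * innerH (h i) (h j))
              - (\<Sum>i<k. partial i p (\<lambda>l. WI (h l) \<omega>) * WI (h i) \<omega>)))"

text \<open>\<open>I_minus_OU_pow \<alpha>\<close> is the power \<open>(I - L)\<close> to the \<open>\<alpha>\<close> on \<open>\<P>\<close>, by functional calculus:
  every element of \<open>\<P>\<close> is a finite sum of eigenvectors \<open>\<Phi> m \<in> \<P>\<close> of \<open>- L\<close>
  with eigenvalues \<open>m = 0, 1, 2, \<dots>\<close>, in a unique way up to null sets and vanishing terms.\<close>

definition I_minus_OU_pow :: "real \<Rightarrow> ('a \<Rightarrow> real) \<Rightarrow> 'a \<Rightarrow> real" where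
  "I_minus_OU_pow \<alpha> F = (SOME G. \<exists>(q :: nat) \<Phi>.
     (\<forall>m\<le>q. \<Phi> m \<in> \<P> \<and> (AE \<omega> in M. - OU (\<Phi> m) \<omega> = real m * \<Phi> m \<omega>)) \<and>
     (AE \<omega> in M. F \<omega> = (\<Sum>m\<le>q. \<Phi> m \<omega>)) \<and>
     G = (\<lambda>\<omega>. \<Sum>m\<le>q. (1 + real m) powr \<alpha> * \<Phi> m \<omega>))"

definition innerP :: "real \<Rightarrow> ('a \<Rightarrow> real) \<Rightarrow> ('a \<Rightarrow> real) \<Rightarrow> real" where
  "innerP s F G = expectation (\<lambda>\<omega>. I_minus_OU_pow (s / 2) F \<omega> * I_minus_OU_pow (s / 2) G \<omega>)"

definition normP :: "real \<Rightarrow> ('a \<Rightarrow> real) \<Rightarrow> real" where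
  "normP s F = sqrt (innerP s F F)"

text \<open>Elements of the completion of \<open>\<P>\<close> for the norm \<open>normP s\<close> are represented by Cauchy sequences
  in \<open>\<P>\<close>; two of them represent the same element iff the norm \<open>normD s\<close> of their difference is 0.
  The inclusion of \<open>\<D> s'\<close> in \<open>\<D> s\<close> for \<open>s \<le> s'\<close> is then literal, \<open>F \<in> \<P>\<close> is embedded as the
  constant sequence, and the continuous extension to \<open>\<D> s\<close> of an operator that is continuous on
  \<open>\<P>\<close> is its application term by term.  Everything below respects equality in \<open>\<D> s\<close>.\<close>

definition \<D> :: "real \<Rightarrow> (nat \<Rightarrow> 'a \<Rightarrow> real) set" where
  "\<D> s = {F. (\<forall>k. F k \<in> \<P>) \<and>
     (\<forall>\<epsilon>>0. \<exists>K. \<forall>i\<ge>K. \<forall>j\<ge>K. normP s (\<lambda>\<omega>. F i \<omega> - F j \<omega>) < \<epsilon>)}"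

definition innerD :: "real \<Rightarrow> (nat \<Rightarrow> 'a \<Rightarrow> real) \<Rightarrow> (nat \<Rightarrow> 'a \<Rightarrow> real) \<Rightarrow> real" where
  "innerD s F G = lim (\<lambda>k. innerP s (F k) (G k))"

definition normD :: "real \<Rightarrow> (nat \<Rightarrow> 'a \<Rightarrow> real) \<Rightarrow> real" where
  "normD s F = sqrt (innerD s F F)"

text \<open>The value of the pairing \<open>gen_exp s F h a\<close> does not depend on the choice of \<open>s\<close> with
  \<open>F \<in> \<D> s\<close>.\<close>

definition gen_exp ::
  "real \<Rightarrow> (nat \<Rightarrow> 'a \<Rightarrow> real) \<Rightarrow> (nat \<Rightarrow> real \<Rightarrow> real) \<Rightarrow> (nat \<Rightarrow> nat) \<Rightarrow> real" where
  "gen_exp s F h a = (1 + real (weight a)) powr (- s) * innerD s F (\<lambda>_. HH h a)"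

definition gen_mean :: "real \<Rightarrow> (nat \<Rightarrow> 'a \<Rightarrow> real) \<Rightarrow> real" where
  "gen_mean s F = innerD s F (\<lambda>_ _. 1)"

definition \<Delta>W :: "real \<Rightarrow> nat \<Rightarrow> nat \<Rightarrow> 'a \<Rightarrow> real" where
  "\<Delta>W T N i \<omega> = W (real i * T / N) \<omega> - W ((real i - 1) * T / N) \<omega>"

definition grid_span :: "real \<Rightarrow> nat \<Rightarrow> ('a \<Rightarrow> real) set" where
  "grid_span T N = {(\<lambda>\<omega>. \<Sum>a\<in>A. c a * HH (grid_h T N) a \<omega>) | A c.
     finite A \<and> A \<subseteq> multi_index N}"

definition \<D>N :: "real \<Rightarrow> real \<Rightarrow> nat \<Rightarrow> (nat \<Rightarrow> 'a \<Rightarrow> real) set" where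
  "\<D>N s T N = {F \<in> \<D> s. \<forall>\<epsilon>>0. \<exists>G\<in>grid_span T N. normD s (\<lambda>k \<omega>. F k \<omega> - G \<omega>) < \<epsilon>}"

text \<open>The series defining the generalized conditional expectation given the first \<open>l\<close> increments
  converges unconditionally in \<open>\<D> s\<close>; its sum is represented by the sequence of the partial sums
  over all multi-indices \<open>a\<close> of length \<open>l\<close> with \<open>weight a \<le> k\<close>.\<close>

definition gen_cond_exp ::
  "real \<Rightarrow> real \<Rightarrow> nat \<Rightarrow> nat \<Rightarrow> (nat \<Rightarrow> 'a \<Rightarrow> real) \<Rightarrow> nat \<Rightarrow> 'a \<Rightarrow> real" where
  "gen_cond_exp s T N l F = (\<lambda>k \<omega>. \<Sum>a | a \<in> multi_index l \<and> weight a \<le> k.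
     gen_exp s F (grid_h T N) a * HH (grid_h T N) a \<omega>)"

definition deriv_\<Delta>W ::
  "real \<Rightarrow> nat \<Rightarrow> nat \<Rightarrow> (nat \<Rightarrow> 'a \<Rightarrow> real) \<Rightarrow> nat \<Rightarrow> 'a \<Rightarrow> real" where
  "deriv_\<Delta>W T N l F = (\<lambda>k \<omega>. (T / N) powr (- 1 / 2) * dir_deriv (grid_h T N l) (F k) \<omega>)"

text \<open>For \<open>F \<in> \<D> s\<close> the \<open>m\<close>-th derivative lies in \<open>\<D> (s - m)\<close>, hence the index \<open>s - m\<close>
  of the conditional expectation.\<close>

definition Err ::
  "real \<Rightarrow> real \<Rightarrow> nat \<Rightarrow> nat \<Rightarrow> (nat \<Rightarrow> 'a \<Rightarrow> real) \<Rightarrow> nat \<Rightarrow> 'a \<Rightarrow> real" where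
  "Err s T N n F = (\<lambda>k \<omega>. F k \<omega> - (gen_mean s F +
     (\<Sum>m=1..n. \<Sum>l=1..N. (T / N) powr (real m / 2) / sqrt (fact m) *
        gen_cond_exp (s - real m) T N (l - 1) ((deriv_\<Delta>W T N l ^^ m) F) k \<omega> *
        hermite m (\<Delta>W T N l \<omega> / sqrt (T / N)))))"

end

end

theory Submission
  imports Defs
begin

text \<open>Everything rests on Gaussian integration by parts \<open>E[p(X) W(g)] = E[D\<^sub>g p(X)]\<close> for polynomials in
  Wiener integrals, which follows by polarization from the moments of a single Wiener integral.  It
  shows that the derivative and the Ornstein--Uhlenbeck operator do not depend on the chosen
  representation, that \<open>L\<close> is symmetric, and that Hermite products are orthonormal eigenfunctions.

  In the expansion along the fine grid the error keeps exactly the terms whose multi-index \<open>b\<close> has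
  last nonzero entry greater than \<open>n\<close>.  If \<open>F\<close> lives on the coarse grid, its coefficient at \<open>b\<close> is
  the coarse coefficient at the vector \<open>a\<close> of block sums of \<open>b\<close>, times a factor whose square is the
  probability that throwing \<open>a i\<close> balls uniformly into the \<open>N1\<close> cells of each block \<open>i\<close> produces
  \<open>b\<close>.  Removing \<open>n\<close> balls from the last nonempty cell shows that this cell holds more than \<open>n\<close>
  balls with probability at most \<open>(a i choose n) / N1^n\<close>, hence at most
  \<open>K = (1 + |a|)^n / (n! N1^n)\<close>.  Being at most 1 as well, the probability is at most \<open>K powr r\<close>,
  and summing over \<open>a\<close> gives the estimate without any interpolation theory.\<close>

section \<open>Hermite polynomials\<close>

text \<open>Wiener integrals, the derivative, \<open>L\<close> and the powers of
  \<open>I - L\<close> are all given by choice, so every identity holds only up to null sets and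
  must not depend on the chosen representation. The integrands of a representation may be linearly
  dependent: there may be no joint density, and a polynomial that vanishes almost surely need not be
  the zero polynomial. For this reason only the laws of single linear combinations are used, and a
  polynomial that vanishes almost surely is differentiated by moving the operator to the other
  factor of an expectation. A second obstacle is that elements of \<open>\<D> s\<close> are
  sequences: the \<open>k\<close>-th term of \<open>Err\<close> subtracts a truncated sum from an
  arbitrary approximant \<open>F k\<close>, and the truncation is by the weight of the conditioning
  index \<open>a\<close>, not of \<open>(a, m)\<close>. This term is compared in norm with the sum
  over the kept indices of weight at most \<open>k\<close>, whose norm is then a sum of squares of
  coefficients.\<close>

fun He :: "nat \<Rightarrow> real \<Rightarrow> real" where
  "He 0 x = 1"
| "He (Suc 0) x = x"
| "He (Suc (Suc m)) x = x * He (Suc m) x - real (Suc m) * He m x"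

text \<open>At \<open>m = 0\<close> the truncated predecessor is harmless because its coefficient
  vanishes. All lowering formulas below rely on this convention.\<close>

lemma He_Suc: "He (Suc m) x = x * He m x - real m * He (m - 1) x"
  by (cases m) auto

lemma DERIV_He: "(He m has_field_derivative real m * He (m - 1) x) (at x)"
proof (induction m arbitrary: x rule: induct_nat_012)
  case 0
  have "He 0 = (\<lambda>x. 1)" by auto
  then show ?case by simp
next
  case 1
  have "He (Suc 0) = (\<lambda>x. x)" by auto
  then show ?case by simp
next
  case (ge2 m)
  have eq: "He (Suc (Suc m)) = (\<lambda>x. x * He (Suc m) x - real (Suc m) * He m x)" by auto
  show ?case unfolding eq
    by (rule derivative_eq_intros refl ge2)+ (simp add: He_Suc[of m] algebra_simps)
qed

text \<open>Differentiating \<open>He m\<close> times the weight gives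
  \<open>m * He (m - 1) - y * He m = - He (Suc m)\<close> times the weight, whence the alternating
  sign.\<close>

lemma deriv_iter_gauss:
  "(deriv ^^ m) (\<lambda>y::real. exp (- y\<^sup>2 / 2)) = (\<lambda>y. (-1) ^ m * He m y * exp (- y\<^sup>2 / 2))"
proof (induction m)
  case (Suc m)
  have "deriv (\<lambda>y. (-1) ^ m * He m y * exp (- y\<^sup>2 / 2)) y
      = (-1) ^ Suc m * He (Suc m) y * exp (- y\<^sup>2 / 2)" for y
  proof (rule DERIV_imp_deriv)
    have e: "((\<lambda>y. exp (- y\<^sup>2 / 2)) has_field_derivative - y * exp (- y\<^sup>2 / 2)) (at y)"
      by (auto intro!: derivative_eq_intros)
    show "((\<lambda>y. (-1) ^ m * He m y * exp (- y\<^sup>2 / 2)) has_field_derivative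
        (-1) ^ Suc m * He (Suc m) y * exp (- y\<^sup>2 / 2)) (at y)"
      using DERIV_mult[OF DERIV_cmult[OF DERIV_He, of "(-1) ^ m"] e]
      by (simp add: He_Suc algebra_simps)
  qed
  then show ?case using Suc by simp
qed simp

lemma hermite_He: "hermite m x = He m x / sqrt (fact m)"
proof -
  have "hermite m x = ((-1) ^ m * (-1) ^ m) * (exp (x\<^sup>2 / 2) * exp (- x\<^sup>2 / 2)) * He m x / sqrt (fact m)"
    unfolding hermite_def deriv_iter_gauss by (simp add: field_simps)
  also have "exp (x\<^sup>2 / 2) * exp (- x\<^sup>2 / 2) = 1" by (simp flip: exp_add)
  also have "(-1::real) ^ m * (-1) ^ m = 1" by (simp flip: power_mult_distrib)
  finally show ?thesis by simp
qed

lemma hermite_0 [simp]: "hermite 0 x = 1"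
  by (simp add: hermite_He)

lemma hermite_1: "hermite (Suc 0) x = x"
  by (simp add: hermite_He)

text \<open>The normalization by \<open>sqrt (fact m)\<close> turns the recursion coefficients into
  square roots: multiplication by \<open>x\<close> is the sum of a raising and a lowering operator,
  and the lowering one is the derivative, see \<open>DERIV_hermite\<close>.\<close>

lemma hermite_three_term:
  "x * hermite m x = sqrt (Suc m) * hermite (Suc m) x + sqrt m * hermite (m - 1) x"
proof (cases m)
  case (Suc k)
  have "x * He m x = He (Suc m) x + real m * He (m - 1) x" using He_Suc[of m x] by simp
  moreover have "sqrt (fact (Suc m)) = sqrt (Suc m) * sqrt (fact m)"
    "sqrt (fact m) = sqrt m * sqrt (fact k)" "real m = sqrt m * sqrt m"
    using Suc by (simp_all add: real_sqrt_mult)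
  moreover have "sqrt (fact k) > 0" "sqrt m > 0" "sqrt (Suc m) > 0" using Suc by auto
  ultimately show ?thesis using Suc unfolding hermite_He
    by (simp add: divide_simps del: fact_Suc)
qed (simp add: hermite_1)

lemma DERIV_hermite: "(hermite m has_field_derivative sqrt m * hermite (m - 1) x) (at x)"
proof (cases m)
  case 0
  have "hermite 0 = (\<lambda>x. 1)" by auto
  then show ?thesis using 0 by simp
next
  case (Suc k)
  have eq: "hermite m = (\<lambda>x. He m x / sqrt (fact m))" by (auto simp: hermite_He)
  have "real m / sqrt (fact m) = sqrt m / sqrt (fact k)"
  proof -
    have "sqrt (fact m) = sqrt m * sqrt (fact k)" "real m = sqrt m * sqrt m" "sqrt m > 0"
      using Suc by (simp_all add: real_sqrt_mult)
    then show ?thesis by (simp add: field_simps)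
  qed
  then have "real m * He (m - 1) x / sqrt (fact m) = sqrt m * (He (m - 1) x / sqrt (fact k))"
    by (metis (no_types, lifting) mult.commute times_divide_eq_left times_divide_eq_right)
  then have *: "real m * He (m - 1) x / sqrt (fact m) = sqrt m * hermite (m - 1) x"
    using Suc by (simp add: hermite_He del: fact_Suc)
  show ?thesis unfolding eq *[symmetric] by (rule DERIV_cdivide[OF DERIV_He])
qed

text \<open>Hermite's equation \<open>f'' - x * f' = - m * f\<close>, with the derivatives already
  replaced by lowered functions, which is how they arise from \<open>partial_hprod\<close>.\<close>

lemma hermite_ode:
  "sqrt m * (sqrt (real (m - 1)) * hermite (m - 1 - 1) x) - x * (sqrt m * hermite (m - 1) x) = - real m * hermite m x"
proof (cases m)
  case (Suc k)
  have "sqrt m * (x * hermite k x)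
      = sqrt m * (sqrt m * hermite m x + sqrt k * hermite (k - 1) x)"
    using hermite_three_term[of x k] Suc by simp
  moreover have "sqrt m * (sqrt m * hermite m x) = real m * hermite m x"
    by (metis abs_of_nat mult.assoc real_sqrt_mult_self)
  ultimately show ?thesis using Suc by (simp add: algebra_simps)
qed simp

section \<open>Polynomial functions\<close>

definition monom_fun :: "nat \<Rightarrow> (nat \<Rightarrow> nat) \<Rightarrow> (nat \<Rightarrow> real) \<Rightarrow> real" where
  "monom_fun k a x = (\<Prod>i<k. x i ^ a i)"

text \<open>An upper bound on the total degree, on which the spectral decomposition is an induction.
  A predicate on some representation avoids any discussion of uniqueness of coefficients.\<close>

definition poly_deg :: "nat \<Rightarrow> nat \<Rightarrow> ((nat \<Rightarrow> real) \<Rightarrow> real) \<Rightarrow> bool" where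
  "poly_deg k d p \<longleftrightarrow> (\<exists>A c. finite A \<and> (\<forall>a\<in>A. (\<Sum>i<k. a i) \<le> d) \<and>
     p = (\<lambda>x. \<Sum>a\<in>A. c a * monom_fun k a x))"

lemma poly_deg_induct [consumes 1, case_names zero add]:
  assumes "poly_deg k d p"
    and zero: "Q (\<lambda>_. 0)"
    and add: "\<And>a c q. (\<Sum>i<k. a i) \<le> d \<Longrightarrow> poly_deg k d q \<Longrightarrow> Q q
      \<Longrightarrow> Q (\<lambda>x. c * monom_fun k a x + q x)"
  shows "Q p"
proof -
  obtain A c where A: "finite A" "\<forall>a\<in>A. (\<Sum>i<k. a i) \<le> d"
    and p: "p = (\<lambda>x. \<Sum>a\<in>A. c a * monom_fun k a x)"
    using assms(1) by (auto simp: poly_deg_def)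
  from A have "Q (\<lambda>x. \<Sum>a\<in>A. c a * monom_fun k a x)"
  proof (induction A)
    case (insert a A)
    have "poly_deg k d (\<lambda>x. \<Sum>a\<in>A. c a * monom_fun k a x)"
      using insert by (auto simp: poly_deg_def)
    with insert show ?case using add[of a] by auto
  qed (simp add: zero)
  with p show ?thesis by simp
qed

lemma poly_deg_zero: "poly_deg k d (\<lambda>_. 0)"
  unfolding poly_deg_def by (rule exI[of _ "{}"]) auto

lemma poly_deg_monom: "(\<Sum>i<k. a i) \<le> d \<Longrightarrow> poly_deg k d (\<lambda>x. c * monom_fun k a x)"
  unfolding poly_deg_def by (rule exI[of _ "{a}"], rule exI[of _ "\<lambda>_. c"]) auto

lemma poly_deg_add:
  assumes "poly_deg k d p" "poly_deg k d q"
  shows "poly_deg k d (\<lambda>x. p x + q x)"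
proof -
  obtain A c B e where *: "finite A" "\<forall>a\<in>A. (\<Sum>i<k. a i) \<le> d"
      "p = (\<lambda>x. \<Sum>a\<in>A. c a * monom_fun k a x)"
      "finite B" "\<forall>a\<in>B. (\<Sum>i<k. a i) \<le> d" "q = (\<lambda>x. \<Sum>a\<in>B. e a * monom_fun k a x)"
    using assms unfolding poly_deg_def by (elim exE conjE) (rule that)
  have "p x + q x = (\<Sum>a\<in>A \<union> B. ((if a \<in> A then c a else 0) + (if a \<in> B then e a else 0)) * monom_fun k a x)" for x
  proof -
    have "p x = (\<Sum>a\<in>A \<union> B. (if a \<in> A then c a else 0) * monom_fun k a x)"
      unfolding *(3) by (rule sum.mono_neutral_cong_left) (use * in auto)
    moreover have "q x = (\<Sum>a\<in>A \<union> B. (if a \<in> B then e a else 0) * monom_fun k a x)"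
      unfolding *(6) by (rule sum.mono_neutral_cong_left) (use * in auto)
    ultimately show ?thesis by (simp add: sum.distrib algebra_simps)
  qed
  with * show ?thesis unfolding poly_deg_def
    by (intro exI[of _ "A \<union> B"] exI[of _ "\<lambda>a. (if a \<in> A then c a else 0) + (if a \<in> B then e a else 0)"]) auto
qed

lemma poly_deg_scale:
  assumes "poly_deg k d p"
  shows "poly_deg k d (\<lambda>x. c * p x)"
  using assms
proof (induction rule: poly_deg_induct)
  case (add a e q)
  have "(\<lambda>x. c * (e * monom_fun k a x + q x)) = (\<lambda>x. (c * e) * monom_fun k a x + c * q x)"
    by (auto simp: algebra_simps)
  then show ?case using add by (auto intro: poly_deg_add poly_deg_monom)
qed (simp add: poly_deg_zero)

lemma poly_deg_mono: "poly_deg k d p \<Longrightarrow> d \<le> e \<Longrightarrow> poly_deg k e p"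
  unfolding poly_deg_def by (elim exE conjE) (intro exI conjI, auto)

lemma poly_deg_sum: "(\<And>i. i \<in> I \<Longrightarrow> poly_deg k d (p i)) \<Longrightarrow> poly_deg k d (\<lambda>x. \<Sum>i\<in>I. p i x)"
  by (induction I rule: infinite_finite_induct) (auto intro: poly_deg_zero poly_deg_add)

lemma monom_fun_mult: "monom_fun k a x * monom_fun k b x = monom_fun k (\<lambda>i. a i + b i) x"
  by (simp add: monom_fun_def power_add prod.distrib)

lemma poly_deg_mult:
  assumes "poly_deg k d p" "poly_deg k e q"
  shows "poly_deg k (d + e) (\<lambda>x. p x * q x)"
  using assms(1)
proof (induction rule: poly_deg_induct)
  case (add a c r)
  have "poly_deg k (d + e) (\<lambda>x. monom_fun k a x * q x)"
    using assms(2)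
  proof (induction rule: poly_deg_induct)
    case (add b c' r)
    have "(\<lambda>x. monom_fun k a x * (c' * monom_fun k b x + r x))
      = (\<lambda>x. c' * monom_fun k (\<lambda>i. a i + b i) x + monom_fun k a x * r x)"
      by (auto simp: algebra_simps monom_fun_mult[symmetric])
    moreover have "(\<Sum>i<k. a i + b i) \<le> d + e"
      using add \<open>(\<Sum>i<k. a i) \<le> d\<close> by (simp add: sum.distrib)
    ultimately show ?case using add by (auto intro!: poly_deg_add poly_deg_monom)
  qed (simp add: poly_deg_zero)
  from poly_deg_add[OF poly_deg_scale[OF this, of c] add.IH]
  show ?case by (simp add: algebra_simps)
qed (simp add: poly_deg_zero)

lemma poly_fun_deg: "poly_fun k p \<longleftrightarrow> (\<exists>d. poly_deg k d p)"
proof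
  assume "poly_fun k p"
  then obtain A :: "(nat \<Rightarrow> nat) set" and c where A: "finite A"
    "p = (\<lambda>x. \<Sum>a\<in>A. c a * monom_fun k a x)"
    by (auto simp: poly_fun_def monom_fun_def)
  \<comment> \<open>Any common bound will do; each degree is at most the sum of all of them.\<close>
  then have "poly_deg k (\<Sum>a\<in>A. \<Sum>i<k. a i) p" unfolding poly_deg_def
    by (intro exI[of _ A] exI[of _ c]) (auto intro!: member_le_sum)
  then show "\<exists>d. poly_deg k d p" ..
next
  assume "\<exists>d. poly_deg k d p"
  then show "poly_fun k p" unfolding poly_fun_def poly_deg_def monom_fun_def by blast
qed

lemma poly_fun_const [intro, simp]: "poly_fun k (\<lambda>_. c)"
proof -
  have "poly_deg k 0 (\<lambda>x. c * monom_fun k (\<lambda>_. 0) x)" by (rule poly_deg_monom) simp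
  then show ?thesis by (auto simp: monom_fun_def poly_fun_deg)
qed

lemma poly_fun_var:
  assumes "i < k" shows "poly_fun k (\<lambda>x. x i)"
proof -
  have *: "monom_fun k (\<lambda>j. if j = i then 1 else 0) x = x i" for x
  proof -
    have "monom_fun k (\<lambda>j. if j = i then 1 else 0) x = (\<Prod>j<k. if j = i then x i else 1)"
      unfolding monom_fun_def by (rule prod.cong) auto
    also have "\<dots> = x i" using assms by (subst prod.delta) auto
    finally show ?thesis .
  qed
  have "poly_deg k 1 (\<lambda>x. 1 * monom_fun k (\<lambda>j. if j = i then 1 else 0) x)"
    using assms by (intro poly_deg_monom) (simp add: sum.delta)
  then show ?thesis unfolding * by (auto simp: poly_fun_deg)
qed

lemma poly_fun_add: "poly_fun k p \<Longrightarrow> poly_fun k q \<Longrightarrow> poly_fun k (\<lambda>x. p x + q x)"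
  unfolding poly_fun_deg
proof (elim exE)
  fix d e assume "poly_deg k d p" "poly_deg k e q"
  then show "\<exists>d. poly_deg k d (\<lambda>x. p x + q x)"
    by (intro exI[of _ "max d e"] poly_deg_add) (auto elim: poly_deg_mono)
qed

lemma poly_fun_mult: "poly_fun k p \<Longrightarrow> poly_fun k q \<Longrightarrow> poly_fun k (\<lambda>x. p x * q x)"
  unfolding poly_fun_deg using poly_deg_mult by blast

lemma poly_fun_diff: "poly_fun k p \<Longrightarrow> poly_fun k q \<Longrightarrow> poly_fun k (\<lambda>x. p x - q x)"
  using poly_fun_add[OF _ poly_fun_mult[OF poly_fun_const[of _ "-1"]], of k p q] by simp

lemma poly_fun_sum: "(\<And>i. i \<in> I \<Longrightarrow> poly_fun k (p i)) \<Longrightarrow> poly_fun k (\<lambda>x. \<Sum>i\<in>I. p i x)"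
  by (induction I rule: infinite_finite_induct) (auto intro: poly_fun_add)

lemma poly_fun_prod: "(\<And>i. i \<in> I \<Longrightarrow> poly_fun k (p i)) \<Longrightarrow> poly_fun k (\<lambda>x. \<Prod>i\<in>I. p i x)"
  by (induction I rule: infinite_finite_induct) (auto intro: poly_fun_mult)

lemma poly_fun_power: "poly_fun k p \<Longrightarrow> poly_fun k (\<lambda>x. p x ^ n)"
  by (induction n) (auto intro: poly_fun_mult)

lemma poly_fun_induct [consumes 1, case_names zero add]:
  assumes "poly_fun k p" and "Q (\<lambda>_. 0)"
    and "\<And>a c q. poly_fun k q \<Longrightarrow> Q q \<Longrightarrow> Q (\<lambda>x. c * monom_fun k a x + q x)"
  shows "Q p"
proof -
  obtain d where "poly_deg k d p" using assms(1) by (auto simp: poly_fun_deg)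
  then show ?thesis using assms(2,3)
    by (induction rule: poly_deg_induct) (auto simp: poly_fun_deg)
qed

lemma poly_fun_subst:
  assumes "poly_fun k p" "\<And>i. i < k \<Longrightarrow> poly_fun m (q i)"
  shows "poly_fun m (\<lambda>x. p (\<lambda>i. q i x))"
  using assms(1)
  by (induction rule: poly_fun_induct)
    (auto simp: monom_fun_def
      intro!: poly_fun_add poly_fun_mult[OF poly_fun_const] poly_fun_prod poly_fun_power assms(2))

lemma poly_fun_mono: "poly_fun k p \<Longrightarrow> k \<le> m \<Longrightarrow> poly_fun m p"
  using poly_fun_subst[of k p m "\<lambda>i x. x i"] poly_fun_var[of _ m] by simp

lemma poly_fun_shift: "poly_fun k p \<Longrightarrow> poly_fun (m + k) (\<lambda>x. p (\<lambda>i. x (m + i)))"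
  by (erule poly_fun_subst) (auto intro: poly_fun_var)

lemma poly_fun_cong:
  assumes "poly_fun k p" "\<And>i. i < k \<Longrightarrow> x i = y i"
  shows "p x = p y"
  using assms(1)
proof (induction rule: poly_fun_induct)
  case (add a c q)
  have "monom_fun k a x = monom_fun k a y" using assms(2) by (simp add: monom_fun_def)
  with add show ?case by simp
qed simp

lemma poly_fun_hermite: "i < k \<Longrightarrow> poly_fun k (\<lambda>x. hermite m (x i))"
proof -
  assume i: "i < k"
  have "poly_fun k (\<lambda>x. He m (x i))"
  proof (induction m rule: induct_nat_012)
    case (ge2 n)
    then show ?case
      by (auto intro!: poly_fun_diff poly_fun_mult poly_fun_var i)
  qed (auto intro: poly_fun_var i)
  from poly_fun_mult[OF poly_fun_const this, of "1 / sqrt (fact m)"] show ?thesis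
    by (simp add: hermite_He)
qed

section \<open>Partial derivatives of polynomial functions\<close>

lemma partial_eqI:
  "((\<lambda>t. p (x(i := t))) has_field_derivative D) (at (x i)) \<Longrightarrow> partial i p x = D"
  unfolding partial_def by (rule DERIV_imp_deriv)

lemma has_partial_monom:
  "((\<lambda>t. monom_fun k a (x(i := t))) has_field_derivative
     (if i < k then real (a i) * monom_fun k (a(i := a i - 1)) x else 0)) (at (x i))"
proof (cases "i < k")
  case True
  have split: "monom_fun k b y = y i ^ b i * (\<Prod>j\<in>{..<k} - {i}. y j ^ b j)" for b y
    unfolding monom_fun_def using True by (subst prod.remove[of _ i]) auto
  have 1: "(\<lambda>t. monom_fun k a (x(i := t))) = (\<lambda>t. t ^ a i * (\<Prod>j\<in>{..<k} - {i}. x j ^ a j))"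
    unfolding split by (auto intro!: prod.cong)
  have 2: "monom_fun k (a(i := a i - 1)) x = x i ^ (a i - 1) * (\<Prod>j\<in>{..<k} - {i}. x j ^ a j)"
    unfolding split by (auto intro!: prod.cong)
  show ?thesis unfolding 1 2 using True by (auto intro!: derivative_eq_intros)
next
  case False
  then have "(\<lambda>t. monom_fun k a (x(i := t))) = (\<lambda>t. monom_fun k a x)"
    by (auto simp: monom_fun_def intro!: prod.cong)
  then show ?thesis using False by simp
qed

lemma partial_monom:
  "partial i (monom_fun k a) x = (if i < k then real (a i) * monom_fun k (a(i := a i - 1)) x else 0)"
  by (rule partial_eqI, rule has_partial_monom)

lemma has_partial:
  assumes "poly_fun k p"
  shows "((\<lambda>t. p (x(i := t))) has_field_derivative partial i p x) (at (x i))"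
proof -
  have "\<exists>D. ((\<lambda>t. p (x(i := t))) has_field_derivative D) (at (x i))"
    using assms
  proof (induction rule: poly_fun_induct)
    case (add a c q)
    then obtain D where "((\<lambda>t. q (x(i := t))) has_field_derivative D) (at (x i))" by blast
    from DERIV_add[OF DERIV_cmult[OF has_partial_monom[of k a x i], of c] this] show ?case by blast
  qed (rule exI, rule DERIV_const)
  then show ?thesis using partial_eqI by blast
qed

lemma partial_add:
  "poly_fun k p \<Longrightarrow> poly_fun k q \<Longrightarrow> partial i (\<lambda>x. p x + q x) = (\<lambda>x. partial i p x + partial i q x)"
  by (auto intro!: ext partial_eqI derivative_eq_intros has_partial)

lemma partial_mult:
  "poly_fun k p \<Longrightarrow> poly_fun k q \<Longrightarrow>
    partial i (\<lambda>x. p x * q x) = (\<lambda>x. partial i p x * q x + p x * partial i q x)"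
  by (auto intro!: ext partial_eqI derivative_eq_intros has_partial)

lemma partial_const [simp]: "partial i (\<lambda>_. c) = (\<lambda>_. 0)"
  by (auto intro!: ext partial_eqI)

lemma partial_scale: "poly_fun k p \<Longrightarrow> partial i (\<lambda>x. c * p x) = (\<lambda>x. c * partial i p x)"
  by (auto intro!: ext partial_eqI derivative_eq_intros has_partial)

lemma partial_var: "partial i (\<lambda>x. x j) = (\<lambda>_. if i = j then 1 else 0)"
  by (auto intro!: ext partial_eqI)

lemma partial_ge: "poly_fun k p \<Longrightarrow> k \<le> i \<Longrightarrow> partial i p = (\<lambda>_. 0)"
proof (rule ext, rule partial_eqI)
  fix x assume p: "poly_fun k p" "k \<le> i"
  have "(\<lambda>t. p (x(i := t))) = (\<lambda>t. p x)"
    by (rule ext, rule poly_fun_cong[OF p(1)]) (use p in auto)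
  then show "((\<lambda>t. p (x(i := t))) has_field_derivative 0) (at (x i))" by simp
qed

text \<open>For the concatenation of two tuples of integrands: the second polynomial then reads its
  variables from position \<open>m\<close> on.\<close>

lemma partial_shift:
  assumes "poly_fun k p"
  shows "partial i (\<lambda>x. p (\<lambda>j. x (m + j)))
    = (\<lambda>x. if i < m then 0 else partial (i - m) p (\<lambda>j. x (m + j)))"
proof (rule ext, rule partial_eqI)
  fix x
  show "((\<lambda>t. p (\<lambda>j. (x(i := t)) (m + j))) has_field_derivative
      (if i < m then 0 else partial (i - m) p (\<lambda>j. x (m + j)))) (at (x i))"
  proof (cases "i < m")
    case False
    then have "(\<lambda>j. (x(i := t)) (m + j)) = (\<lambda>j. x (m + j))(i - m := t)" for t
      by (auto simp: fun_eq_iff)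
    then show ?thesis using has_partial[OF assms, of "\<lambda>j. x (m + j)" "i - m"] False by simp
  qed simp
qed

lemma poly_deg_partial:
  assumes "poly_deg k d p" shows "poly_deg k (d - 1) (partial i p)"
  using assms
proof (induction rule: poly_deg_induct)
  case (add a c q)
  have *: "partial i (\<lambda>x. c * monom_fun k a x + q x)
    = (\<lambda>x. c * partial i (monom_fun k a) x + partial i q x)"
    using add by (subst partial_add[of k]; (subst partial_scale[of k])?)
      (auto simp: poly_fun_deg intro: poly_deg_monom[where c = 1, simplified] poly_deg_scale)
  have "poly_deg k (d - 1) (partial i (monom_fun k a))"
  proof (cases "i < k \<and> 0 < a i")
    case True
    have "(\<Sum>j<k. (a(i := a i - 1)) j) = (\<Sum>j<k. a j) - 1"
      using True by (subst (1 2) sum.remove[of _ i]) auto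
    then have "poly_deg k (d - 1) (\<lambda>x. real (a i) * monom_fun k (a(i := a i - 1)) x)"
      using add by (intro poly_deg_monom) auto
    moreover have "partial i (monom_fun k a) = (\<lambda>x. real (a i) * monom_fun k (a(i := a i - 1)) x)"
      using True by (auto simp: partial_monom)
    ultimately show ?thesis by simp
  next
    case False
    then have "partial i (monom_fun k a) = (\<lambda>_. 0)" by (auto simp: partial_monom)
    then show ?thesis by (simp add: poly_deg_zero)
  qed
  then show ?case unfolding * by (intro poly_deg_add poly_deg_scale add.IH)
qed (simp add: poly_deg_zero)

lemma poly_fun_partial: "poly_fun k p \<Longrightarrow> poly_fun k (partial i p)"
  unfolding poly_fun_deg using poly_deg_partial by blast

section \<open>The Ornstein--Uhlenbeck operator on polynomial functions\<close>

text \<open>The matrix \<open>C\<close> stands for the inner products of the integrands. Leaving it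
  abstract makes the algebra of the operator independent of probability.\<close>

definition OUp :: "nat \<Rightarrow> (nat \<Rightarrow> nat \<Rightarrow> real) \<Rightarrow> ((nat \<Rightarrow> real) \<Rightarrow> real) \<Rightarrow> (nat \<Rightarrow> real) \<Rightarrow> real" where
  "OUp k C p x = (\<Sum>i<k. \<Sum>j<k. partial i (partial j p) x * C i j) - (\<Sum>i<k. partial i p x * x i)"

lemma OUp_add:
  assumes "poly_fun k p" "poly_fun k q"
  shows "OUp k C (\<lambda>x. p x + q x) = (\<lambda>x. OUp k C p x + OUp k C q x)"
  unfolding OUp_def using assms
  by (simp add: partial_add[where k = k] poly_fun_partial sum.distrib algebra_simps)

lemma OUp_scale: "poly_fun k p \<Longrightarrow> OUp k C (\<lambda>x. c * p x) = (\<lambda>x. c * OUp k C p x)"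
  unfolding OUp_def
  by (simp add: partial_scale[where k = k] poly_fun_partial sum_distrib_left algebra_simps)

lemma poly_fun_OUp: "poly_fun k p \<Longrightarrow> poly_fun k (OUp k C p)"
  unfolding OUp_def
  by (auto intro!: poly_fun_diff poly_fun_sum poly_fun_mult poly_fun_partial poly_fun_var)

lemma poly_fun_monom: "poly_fun k (monom_fun k a)"
  using poly_deg_monom[where a = a and k = k and c = 1, OF order_refl] by (auto simp: poly_fun_deg)

lemma OUp_0: "OUp k C (\<lambda>_. 0) = (\<lambda>_. 0)"
  by (rule ext) (simp add: OUp_def)

text \<open>Euler's identity for homogeneous functions: the drift of \<open>OUp\<close> multiplies a
  monomial by minus its degree, which is where the eigenvalues come from.\<close>

lemma monom_fun_euler: "(\<Sum>i<k. partial i (monom_fun k a) x * x i) = real (\<Sum>i<k. a i) * monom_fun k a x"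
proof -
  have "partial i (monom_fun k a) x * x i = real (a i) * monom_fun k a x" if "i < k" for i
  proof (cases "a i = 0")
    case False
    have "monom_fun k (a(i := a i - 1)) x * x i = x i ^ (a i - 1) * x i * (\<Prod>j\<in>{..<k} - {i}. x j ^ a j)"
      unfolding monom_fun_def using that by (subst prod.remove[of _ i]) auto
    also have "\<dots> = monom_fun k a x"
      unfolding monom_fun_def using that False
      by (subst (2) prod.remove[of _ i]) (simp_all flip: power_Suc2)
    finally show ?thesis using that by (simp add: partial_monom)
  qed (use that in \<open>simp add: partial_monom\<close>)
  then show ?thesis by (simp add: sum_distrib_right)
qed

text \<open>The second-order part lowers the degree and the drift multiplies a monomial of degree
  \<open>e\<close> by \<open>- e\<close>, so adding \<open>d\<close> times the polynomial cancels
  the terms of degree \<open>d\<close>.\<close>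

lemma poly_deg_OUp:
  assumes "poly_deg k d p"
  shows "poly_deg k (d - 1) (\<lambda>x. OUp k C p x + real d * p x)"
  using assms
proof (induction rule: poly_deg_induct)
  case (add a c q)
  have pq: "poly_fun k q" using add by (auto simp: poly_fun_deg)
  have pm: "poly_fun k (\<lambda>x. c * monom_fun k a x)" by (intro poly_fun_mult poly_fun_monom) simp
  let ?m = "monom_fun k a"
  have dm: "poly_deg k d ?m" using add poly_deg_monom[where a = a and k = k and c = 1 and d = d] by simp
  have "poly_deg k (d - 1) (\<lambda>x. OUp k C ?m x + real d * ?m x)"
  proof -
    have "poly_deg k (d - 1) (\<lambda>x. \<Sum>i<k. \<Sum>j<k. partial i (partial j ?m) x * C i j)"
      using poly_deg_scale[OF poly_deg_mono[OF poly_deg_partial[OF poly_deg_partial[OF dm]], of "d - 1"]]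
      by (intro poly_deg_sum) (simp add: mult.commute)
    \<comment> \<open>A monomial of degree exactly \<open>d\<close> gets the coefficient zero; any
      other one has degree at most \<open>d - 1\<close> already.\<close>
    moreover have "poly_deg k (d - 1) (\<lambda>x. (real d - real (\<Sum>i<k. a i)) * ?m x)"
    proof (cases "(\<Sum>i<k. a i) = d")
      case True
      then show ?thesis by (simp add: poly_deg_zero)
    next
      case False
      then show ?thesis using add by (intro poly_deg_monom) simp
    qed
    ultimately have "poly_deg k (d - 1) (\<lambda>x. (\<Sum>i<k. \<Sum>j<k. partial i (partial j ?m) x * C i j)
        + (real d - real (\<Sum>i<k. a i)) * ?m x)" by (rule poly_deg_add)
    then show ?thesis unfolding OUp_def monom_fun_euler by (simp add: algebra_simps)
  qed
  from poly_deg_add[OF poly_deg_scale[OF this, of c] add.IH] show ?case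
    unfolding OUp_add[OF pm pq] OUp_scale[OF poly_fun_monom] by (simp add: algebra_simps)
qed (simp add: poly_deg_zero OUp_0)

lemma poly_deg_0_const:
  assumes "poly_deg k 0 p" shows "\<exists>c. p = (\<lambda>_. c)"
  using assms
proof (induction rule: poly_deg_induct)
  case (add a c q)
  then have "monom_fun k a = (\<lambda>_. 1)" by (auto simp: monom_fun_def)
  with add show ?case by auto
qed auto

lemma OUp_deg_0: "poly_deg k 0 p \<Longrightarrow> OUp k C p = (\<lambda>_. 0)"
  using poly_deg_0_const[of k p] by (intro ext) (auto simp: OUp_def)

text \<open>If \<open>G j\<close> are the components of \<open>(L + d) p\<close>, which has lower degree, then those of \<open>p\<close> below
  \<open>d\<close> are \<open>G j / (d - j)\<close>, and the rest of \<open>p\<close> is killed by \<open>L + d\<close>.\<close>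

lemma poly_eigen_decomposition:
  assumes "poly_deg k d p"
  shows "\<exists>f. (\<forall>m\<le>d. poly_fun k (f m) \<and> OUp k C (f m) = (\<lambda>x. - real m * f m x)) \<and> p = (\<lambda>x. \<Sum>m\<le>d. f m x)"
  using assms
proof (induction d arbitrary: p)
  case 0
  then show ?case by (intro exI[of _ "\<lambda>_. p"]) (auto simp: OUp_deg_0 poly_fun_deg)
next
  case (Suc d)
  have pp: "poly_fun k p" using Suc.prems by (auto simp: poly_fun_deg)
  from poly_deg_OUp[OF Suc.prems, of C]
  have "poly_deg k d (\<lambda>x. OUp k C p x + real (Suc d) * p x)" by simp
  from Suc.IH[OF this] obtain g where
    g: "\<And>m. m \<le> d \<Longrightarrow> poly_fun k (g m)" "\<And>m. m \<le> d \<Longrightarrow> OUp k C (g m) = (\<lambda>x. - real m * g m x)"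
    and sum_g: "(\<lambda>x. OUp k C p x + real (Suc d) * p x) = (\<lambda>x. \<Sum>m\<le>d. g m x)" by blast
  define c where "c m = 1 / (real (Suc d) - real m)" for m
  define u where "u = (\<lambda>x. \<Sum>m\<le>d. c m * g m x)"
  have u: "poly_fun k u" unfolding u_def by (auto intro!: poly_fun_sum poly_fun_mult g)
  have OUp_sum: "OUp k C (\<lambda>x. \<Sum>m\<in>I. c m * g m x) = (\<lambda>x. \<Sum>m\<in>I. c m * (- real m * g m x))"
    if "finite I" "I \<subseteq> {..d}" for I using that
  proof (induction I)
    case (insert i I)
    then show ?case
      by (simp, subst OUp_add) (auto intro!: poly_fun_sum poly_fun_mult simp: g OUp_scale OUp_add)
  qed (simp add: OUp_0)
  have OUu: "OUp k C u x + real (Suc d) * u x = (\<Sum>m\<le>d. g m x)" for x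
  proof -
    have "OUp k C u x + real (Suc d) * u x = (\<Sum>m\<le>d. (real (Suc d) - real m) * c m * g m x)"
      unfolding u_def using OUp_sum[of "{..d}"]
      by (simp add: sum_distrib_left sum.distrib[symmetric] algebra_simps)
    also have "\<dots> = (\<Sum>m\<le>d. g m x)" by (rule sum.cong) (auto simp: c_def)
    finally show ?thesis .
  qed
  define f where "f m = (if m = Suc d then (\<lambda>x. p x + (-1) * u x) else (\<lambda>x. c m * g m x))" for m
  have OUf: "OUp k C (f (Suc d)) x = - real (Suc d) * f (Suc d) x" for x
  proof -
    have "OUp k C (f (Suc d)) x = OUp k C p x - OUp k C u x"
      unfolding f_def if_P[OF refl] OUp_add[OF pp poly_fun_mult[OF poly_fun_const u]] OUp_scale[OF u]
    by simp
    then show ?thesis using OUu[of x] fun_cong[OF sum_g, of x]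
      by (simp add: f_def algebra_simps)
  qed
  have "poly_fun k (f m) \<and> OUp k C (f m) = (\<lambda>x. - real m * f m x)" if "m \<le> Suc d" for m
  proof (cases "m = Suc d")
    case True
    moreover have "poly_fun k (f (Suc d))" unfolding f_def
      by (simp only: simp_thms if_True) (intro poly_fun_add poly_fun_mult pp u poly_fun_const)
    ultimately show ?thesis using OUf by blast
  next
    case False
    then have "f m = (\<lambda>x. c m * g m x)" "m \<le> d" using that by (auto simp: f_def)
    then show ?thesis using g by (auto simp: OUp_scale intro!: poly_fun_mult)
  qed
  moreover have "p = (\<lambda>x. \<Sum>m\<le>Suc d. f m x)"
  proof
    fix x
    have "(\<Sum>m\<le>d. f m x) = u x" unfolding u_def by (rule sum.cong) (auto simp: f_def)
    then show "p x = (\<Sum>m\<le>Suc d. f m x)" by (simp add: f_def)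
  qed
  ultimately show ?case by blast
qed

section \<open>Square-integrable functions\<close>

definition sq_int :: "'b measure \<Rightarrow> ('b \<Rightarrow> real) \<Rightarrow> bool" where
  "sq_int M f \<longleftrightarrow> f \<in> borel_measurable M \<and> integrable M (\<lambda>x. (f x)\<^sup>2)"

lemma sq_int_mult:
  assumes "sq_int M f" "sq_int M g"
  shows "integrable M (\<lambda>x. f x * g x)"
proof (rule Bochner_Integration.integrable_bound)
  show "integrable M (\<lambda>x. (f x)\<^sup>2 + (g x)\<^sup>2)" using assms by (auto simp: sq_int_def)
  have "\<bar>a * b\<bar> \<le> a\<^sup>2 + b\<^sup>2" for a b :: real
    using sum_squares_bound[of "\<bar>a\<bar>" "\<bar>b\<bar>"] abs_ge_zero[of "a * b"] unfolding abs_mult power2_abs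
    by linarith
  then show "AE x in M. norm (f x * g x) \<le> norm ((f x)\<^sup>2 + (g x)\<^sup>2)" by simp
qed (use assms in \<open>auto simp: sq_int_def\<close>)

lemma sq_int_lincomb:
  assumes "sq_int M f" "sq_int M g"
  shows "sq_int M (\<lambda>x. a * f x + b * g x)"
proof -
  have "(\<lambda>x. (a * f x + b * g x)\<^sup>2) = (\<lambda>x. a\<^sup>2 * (f x)\<^sup>2 + b\<^sup>2 * (g x)\<^sup>2 + 2 * a * b * (f x * g x))"
    by (auto simp: power2_sum power_mult_distrib)
  then show ?thesis using assms sq_int_mult[OF assms] by (auto simp: sq_int_def)
qed

lemma sq_int_zero: "sq_int M (\<lambda>_. 0)"
  by (simp add: sq_int_def)

lemma sq_int_add: "sq_int M f \<Longrightarrow> sq_int M g \<Longrightarrow> sq_int M (\<lambda>x. f x + g x)"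
  using sq_int_lincomb[of M f g 1 1] by simp

lemma sq_int_diff: "sq_int M f \<Longrightarrow> sq_int M g \<Longrightarrow> sq_int M (\<lambda>x. f x - g x)"
  using sq_int_lincomb[of M f g 1 "-1"] by simp

lemma sq_int_scale: "sq_int M f \<Longrightarrow> sq_int M (\<lambda>x. a * f x)"
  using sq_int_lincomb[of M f f a 0] by simp

text \<open>Integrates \<open>(u + v)^2 <= 2 u^2 + 2 v^2\<close>, a substitute for the triangle
  inequality that stays with squared norms.\<close>

lemma sq_integral_lincomb_le:
  assumes "sq_int M f" "sq_int M g"
  shows "(LINT x|M. (a * f x + b * g x)\<^sup>2) \<le> 2 * a\<^sup>2 * (LINT x|M. (f x)\<^sup>2) + 2 * b\<^sup>2 * (LINT x|M. (g x)\<^sup>2)"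
proof -
  have "(LINT x|M. (a * f x + b * g x)\<^sup>2) \<le> (LINT x|M. 2 * a\<^sup>2 * (f x)\<^sup>2 + 2 * b\<^sup>2 * (g x)\<^sup>2)"
  proof (rule integral_mono)
    show "(a * f x + b * g x)\<^sup>2 \<le> 2 * a\<^sup>2 * (f x)\<^sup>2 + 2 * b\<^sup>2 * (g x)\<^sup>2" for x
      using zero_le_power2[of "a * f x - b * g x"]
      by (simp add: power2_diff power2_sum power_mult_distrib)
  qed (use assms sq_int_lincomb[OF assms, of a b] in \<open>auto simp: sq_int_def\<close>)
  also have "\<dots> = 2 * a\<^sup>2 * (LINT x|M. (f x)\<^sup>2) + 2 * b\<^sup>2 * (LINT x|M. (g x)\<^sup>2)"
    using assms by (subst Bochner_Integration.integral_add) (auto simp: sq_int_def)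
  finally show ?thesis .
qed

lemma sq_integral_add_le:
  assumes "sq_int M f" "sq_int M g"
  shows "(LINT x|M. (f x + g x)\<^sup>2) \<le> 2 * (LINT x|M. (f x)\<^sup>2) + 2 * (LINT x|M. (g x)\<^sup>2)"
  using sq_integral_lincomb_le[OF assms, of 1 1] by simp

text \<open>On a probability space a Cauchy sequence in mean square is Cauchy in mean, so a
  subsequence converges almost surely; Fatou's lemma then carries the Cauchy estimate over to the
  limit.\<close>

lemma (in prob_space) L2_complete:
  fixes X :: "nat \<Rightarrow> 'a \<Rightarrow> real"
  assumes X: "\<And>k. sq_int M (X k)"
    and cauchy: "\<And>e. e > 0 \<Longrightarrow> \<exists>K. \<forall>i\<ge>K. \<forall>j\<ge>K. expectation (\<lambda>\<omega>. (X i \<omega> - X j \<omega>)\<^sup>2) < e"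
  shows "\<exists>Y. sq_int M Y \<and> (\<lambda>k. expectation (\<lambda>\<omega>. (Y \<omega> - X k \<omega>)\<^sup>2)) \<longlonglongrightarrow> 0"
proof -
  have [measurable]: "X k \<in> borel_measurable M" for k using X by (auto simp: sq_int_def)
  have sq_diff: "integrable M (\<lambda>\<omega>. (X i \<omega> - X j \<omega>)\<^sup>2)" for i j
    using sq_int_diff[OF X X] by (auto simp: sq_int_def)
  have int1: "integrable M (X k)" for k
    using sq_int_mult[OF X, of "\<lambda>_. 1" k] by (simp add: sq_int_def)
  \<comment> \<open>Young's inequality with a free parameter:
    \<open>|d| <= d^2 / (2 e) + e / 2\<close>. If the first expectation on the right is below
    \<open>e^2\<close>, the total is below \<open>e\<close>.\<close>
  have L1: "expectation (\<lambda>\<omega>. norm (X i \<omega> - X j \<omega>)) \<le> expectation (\<lambda>\<omega>. (X i \<omega> - X j \<omega>)\<^sup>2) / (2 * e) + e / 2"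
    if "e > 0" for e :: real and i j
  proof -
    have "expectation (\<lambda>\<omega>. norm (X i \<omega> - X j \<omega>)) \<le> expectation (\<lambda>\<omega>. (X i \<omega> - X j \<omega>)\<^sup>2 / (2 * e) + e / 2)"
    proof (rule integral_mono)
      show "norm (X i \<omega> - X j \<omega>) \<le> (X i \<omega> - X j \<omega>)\<^sup>2 / (2 * e) + e / 2" for \<omega>
        using sum_squares_bound[of "\<bar>X i \<omega> - X j \<omega>\<bar>" e] that
        by (simp add: field_simps power2_eq_square)
    qed (use int1 sq_diff in auto)
    also have "\<dots> = expectation (\<lambda>\<omega>. (X i \<omega> - X j \<omega>)\<^sup>2) / (2 * e) + e / 2"
      using sq_diff by (subst Bochner_Integration.integral_add) (auto simp: prob_space)
    finally show ?thesis .
  qed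
  have "\<exists>N. \<forall>i\<ge>N. \<forall>j\<ge>N. expectation (\<lambda>\<omega>. norm (X i \<omega> - X j \<omega>)) < e" if "e > 0" for e :: real
  proof -
    obtain K where K: "\<forall>i\<ge>K. \<forall>j\<ge>K. expectation (\<lambda>\<omega>. (X i \<omega> - X j \<omega>)\<^sup>2) < e\<^sup>2"
      using cauchy[OF zero_less_power[OF \<open>0 < e\<close>, of 2]] by blast
    have "expectation (\<lambda>\<omega>. norm (X i \<omega> - X j \<omega>)) < e" if "i \<ge> K" "j \<ge> K" for i j
    proof -
      have "expectation (\<lambda>\<omega>. (X i \<omega> - X j \<omega>)\<^sup>2) / (2 * e) < e\<^sup>2 / (2 * e)"
        using K that \<open>e > 0\<close> by (intro divide_strict_right_mono) auto
      then show ?thesis using L1[OF \<open>e > 0\<close>, of i j] \<open>e > 0\<close> by (simp add: power2_eq_square)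
    qed
    then show ?thesis by blast
  qed
  from cauchy_L1_AE_cauchy_subseq[OF int1 this] obtain r where
    r: "strict_mono r" "AE \<omega> in M. Cauchy (\<lambda>i. X (r i) \<omega>)" by blast
  define Y where "Y \<omega> = lim (\<lambda>i. X (r i) \<omega>)" for \<omega>
  have [measurable]: "Y \<in> borel_measurable M" unfolding Y_def by measurable
  have lim: "AE \<omega> in M. (\<lambda>i. X (r i) \<omega>) \<longlonglongrightarrow> Y \<omega>"
    using r(2) by eventually_elim (simp add: Y_def Cauchy_convergent_iff convergent_LIMSEQ_iff)
  \<comment> \<open>Used twice: with bound 1 it gives square integrability of \<open>Y\<close>, with
    bound \<open>e / 2\<close> it gives convergence of the whole sequence.\<close>
  have fatou: "sq_int M (\<lambda>\<omega>. Y \<omega> - X k \<omega>) \<and> expectation (\<lambda>\<omega>. (Y \<omega> - X k \<omega>)\<^sup>2) \<le> e"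
    if K: "\<forall>i\<ge>K. \<forall>j\<ge>K. expectation (\<lambda>\<omega>. (X i \<omega> - X j \<omega>)\<^sup>2) < e" and "k \<ge> K" "e > 0" for k K e
  proof -
    have "(\<integral>\<^sup>+\<omega>. ennreal ((Y \<omega> - X k \<omega>)\<^sup>2) \<partial>M) = (\<integral>\<^sup>+\<omega>. liminf (\<lambda>i. ennreal ((X (r i) \<omega> - X k \<omega>)\<^sup>2)) \<partial>M)"
    proof (rule nn_integral_cong_AE, use lim in eventually_elim)
      case (elim \<omega>)
      then have "(\<lambda>i. ennreal ((X (r i) \<omega> - X k \<omega>)\<^sup>2)) \<longlonglongrightarrow> ennreal ((Y \<omega> - X k \<omega>)\<^sup>2)"
        by (intro tendsto_intros)
      then show ?case by (intro lim_imp_Liminf[symmetric] sequentially_bot)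
    qed
    also have "\<dots> \<le> liminf (\<lambda>i. \<integral>\<^sup>+\<omega>. ennreal ((X (r i) \<omega> - X k \<omega>)\<^sup>2) \<partial>M)"
      by (rule nn_integral_liminf) measurable
    also have "\<dots> \<le> liminf (\<lambda>i. ennreal e)"
    proof (rule Liminf_mono, rule eventually_sequentiallyI[of K])
      fix i assume "i \<ge> K"
      then have "r i \<ge> K" using seq_suble[OF r(1), of i] by linarith
      then have "expectation (\<lambda>\<omega>. (X (r i) \<omega> - X k \<omega>)\<^sup>2) \<le> e" using K that by (meson less_imp_le)
      then show "(\<integral>\<^sup>+\<omega>. ennreal ((X (r i) \<omega> - X k \<omega>)\<^sup>2) \<partial>M) \<le> ennreal e"
        by (subst nn_integral_eq_integral) (auto simp: sq_diff intro: ennreal_leI)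
    qed
    also have "\<dots> = ennreal e" by (rule Liminf_const) simp
    finally have le: "(\<integral>\<^sup>+\<omega>. ennreal ((Y \<omega> - X k \<omega>)\<^sup>2) \<partial>M) \<le> ennreal e" .
    then have int: "integrable M (\<lambda>\<omega>. (Y \<omega> - X k \<omega>)\<^sup>2)"
      by (intro integrableI_nonneg) (auto simp: less_top[symmetric] top_unique)
    then have "ennreal (expectation (\<lambda>\<omega>. (Y \<omega> - X k \<omega>)\<^sup>2)) \<le> ennreal e"
      using le by (subst (asm) nn_integral_eq_integral) auto
    then show ?thesis using int \<open>e > 0\<close> by (simp add: sq_int_def)
  qed
  have "sq_int M Y"
  proof -
    obtain K where "\<forall>i\<ge>K. \<forall>j\<ge>K. expectation (\<lambda>\<omega>. (X i \<omega> - X j \<omega>)\<^sup>2) < 1" using cauchy[of 1] by auto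
    from fatou[OF this, of K] have "sq_int M (\<lambda>\<omega>. Y \<omega> - X K \<omega>)" by simp
    from sq_int_add[OF this X[of K]] show ?thesis by simp
  qed
  moreover have "(\<lambda>k. expectation (\<lambda>\<omega>. (Y \<omega> - X k \<omega>)\<^sup>2)) \<longlonglongrightarrow> 0"
  proof (rule LIMSEQ_I)
    fix e :: real assume "e > 0"
    then obtain K where K: "\<forall>i\<ge>K. \<forall>j\<ge>K. expectation (\<lambda>\<omega>. (X i \<omega> - X j \<omega>)\<^sup>2) < e / 2"
      using cauchy[of "e / 2"] by auto
    have "norm (expectation (\<lambda>\<omega>. (Y \<omega> - X k \<omega>)\<^sup>2) - 0) < e" if "k \<ge> K" for k
      using fatou[OF K that] \<open>e > 0\<close> by simp
    then show "\<exists>K. \<forall>k\<ge>K. norm (expectation (\<lambda>\<omega>. (Y \<omega> - X k \<omega>)\<^sup>2) - 0) < e" by blast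
  qed
  ultimately show ?thesis by blast
qed

section \<open>Density of step functions\<close>

lemma L2H_sq_int: "h \<in> L2H \<longleftrightarrow> sq_int half_line h"
  by (simp add: L2H_def sq_int_def)

lemma space_half_line [simp]: "space half_line = {0..}"
  by (simp add: half_line_def space_restrict_space)

lemma sets_half_line: "A \<in> sets half_line \<longleftrightarrow> A \<subseteq> {0..} \<and> A \<in> sets borel"
  by (simp add: half_line_def sets_restrict_space_iff)

lemma borel_measurable_half_line: "f \<in> borel_measurable borel \<Longrightarrow> f \<in> borel_measurable half_line"
  by (simp add: half_line_def measurable_restrict_space1)

lemma emeasure_half_line: "A \<subseteq> {0..} \<Longrightarrow> emeasure half_line A = emeasure lborel A"
  unfolding half_line_def by (subst emeasure_restrict_space) auto

lemma emeasure_half_line_finite: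
  assumes "A \<in> sets borel" "A \<subseteq> {0..R}"
  shows "emeasure half_line A < \<infinity>"
proof -
  have "emeasure half_line A = emeasure lborel A" using assms by (intro emeasure_half_line) auto
  also have "\<dots> \<le> emeasure lborel {0..R}" using assms by (intro emeasure_mono) auto
  also have "\<dots> < \<infinity>" by (cases "0 \<le> R") auto
  finally show ?thesis .
qed

lemma sq_int_indicator:
  assumes "A \<in> sets borel" "A \<subseteq> {0..R}"
  shows "sq_int half_line (indicator A)"
proof -
  have "(\<lambda>x. (indicator A x :: real)\<^sup>2) = indicator A" by (auto simp: indicator_def)
  moreover have "A \<in> sets half_line" using assms by (auto simp: sets_half_line)
  ultimately show ?thesis using emeasure_half_line_finite[OF assms] by (simp add: sq_int_def)
qed

lemma step_fun_Nil [simp]: "step_fun [] = (\<lambda>_. 0)"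
  by (auto simp: step_fun_def)

lemma step_fun_Cons: "step_fun ((c, u, v) # ps) = (\<lambda>t. c * indicator {u<..v} t + step_fun ps t)"
  by (auto simp: step_fun_def)

lemma step_fun_append: "step_fun (ps @ qs) = (\<lambda>t. step_fun ps t + step_fun qs t)"
  by (auto simp: step_fun_def)

definition scale_steps :: "real \<Rightarrow> (real \<times> real \<times> real) list \<Rightarrow> (real \<times> real \<times> real) list" where
  "scale_steps a = map (\<lambda>(c, u, v). (a * c, u, v))"

lemma step_fun_scale: "step_fun (scale_steps a ps) = (\<lambda>t. a * step_fun ps t)"
  by (induction ps) (auto simp: scale_steps_def step_fun_Cons algebra_simps)

lemma valid_steps_Nil [simp]: "valid_steps []"
  by (simp add: valid_steps_def)

lemma valid_steps_Cons [simp]: "valid_steps ((c, u, v) # ps) \<longleftrightarrow> 0 \<le> u \<and> u \<le> v \<and> valid_steps ps"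
  by (auto simp: valid_steps_def)

lemma valid_steps_append [simp]: "valid_steps (ps @ qs) \<longleftrightarrow> valid_steps ps \<and> valid_steps qs"
  by (simp add: valid_steps_def ball_Un)

lemma valid_steps_scale: "valid_steps ps \<Longrightarrow> valid_steps (scale_steps a ps)"
  by (auto simp: valid_steps_def scale_steps_def)

lemma sq_int_step_fun: "valid_steps ps \<Longrightarrow> sq_int half_line (step_fun ps)"
proof (induction ps)
  case (Cons p ps)
  obtain c u v where p: "p = (c, u, v)" by (cases p) auto
  have "sq_int half_line (indicator {u<..v})"
    using Cons by (intro sq_int_indicator[where R = v]) (auto simp: p)
  with Cons show ?case unfolding p step_fun_Cons by (auto intro: sq_int_add sq_int_scale)
qed (simp add: sq_int_zero)

text \<open>The mean-square closure of the step functions. Since it is closed under linear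
  combinations and limits, density reduces to indicators of Borel sets.\<close>

definition step_approximable :: "(real \<Rightarrow> real) \<Rightarrow> bool" where
  "step_approximable h \<longleftrightarrow> sq_int half_line h \<and>
     (\<forall>e>0. \<exists>ps. valid_steps ps \<and> (LINT t|half_line. (h t - step_fun ps t)\<^sup>2) < e)"

lemma step_approximable_step: "valid_steps ps \<Longrightarrow> step_approximable (step_fun ps)"
  unfolding step_approximable_def by (auto intro: sq_int_step_fun exI[of _ ps])

lemma step_approximable_limit:
  assumes h: "sq_int half_line h"
    and ex: "\<And>e. e > 0 \<Longrightarrow> \<exists>g. step_approximable g \<and> (LINT t|half_line. (h t - g t)\<^sup>2) < e"
  shows "step_approximable h"
  unfolding step_approximable_def
proof (intro conjI allI impI h)
  fix e :: real assume "e > 0"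
  then obtain g where g: "step_approximable g" "(LINT t|half_line. (h t - g t)\<^sup>2) < e / 4"
    using ex[of "e / 4"] by auto
  then obtain ps where ps: "valid_steps ps" "(LINT t|half_line. (g t - step_fun ps t)\<^sup>2) < e / 4"
    using \<open>e > 0\<close> unfolding step_approximable_def by (metis zero_less_divide_iff zero_less_numeral)
  have "sq_int half_line (\<lambda>t. h t - g t)" "sq_int half_line (\<lambda>t. g t - step_fun ps t)"
    using h g ps by (auto intro!: sq_int_diff sq_int_step_fun simp: step_approximable_def)
  from sq_integral_add_le[OF this] g(2) ps(2)
  have "(LINT t|half_line. (h t - step_fun ps t)\<^sup>2) < e" by simp
  with ps show "\<exists>ps. valid_steps ps \<and> (LINT t|half_line. (h t - step_fun ps t)\<^sup>2) < e" by blast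
qed

lemma LIMSEQ_0_ex_less:
  fixes f :: "nat \<Rightarrow> real"
  assumes "f \<longlonglongrightarrow> 0" "e > 0"
  shows "\<exists>n. f n < e"
  using order_tendstoD(2)[OF assms] by (auto simp: eventually_sequentially)

lemma step_approximable_scale:
  assumes "step_approximable g"
  shows "step_approximable (\<lambda>t. a * g t)"
proof (cases "a = 0")
  case True
  then show ?thesis using step_approximable_step[of "[]"] by simp
next
  case False
  show ?thesis unfolding step_approximable_def
  proof (intro conjI allI impI)
    fix e :: real assume "e > 0"
    then obtain ps where ps: "valid_steps ps" "(LINT t|half_line. (g t - step_fun ps t)\<^sup>2) < e / a\<^sup>2"
      using assms False unfolding step_approximable_def by (metis divide_pos_pos zero_less_power2)
    have "(LINT t|half_line. (a * g t - step_fun (scale_steps a ps) t)\<^sup>2)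
        = a\<^sup>2 * (LINT t|half_line. (g t - step_fun ps t)\<^sup>2)"
      by (simp add: step_fun_scale right_diff_distrib[symmetric] power_mult_distrib)
    also have "\<dots> < e" using ps(2) False by (simp add: field_simps)
    finally show "\<exists>ps. valid_steps ps \<and> (LINT t|half_line. (a * g t - step_fun ps t)\<^sup>2) < e"
      using ps(1) valid_steps_scale by blast
  qed (use assms in \<open>auto simp: step_approximable_def intro: sq_int_scale\<close>)
qed

lemma step_approximable_add:
  assumes f: "step_approximable f" and g: "step_approximable g"
  shows "step_approximable (\<lambda>t. f t + g t)"
  unfolding step_approximable_def
proof (intro conjI allI impI)
  fix e :: real assume "e > 0"
  then obtain ps qs where *: "valid_steps ps" "(LINT t|half_line. (f t - step_fun ps t)\<^sup>2) < e / 4"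
    "valid_steps qs" "(LINT t|half_line. (g t - step_fun qs t)\<^sup>2) < e / 4"
    using f[unfolded step_approximable_def, THEN conjunct2, rule_format, of "e / 4"]
      g[unfolded step_approximable_def, THEN conjunct2, rule_format, of "e / 4"] by auto
  have "sq_int half_line (\<lambda>t. f t - step_fun ps t)" "sq_int half_line (\<lambda>t. g t - step_fun qs t)"
    using f g * by (auto intro!: sq_int_diff sq_int_step_fun simp: step_approximable_def)
  from sq_integral_add_le[OF this] *
  have "(LINT t|half_line. (f t + g t - step_fun (ps @ qs) t)\<^sup>2) < e"
    by (simp add: step_fun_append algebra_simps)
  with * show "\<exists>ps. valid_steps ps \<and> (LINT t|half_line. (f t + g t - step_fun ps t)\<^sup>2) < e"
    by (meson valid_steps_append)
qed (use f g in \<open>auto simp: step_approximable_def intro: sq_int_add\<close>)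

lemma step_approximable_sum:
  "(\<And>i. i \<in> I \<Longrightarrow> step_approximable (f i)) \<Longrightarrow> step_approximable (\<lambda>t. \<Sum>i\<in>I. f i t)"
  by (induction I rule: infinite_finite_induct)
    (auto intro: step_approximable_add step_approximable_step[of "[]", simplified])

lemma step_approximable_indicator_Ioc:
  assumes "0 \<le> u" shows "step_approximable (indicator {u<..v})"
proof (cases "u \<le> v")
  case True
  then show ?thesis using assms step_approximable_step[of "[(1, u, v)]"] by (simp add: step_fun_Cons)
next
  case False
  then have "indicator {u<..v} = (\<lambda>_::real. 0 :: real)" by auto
  then show ?thesis using step_approximable_step[of "[]"] by simp
qed

text \<open>Dynkin's theorem for the half-lines \<open>{..a}\<close>. Intersecting with
  \<open>{0<..R}\<close> keeps all measures finite, so complements can be taken by subtraction and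
  countable unions by dominated convergence.\<close>

lemma step_approximable_indicator:
  assumes "A \<in> sets borel"
  shows "step_approximable (indicator (A \<inter> {0<..R}))"
proof -
  have "Int_stable (range (\<lambda>a::real. {..a}))" by (auto simp: Int_stable_def)
  moreover have "range (\<lambda>a::real. {..a}) \<subseteq> Pow UNIV" by auto
  moreover have "A \<in> sigma_sets UNIV (range (\<lambda>a::real. {..a}))"
    using assms by (simp add: borel_eq_atMost)
  ultimately show ?thesis
  proof (induction rule: sigma_sets_induct_disjoint)
    case (basic A)
    then obtain a where "A = {..a}" by auto
    then have "A \<inter> {0<..R} = {0<..min a R}" by auto
    then show ?case by (simp add: step_approximable_indicator_Ioc)
  next
    case empty
    have "indicator ({} \<inter> {0<..R}) = (\<lambda>_::real. 0::real)" by auto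
    then show ?case using step_approximable_step[of "[]"] by simp
  next
    case (compl A)
    have "indicator ((UNIV - A) \<inter> {0<..R}) = (\<lambda>t. indicator {0<..R} t + (-1) * indicator (A \<inter> {0<..R}) t :: real)"
      by (auto simp: indicator_def)
    then show ?case
      by (simp only:) (intro step_approximable_add step_approximable_scale compl step_approximable_indicator_Ioc order_refl)
  next
    case (union A)
    have sA: "A i \<in> sets borel" for i using union(2) by (auto simp: borel_eq_atMost)
    define g where "g n = (\<lambda>t. indicator (\<Union>i<n. A i \<inter> {0<..R}) t :: real)" for n :: nat
    define h where "h = (\<lambda>t. indicator (\<Union>i. A i \<inter> {0<..R}) t :: real)"
    have g: "step_approximable (g n)" for n
    proof -
      have "disjoint_family_on (\<lambda>i. A i \<inter> {0<..R}) {..<n}"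
        using union(1) by (auto simp: disjoint_family_on_def)
      then have "g n = (\<lambda>t. \<Sum>i<n. indicator (A i \<inter> {0<..R}) t)"
        unfolding g_def by (intro ext indicator_UN_disjoint) auto
      then show ?thesis by (auto intro: step_approximable_sum union)
    qed
    have h: "sq_int half_line h" unfolding h_def
      using sA by (intro sq_int_indicator[of _ R]) auto
    have "(\<lambda>n. LINT t|half_line. (h t - g n t)\<^sup>2) \<longlonglongrightarrow> (LINT t|half_line. 0)"
    proof (rule integral_dominated_convergence[where w = "indicator {0<..R}"])
      show "integrable half_line (indicator {0<..R} :: real \<Rightarrow> real)"
        by (intro integrable_real_indicator emeasure_half_line_finite[of _ R]) (auto simp: sets_half_line)
      show "(\<lambda>t. (h t - g n t)\<^sup>2) \<in> borel_measurable half_line" for n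
        using h g[of n] by (auto simp: sq_int_def step_approximable_def)
      have "g n t \<le> h t" "h t \<le> indicator {0<..R} t" "0 \<le> g n t" for n t
        by (auto simp: g_def h_def indicator_def)
      then have "(h t - g n t)\<^sup>2 \<le> indicator {0<..R} t" for n t
        by (smt (verit) indicator_simps mult_left_le power2_eq_square power_mono power_zero_numeral zero_power2)
      then show "AE t in half_line. norm ((h t - g n t)\<^sup>2) \<le> indicator {0<..R} t" for n by simp
      have "(\<lambda>n. (h t - g n t)\<^sup>2) \<longlonglongrightarrow> (h t - h t)\<^sup>2" for t
        unfolding g_def h_def by (intro tendsto_intros LIMSEQ_indicator_UN)
      then show "AE t in half_line. (\<lambda>n. (h t - g n t)\<^sup>2) \<longlonglongrightarrow> 0" by simp
    qed simp
    then have "\<exists>n. (LINT t|half_line. (h t - g n t)\<^sup>2) < e" if "e > 0" for e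
      using that by (intro LIMSEQ_0_ex_less) simp_all
    then have "step_approximable h" using g by (intro step_approximable_limit h) blast
    then show ?case unfolding h_def by (simp add: Int_UN_distrib2 flip: UN_extend_simps)
  qed
qed

lemma step_approximable_L2H:
  assumes h: "h \<in> L2H"
  shows "step_approximable h"
proof -
  have h2: "sq_int half_line h" using h by (simp add: L2H_sq_int)
  then have meas: "h \<in> borel_measurable half_line" by (simp add: sq_int_def)
  obtain s where s: "\<And>i. simple_function half_line (s i)"
    "\<And>x. x \<ge> 0 \<Longrightarrow> (\<lambda>i. s i x) \<longlonglongrightarrow> h x" "\<And>i x. x \<ge> 0 \<Longrightarrow> \<bar>s i x\<bar> \<le> 2 * \<bar>h x\<bar>"
    using borel_measurable_implies_sequence_metric[OF meas, of 0]
    unfolding space_half_line Ball_def by (elim exE conjE) (auto simp: dist_real_def intro: that)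
  have sm [measurable]: "s i \<in> borel_measurable half_line" for i
    using s(1) by (rule borel_measurable_simple_function)
  \<comment> \<open>The cut-off makes the level sets bounded, as the indicator case requires, and
    disappears in the limit.\<close>
  define g where "g i t = s i t * indicator {0<..real i} t" for i t
  have ind [measurable]: "(indicator {0<..real i} :: real \<Rightarrow> real) \<in> borel_measurable half_line" for i
    by (intro borel_measurable_half_line) measurable
  have gm: "g i \<in> borel_measurable half_line" for i unfolding g_def[abs_def]
    by measurable
  have g: "step_approximable (g i)" for i
  proof -
    define R where "R = s i ` {0..}"
    have fin: "finite R" using s(1)[of i] by (simp add: simple_function_def R_def)
    define B where "B y = {x \<in> {0..}. s i x = y}" for y
    have B: "B y \<in> sets borel" for y
    proof -
      have "B y = s i -` {y} \<inter> space half_line" by (auto simp: B_def)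
      then have "B y \<in> sets half_line" using borel_measurable_vimage[OF sm[of i]] by simp
      then show ?thesis by (simp add: sets_half_line)
    qed
    have eq: "g i t = (\<Sum>y\<in>R. y * indicator (B y \<inter> {0<..real i}) t)" for t
    proof (cases "t \<in> {0<..real i}")
      case True
      then have "(\<Sum>y\<in>R. y * indicator (B y \<inter> {0<..real i}) t) = (\<Sum>y\<in>R. if y = s i t then y else 0)"
        by (intro sum.cong) (auto simp: B_def indicator_def)
      also have "\<dots> = s i t" using True fin by (subst sum.delta) (auto simp: R_def)
      finally show ?thesis using True by (simp add: g_def)
    qed (auto simp: g_def)
    have "step_approximable (\<lambda>t. \<Sum>y\<in>R. y * indicator (B y \<inter> {0<..real i}) t)"
      by (intro step_approximable_sum step_approximable_scale step_approximable_indicator B)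
    moreover have "g i = (\<lambda>t. \<Sum>y\<in>R. y * indicator (B y \<inter> {0<..real i}) t)" by (rule ext) (rule eq)
    ultimately show ?thesis by simp
  qed
  \<comment> \<open>The cut-off intervals never contain the point 0, where \<open>g\<close>
    therefore need not converge to \<open>h\<close>.\<close>
  have null: "AE t in half_line. t \<noteq> 0"
  proof (rule AE_I)
    show "emeasure half_line {0} = 0" by (subst emeasure_half_line) auto
  qed (auto simp: sets_half_line)
  \<comment> \<open>From \<open>|s i| \<le> 2 * |h|\<close> the difference is at most
    \<open>3 * |h|\<close>, which explains the dominating function \<open>9 * h^2\<close>.\<close>
  have "(\<lambda>n. LINT t|half_line. (h t - g n t)\<^sup>2) \<longlonglongrightarrow> (LINT t|half_line. 0)"
  proof (rule integral_dominated_convergence[where w = "\<lambda>t. 9 * (h t)\<^sup>2"])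
    show "integrable half_line (\<lambda>t. 9 * (h t)\<^sup>2)" using h2 by (simp add: sq_int_def)
    show "(\<lambda>t. (h t - g n t)\<^sup>2) \<in> borel_measurable half_line" for n using meas gm by measurable
    show "AE t in half_line. norm ((h t - g n t)\<^sup>2) \<le> 9 * (h t)\<^sup>2" for n
    proof (rule AE_I2)
      fix t assume "t \<in> space half_line"
      then have "\<bar>g n t\<bar> \<le> 2 * \<bar>h t\<bar>" using s(3)[of t n] by (auto simp: g_def indicator_def)
      then have "\<bar>h t - g n t\<bar> \<le> 3 * \<bar>h t\<bar>" by linarith
      then have "(h t - g n t)\<^sup>2 \<le> (3 * \<bar>h t\<bar>)\<^sup>2" by (metis abs_ge_zero power2_abs power_mono)
      then show "norm ((h t - g n t)\<^sup>2) \<le> 9 * (h t)\<^sup>2" by (simp add: power_mult_distrib)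
    qed
    have "AE t in half_line. t \<in> space half_line" by (rule AE_space)
    with null show "AE t in half_line. (\<lambda>n. (h t - g n t)\<^sup>2) \<longlonglongrightarrow> 0"
    proof eventually_elim
      case (elim t)
      then have "t > 0" by simp
      obtain n0 where n0: "t \<le> real n0" using real_arch_simple by blast
      have "eventually (\<lambda>n. (h t - s n t)\<^sup>2 = (h t - g n t)\<^sup>2) sequentially"
        using \<open>t > 0\<close> n0 by (intro eventually_sequentiallyI[of n0]) (auto simp: g_def)
      moreover have "(\<lambda>n. (h t - s n t)\<^sup>2) \<longlonglongrightarrow> (h t - h t)\<^sup>2"
        using \<open>t > 0\<close> by (intro tendsto_intros s(2)) simp
      ultimately show ?case using Lim_transform_eventually by fastforce
    qed
  qed simp
  then have "\<exists>n. (LINT t|half_line. (h t - g n t)\<^sup>2) < e" if "e > 0" for e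
    using that by (intro LIMSEQ_0_ex_less) simp_all
  then show ?thesis using g by (intro step_approximable_limit h2) blast
qed

lemma step_sequence:
  assumes "h \<in> L2H"
  obtains ps where "\<And>k. valid_steps (ps k)"
    "(\<lambda>k. LINT t|half_line. (h t - step_fun (ps k) t)\<^sup>2) \<longlonglongrightarrow> 0"
proof -
  have "\<exists>ps. valid_steps ps \<and> (LINT t|half_line. (h t - step_fun ps t)\<^sup>2) < 1 / Suc k" for k
    using step_approximable_L2H[OF assms] by (simp add: step_approximable_def)
  then obtain ps where ps: "\<And>k. valid_steps (ps k)"
    "\<And>k. (LINT t|half_line. (h t - step_fun (ps k) t)\<^sup>2) < 1 / Suc k" by metis
  have "(\<lambda>k. LINT t|half_line. (h t - step_fun (ps k) t)\<^sup>2) \<longlonglongrightarrow> 0"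
  proof (rule tendsto_sandwich[where f = "\<lambda>_. 0" and h = "\<lambda>k. 1 / Suc k"])
    show "(\<lambda>k. 1 / real (Suc k)) \<longlonglongrightarrow> 0" using LIMSEQ_inverse_real_of_nat by (simp add: inverse_eq_divide)
    show "\<forall>\<^sub>F k in sequentially. (LINT t|half_line. (h t - step_fun (ps k) t)\<^sup>2) \<le> 1 / Suc k"
      using ps(2) less_imp_le by (intro always_eventually allI) blast
  qed auto
  with ps show ?thesis using that by blast
qed

section \<open>Gaussian random variables\<close>

text \<open>The common core of both Cauchy-Schwarz inequalities below, one for square-integrable
  functions and one for \<open>innerP\<close>. These forms are only known to be semidefinite, hence
  the case \<open>A = 0\<close>.\<close>

lemma quadratic_nonneg_discriminant:
  fixes A B C :: real
  assumes nonneg: "\<And>t. 0 \<le> A * t\<^sup>2 + 2 * B * t + C" and "0 \<le> A"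
  shows "B\<^sup>2 \<le> A * C"
proof (cases "A = 0")
  case True
  have "B = 0"
  proof (rule ccontr)
    assume "B \<noteq> 0"
    then have "2 * B * (- (C + 1) / (2 * B)) = - (C + 1)" by simp
    then show False using nonneg[of "- (C + 1) / (2 * B)"] True by simp
  qed
  then show ?thesis using True by simp
next
  case False
  then have "A > 0" using assms by simp
  have "A * (- B / A)\<^sup>2 + 2 * B * (- B / A) + C = C - B\<^sup>2 / A"
    using \<open>A > 0\<close> by (simp add: field_simps power2_eq_square)
  then have "B\<^sup>2 / A \<le> C" using nonneg[of "- B / A"] by simp
  then show ?thesis using \<open>A > 0\<close> by (simp add: field_simps)
qed

lemma sq_integral_lincomb:
  assumes "sq_int M f" "sq_int M g"
  shows "(LINT x|M. (a * f x + b * g x)\<^sup>2)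
    = a\<^sup>2 * (LINT x|M. (f x)\<^sup>2) + 2 * a * b * (LINT x|M. f x * g x) + b\<^sup>2 * (LINT x|M. (g x)\<^sup>2)"
proof -
  have "(LINT x|M. (a * f x + b * g x)\<^sup>2)
      = (LINT x|M. a\<^sup>2 * (f x)\<^sup>2 + 2 * a * b * (f x * g x) + b\<^sup>2 * (g x)\<^sup>2)"
    by (simp add: power2_sum power_mult_distrib algebra_simps)
  also have "\<dots> = a\<^sup>2 * (LINT x|M. (f x)\<^sup>2) + 2 * a * b * (LINT x|M. f x * g x) + b\<^sup>2 * (LINT x|M. (g x)\<^sup>2)"
    using assms sq_int_mult[OF assms]
    by (subst Bochner_Integration.integral_add; (subst Bochner_Integration.integral_add)?)
       (auto simp: sq_int_def)
  finally show ?thesis .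
qed

lemma sq_int_Cauchy_Schwarz:
  assumes "sq_int M f" "sq_int M g"
  shows "(LINT x|M. f x * g x)\<^sup>2 \<le> (LINT x|M. (f x)\<^sup>2) * (LINT x|M. (g x)\<^sup>2)"
proof (rule quadratic_nonneg_discriminant)
  fix t
  have "0 \<le> (LINT x|M. (t * f x + 1 * g x)\<^sup>2)" by simp
  then show "0 \<le> (LINT x|M. (f x)\<^sup>2) * t\<^sup>2 + 2 * (LINT x|M. f x * g x) * t + (LINT x|M. (g x)\<^sup>2)"
    unfolding sq_integral_lincomb[OF assms] by (simp add: algebra_simps)
qed simp

text \<open>Expand the square of \<open>g k = f - (f - g k)\<close>; the mixed term is controlled by
  Cauchy-Schwarz.\<close>

lemma sq_integral_tendsto:
  assumes f: "sq_int M f" and g: "\<And>k. sq_int M (g k)"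
    and lim: "(\<lambda>k. LINT x|M. (f x - g k x)\<^sup>2) \<longlonglongrightarrow> 0"
  shows "(\<lambda>k. LINT x|M. (g k x)\<^sup>2) \<longlonglongrightarrow> (LINT x|M. (f x)\<^sup>2)"
proof -
  have d: "sq_int M (\<lambda>x. f x - g k x)" for k using f g by (intro sq_int_diff)
  have eq: "(LINT x|M. (g k x)\<^sup>2) = (LINT x|M. (f x)\<^sup>2) - 2 * (LINT x|M. f x * (f x - g k x))
      + (LINT x|M. (f x - g k x)\<^sup>2)" for k
    using sq_integral_lincomb[OF f d, of 1 "-1" k] by simp
  have "(\<lambda>k. LINT x|M. f x * (f x - g k x)) \<longlonglongrightarrow> 0"
  proof (rule tendsto_rabs_zero_cancel, rule tendsto_sandwich[where f = "\<lambda>_. 0"])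
    show "\<forall>\<^sub>F k in sequentially. \<bar>LINT x|M. f x * (f x - g k x)\<bar>
        \<le> sqrt ((LINT x|M. (f x)\<^sup>2) * (LINT x|M. (f x - g k x)\<^sup>2))"
      using sq_int_Cauchy_Schwarz[OF f d] by (intro always_eventually allI real_le_rsqrt) simp
    have "(\<lambda>k. sqrt ((LINT x|M. (f x)\<^sup>2) * (LINT x|M. (f x - g k x)\<^sup>2))) \<longlonglongrightarrow> sqrt ((LINT x|M. (f x)\<^sup>2) * 0)"
      by (intro tendsto_intros lim)
    then show "(\<lambda>k. sqrt ((LINT x|M. (f x)\<^sup>2) * (LINT x|M. (f x - g k x)\<^sup>2))) \<longlonglongrightarrow> 0" by simp
  qed auto
  then have "(\<lambda>k. (LINT x|M. (f x)\<^sup>2) - 2 * (LINT x|M. f x * (f x - g k x)) + (LINT x|M. (f x - g k x)\<^sup>2))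
     \<longlonglongrightarrow> (LINT x|M. (f x)\<^sup>2) - 2 * 0 + 0"
    by (intro tendsto_intros lim)
  then show ?thesis unfolding eq by simp
qed

section \<open>Moments and mean-square limits of Gaussian random variables\<close>

abbreviation std_moment :: "nat \<Rightarrow> real" where
  "std_moment n \<equiv> (LINT x|std_normal_distribution. x ^ n)"

lemma std_moment_odd: "std_moment (2 * k + 1) = 0"
  using integral_std_normal_moment_odd[of k]
  by (subst integral_density) (auto simp: normal_density_nonneg)

text \<open>One-dimensional Gaussian integration by parts for a power; the integration by parts for
  Wiener integrals grows out of this recursion.\<close>

lemma std_moment_Suc_Suc: "std_moment (Suc (Suc n)) = real (Suc n) * std_moment n"
proof (cases "even n")
  case True
  then obtain k where n: "n = 2 * k" by (elim evenE)
  have "Suc (Suc n) = 2 * Suc k" using n by simp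
  then have "std_moment (Suc (Suc n)) = fact (2 * Suc k) / (2 ^ Suc k * fact (Suc k))"
    by (simp only: std_normal_distribution_even_moments)
  also have "\<dots> = (2 * real (Suc k) * (real (Suc n) * fact (2 * k))) / (2 * real (Suc k) * (2 ^ k * fact k))"
    using n by (simp add: algebra_simps)
  also have "\<dots> = real (Suc n) * (fact (2 * k) / (2 ^ k * fact k))"
    by (subst mult_divide_mult_cancel_left) auto
  finally show ?thesis unfolding n std_normal_distribution_even_moments .
next
  case False
  then obtain k where n: "n = 2 * k + 1" by (elim oddE)
  have "Suc (Suc n) = 2 * Suc k + 1" using n by simp
  then show ?thesis using std_moment_odd[of k] std_moment_odd[of "Suc k"] n by simp
qed

context prob_space begin

text \<open>Centred Gaussian with variance \<open>v\<close>, through the characteristic function: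
  this includes the degenerate case \<open>v = 0\<close>, which has no density, and suits
  independent sums and mean-square limits.\<close>

definition gauss :: "('a \<Rightarrow> real) \<Rightarrow> real \<Rightarrow> bool" where
  "gauss X v \<longleftrightarrow> X \<in> borel_measurable M \<and> 0 \<le> v \<and>
     (\<forall>t. char (distr M borel X) t = complex_of_real (exp (- (v * t\<^sup>2) / 2)))"

lemma char_scale:
  assumes "X \<in> borel_measurable M"
  shows "char (distr M borel (\<lambda>\<omega>. a * X \<omega>)) t = char (distr M borel X) (a * t)"
  using assms unfolding char_def by (simp add: integral_distr mult_ac)

text \<open>Levy's uniqueness theorem identifies the law itself, so that moments can be read off
  from the standard normal distribution.\<close>

lemma gauss_std: "gauss X v \<Longrightarrow> distr M borel X = distr std_normal_distribution borel (\<lambda>x. sqrt v * x)"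
proof (rule Levy_uniqueness)
  assume X: "gauss X v"
  interpret N: real_distribution std_normal_distribution by (rule real_dist_normal_dist)
  show "real_distribution (distr M borel X)" using X by (auto simp: gauss_def)
  show "real_distribution (distr std_normal_distribution borel (\<lambda>x. sqrt v * x))"
    by (intro N.real_distribution_distr) auto
  show "char (distr M borel X) = char (distr std_normal_distribution borel (\<lambda>x. sqrt v * x))"
  proof
    fix t
    have "distr std_normal_distribution borel (\<lambda>x. x) = std_normal_distribution"
      by (intro distr_id2) simp
    then have "char (distr std_normal_distribution borel (\<lambda>x. sqrt v * x)) t
        = char std_normal_distribution (sqrt v * t)"
      using N.char_scale[of "\<lambda>x. x" "sqrt v" t] by simp
    then show "char (distr M borel X) t = char (distr std_normal_distribution borel (\<lambda>x. sqrt v * x)) t"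
      using X by (simp add: gauss_def char_std_normal_distribution power_mult_distrib)
  qed
qed

lemma gauss_moment:
  assumes "gauss X v"
  shows "integrable M (\<lambda>\<omega>. X \<omega> ^ n)" "expectation (\<lambda>\<omega>. X \<omega> ^ n) = sqrt v ^ n * std_moment n"
proof -
  have X: "X \<in> borel_measurable M" using assms by (simp add: gauss_def)
  have "integrable (distr std_normal_distribution borel (\<lambda>x. sqrt v * x)) (\<lambda>x. x ^ n)"
    using integrable_std_normal_distribution_moment[of n]
    by (subst integrable_distr_eq) (auto simp: power_mult_distrib)
  then have "integrable (distr M borel X) (\<lambda>x. x ^ n)" by (simp add: gauss_std[OF assms])
  then show "integrable M (\<lambda>\<omega>. X \<omega> ^ n)" using X by (subst (asm) integrable_distr_eq) auto
  have "expectation (\<lambda>\<omega>. X \<omega> ^ n) = (LINT x|distr M borel X. x ^ n)"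
    using X by (subst integral_distr) auto
  also have "\<dots> = (LINT x|distr std_normal_distribution borel (\<lambda>x. sqrt v * x). x ^ n)"
    by (simp add: gauss_std[OF assms])
  also have "\<dots> = (LINT x|std_normal_distribution. (sqrt v * x) ^ n)"
    by (subst integral_distr) auto
  also have "\<dots> = sqrt v ^ n * std_moment n" by (simp add: power_mult_distrib)
  finally show "expectation (\<lambda>\<omega>. X \<omega> ^ n) = sqrt v ^ n * std_moment n" .
qed

lemma gauss_mean: "gauss X v \<Longrightarrow> expectation X = 0"
  using gauss_moment(2)[of X v 1] std_moment_odd[of 0] by simp

lemma gauss_moment_rec:
  "gauss X v \<Longrightarrow> expectation (\<lambda>\<omega>. X \<omega> ^ Suc (Suc n)) = real (Suc n) * v * expectation (\<lambda>\<omega>. X \<omega> ^ n)"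
  unfolding gauss_moment(2) std_moment_Suc_Suc by (simp add: gauss_def mult.assoc[symmetric])

lemma gauss_square: "gauss X v \<Longrightarrow> expectation (\<lambda>\<omega>. (X \<omega>)\<^sup>2) = v"
  using gauss_moment_rec[of X v 0] by (simp add: prob_space numeral_2_eq_2)

lemma gauss_sq_int: "gauss X v \<Longrightarrow> sq_int M X"
  using gauss_moment(1)[of X v 2] by (simp add: sq_int_def gauss_def)

lemma expectation_abs_le:
  assumes "sq_int M X"
  shows "expectation (\<lambda>\<omega>. \<bar>X \<omega>\<bar>) \<le> sqrt (expectation (\<lambda>\<omega>. (X \<omega>)\<^sup>2))"
proof (rule real_le_rsqrt)
  have "sq_int M (\<lambda>\<omega>. \<bar>X \<omega>\<bar>)" "sq_int M (\<lambda>_. 1)" using assms by (auto simp: sq_int_def)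
  from sq_int_Cauchy_Schwarz[OF this]
  show "(expectation (\<lambda>\<omega>. \<bar>X \<omega>\<bar>))\<^sup>2 \<le> expectation (\<lambda>\<omega>. (X \<omega>)\<^sup>2)" by (simp add: prob_space)
qed

text \<open>Since \<open>|exp (i x) - exp (i y)| <= |x - y|\<close>, mean-square convergence forces
  the characteristic functions to converge pointwise.\<close>

lemma gauss_limit:
  assumes X: "sq_int M X" and Y: "\<And>k. gauss (Y k) (v k)"
    and lim: "(\<lambda>k. expectation (\<lambda>\<omega>. (X \<omega> - Y k \<omega>)\<^sup>2)) \<longlonglongrightarrow> 0" and v: "v \<longlonglongrightarrow> w"
  shows "gauss X w"
  unfolding gauss_def
proof (intro conjI allI)
  show [measurable]: "X \<in> borel_measurable M" using X by (simp add: sq_int_def)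
  have [measurable]: "Y k \<in> borel_measurable M" for k using Y by (simp add: gauss_def)
  show "0 \<le> w" using LIMSEQ_le_const[OF v, of 0] Y by (auto simp: gauss_def)
  fix t
  have d: "sq_int M (\<lambda>\<omega>. X \<omega> - Y k \<omega>)" for k using X gauss_sq_int[OF Y] by (rule sq_int_diff)
  have "norm (char (distr M borel (Y k)) t - char (distr M borel X) t)
      \<le> \<bar>t\<bar> * sqrt (expectation (\<lambda>\<omega>. (X \<omega> - Y k \<omega>)\<^sup>2))" for k
  proof -
    have int: "integrable M (\<lambda>\<omega>. iexp (t * Z \<omega>))" if "Z \<in> borel_measurable M" for Z
      using that by (intro integrable_iexp) auto
    have "char (distr M borel (Y k)) t - char (distr M borel X) t
        = (CLINT \<omega>|M. iexp (t * Y k \<omega>) - iexp (t * X \<omega>))"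
      by (subst Bochner_Integration.integral_diff[OF int int]) (simp_all add: char_def integral_distr)
    also have "norm \<dots> \<le> (LINT \<omega>|M. norm (iexp (t * Y k \<omega>) - iexp (t * X \<omega>)))"
      by (rule integral_norm_bound)
    also have "\<dots> \<le> (LINT \<omega>|M. \<bar>t\<bar> * \<bar>X \<omega> - Y k \<omega>\<bar>)"
    proof (rule integral_mono)
      show "integrable M (\<lambda>\<omega>. norm (iexp (t * Y k \<omega>) - iexp (t * X \<omega>)))"
        by (intro integrable_norm Bochner_Integration.integrable_diff int) auto
      show "integrable M (\<lambda>\<omega>. \<bar>t\<bar> * \<bar>X \<omega> - Y k \<omega>\<bar>)"
        using sq_int_mult[OF d, of "\<lambda>_. 1" k] by (auto simp: sq_int_def)
      fix \<omega>
      have "iexp (t * Y k \<omega>) - iexp (t * X \<omega>) = iexp (t * X \<omega>) * (iexp (t * (Y k \<omega> - X \<omega>)) - 1)"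
        by (simp add: algebra_simps flip: exp_add)
      also have "norm \<dots> = norm (iexp (t * (Y k \<omega> - X \<omega>)) - 1)" by (simp add: norm_mult)
      also have "\<dots> \<le> \<bar>t * (Y k \<omega> - X \<omega>)\<bar>" using iexp_approx1[of "t * (Y k \<omega> - X \<omega>)" 0] by simp
      finally show "norm (iexp (t * Y k \<omega>) - iexp (t * X \<omega>)) \<le> \<bar>t\<bar> * \<bar>X \<omega> - Y k \<omega>\<bar>"
        by (simp add: abs_mult abs_minus_commute)
    qed
    also have "\<dots> \<le> \<bar>t\<bar> * sqrt (expectation (\<lambda>\<omega>. (X \<omega> - Y k \<omega>)\<^sup>2))"
      using expectation_abs_le[OF d] by (simp add: mult_left_mono)
    finally show ?thesis .
  qed
  moreover have "(\<lambda>k. \<bar>t\<bar> * sqrt (expectation (\<lambda>\<omega>. (X \<omega> - Y k \<omega>)\<^sup>2))) \<longlonglongrightarrow> 0"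
    using tendsto_mult_left[OF tendsto_real_sqrt[OF lim], of "\<bar>t\<bar>"] by simp
  ultimately have "(\<lambda>k. char (distr M borel (Y k)) t - char (distr M borel X) t) \<longlonglongrightarrow> 0"
    by (rule Lim_null_comparison[OF always_eventually, rule_format])
  then have "(\<lambda>k. char (distr M borel (Y k)) t) \<longlonglongrightarrow> char (distr M borel X) t"
    by (simp add: LIM_zero_iff)
  moreover have "(\<lambda>k. complex_of_real (exp (- (v k * t\<^sup>2) / 2))) \<longlonglongrightarrow> complex_of_real (exp (- (w * t\<^sup>2) / 2))"
    by (intro tendsto_intros v) simp
  moreover have "(\<lambda>k. char (distr M borel (Y k)) t) = (\<lambda>k. complex_of_real (exp (- (v k * t\<^sup>2) / 2)))"
    using Y unfolding gauss_def by blast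
  ultimately show "char (distr M borel X) t = complex_of_real (exp (- (w * t\<^sup>2) / 2))"
    by (metis LIMSEQ_unique)
qed

lemma gauss_distributed:
  assumes "distributed M lborel X (normal_density 0 \<sigma>)" "\<sigma> > 0"
  shows "gauss X (\<sigma>\<^sup>2)"
proof -
  have Y: "distributed M lborel (\<lambda>\<omega>. X \<omega> / \<sigma>) std_normal_density"
    using assms normal_standard_normal_convert[of \<sigma> X 0] by simp
  then have [measurable]: "(\<lambda>\<omega>. X \<omega> / \<sigma>) \<in> borel_measurable M" by (auto simp: distributed_def)
  have "distr M borel (\<lambda>\<omega>. X \<omega> / \<sigma>) = std_normal_distribution"
  proof -
    have "distr M borel (\<lambda>\<omega>. X \<omega> / \<sigma>) = distr M lborel (\<lambda>\<omega>. X \<omega> / \<sigma>)" by (rule distr_cong) auto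
    then show ?thesis using distributed_distr_eq_density[OF Y] by simp
  qed
  then have "char (distr M borel (\<lambda>\<omega>. \<sigma> * (X \<omega> / \<sigma>))) t = exp (- (\<sigma>\<^sup>2 * t\<^sup>2) / 2)" for t
    by (subst char_scale) (auto simp: char_std_normal_distribution power_mult_distrib)
  moreover have "X \<in> borel_measurable M" using assms(1) by (auto simp: distributed_def)
  ultimately show ?thesis using assms(2) by (simp add: gauss_def)
qed

lemma gauss_scale: "gauss X v \<Longrightarrow> gauss (\<lambda>\<omega>. a * X \<omega>) (a\<^sup>2 * v)"
  unfolding gauss_def by (auto simp: char_scale power_mult_distrib mult_ac)

lemma gauss_sum:
  assumes "indep_vars (\<lambda>_. borel) X I" "finite I" "\<And>i. i \<in> I \<Longrightarrow> gauss (X i) (v i)"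
  shows "gauss (\<lambda>\<omega>. \<Sum>i\<in>I. X i \<omega>) (\<Sum>i\<in>I. v i)"
proof -
  have "char (distr M borel (\<lambda>\<omega>. \<Sum>i\<in>I. X i \<omega>)) t = complex_of_real (exp (- ((\<Sum>i\<in>I. v i) * t\<^sup>2) / 2))" for t
  proof -
    have "char (distr M borel (\<lambda>\<omega>. \<Sum>i\<in>I. X i \<omega>)) t = (\<Prod>i\<in>I. complex_of_real (exp (- (v i * t\<^sup>2) / 2)))"
      using assms by (simp add: char_distr_sum gauss_def)
    also have "\<dots> = complex_of_real (exp (\<Sum>i\<in>I. - (v i * t\<^sup>2) / 2))"
      using assms(2) by (simp add: exp_sum)
    also have "(\<Sum>i\<in>I. - (v i * t\<^sup>2) / 2) = - ((\<Sum>i\<in>I. v i) * t\<^sup>2) / 2"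
      by (simp add: sum_negf sum_divide_distrib[symmetric] sum_distrib_right)
    finally show ?thesis .
  qed
  then show ?thesis using assms(2,3) by (auto simp: gauss_def intro!: sum_nonneg borel_measurable_sum)
qed

end

section \<open>The Wiener integral\<close>

lemma innerH_lincomb_left:
  "f \<in> L2H \<Longrightarrow> g \<in> L2H \<Longrightarrow> h \<in> L2H \<Longrightarrow>
    innerH (\<lambda>t. a * f t + b * g t) h = a * innerH f h + b * innerH g h"
  unfolding L2H_sq_int innerH_def by (simp add: distrib_right sq_int_mult mult.assoc)

lemma innerH_commute: "innerH f g = innerH g f"
  by (simp add: innerH_def mult.commute)

lemma innerH_self: "innerH h h = (LINT t|half_line. (h t)\<^sup>2)"
  by (simp add: innerH_def power2_eq_square)

lemma L2H_lincomb: "f \<in> L2H \<Longrightarrow> g \<in> L2H \<Longrightarrow> (\<lambda>t. a * f t + b * g t) \<in> L2H"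
  by (simp add: L2H_sq_int sq_int_lincomb)

text \<open>Independence of increments is assumed along infinite strictly increasing sequences, so
  the sorted list of endpoints is continued by unit steps. Inserting 0 keeps the list
  nonempty.\<close>

lemma finite_grid:
  assumes "finite S" "S \<subseteq> {0..}"
  shows "\<exists>(t :: nat \<Rightarrow> real) m. strict_mono t \<and> 0 \<le> t 0 \<and> S \<subseteq> t ` {..m}"
proof -
  define xs where "xs = sorted_list_of_set (insert 0 S)"
  have fin: "finite (insert 0 S)" using assms by simp
  have set: "set xs = insert 0 S" unfolding xs_def using fin by (rule set_sorted_list_of_set)
  have sorted: "sorted_wrt (<) xs" by (simp add: xs_def)
  have len: "length xs > 0" using set by (cases xs) auto
  define t where "t i = (if i < length xs then xs ! i else last xs + real (i - length xs + 1))" for i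
  have "strict_mono t"
  proof (rule strict_monoI_Suc)
    fix i
    consider "Suc i < length xs" | "Suc i = length xs" | "length xs < Suc i" by linarith
    then show "t i < t (Suc i)"
    proof cases
      case 1
      then show ?thesis using sorted_wrt_nth_less[OF sorted, of i "Suc i"] by (simp add: t_def)
    next
      case 2
      then have "last xs = xs ! i" using len by (metis diff_Suc_1 last_conv_nth length_greater_0_conv)
      then show ?thesis using 2 by (simp add: t_def)
    qed (auto simp: t_def)
  qed
  moreover have "0 \<le> t 0"
  proof -
    have "xs ! 0 \<in> set xs" using len by simp
    then show ?thesis using set assms len by (auto simp: t_def)
  qed
  moreover have "S \<subseteq> t ` {..length xs}"
  proof
    fix x assume "x \<in> S"
    then have "x \<in> set xs" using set by simp
    then obtain i where "i < length xs" "x = xs ! i" by (auto simp: in_set_conv_nth)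
    then show "x \<in> t ` {..length xs}" by (intro image_eqI[of _ _ i]) (auto simp: t_def)
  qed
  ultimately show ?thesis by blast
qed

lemma indicator_Ioc_split:
  fixes t :: "nat \<Rightarrow> real"
  assumes "strict_mono t" "i \<le> j"
  shows "indicator {t i<..t j} s = (\<Sum>l\<in>{i..<j}. indicator {t l<..t (Suc l)} s :: real)"
  using assms(2)
proof (induction j rule: dec_induct)
  case (step j)
  have "t i \<le> t j" "t j < t (Suc j)" using assms(1) step
    by (auto simp: strict_mono_less_eq strict_mono_less)
  then have "indicator {t i<..t (Suc j)} s = indicator {t i<..t j} s + (indicator {t j<..t (Suc j)} s :: real)"
    by (auto simp: indicator_def)
  then show ?case using step by simp
qed simp

text \<open>The cells are disjoint, so the mixed terms vanish. The result is also the variance of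
  the corresponding combination of increments.\<close>

lemma integral_simple_steps:
  fixes t :: "nat \<Rightarrow> real"
  assumes t: "strict_mono t" "0 \<le> t 0"
  shows "(LINT s|half_line. (\<Sum>i<m. d i * indicator {t i<..t (Suc i)} s)\<^sup>2) = (\<Sum>i<m. (d i)\<^sup>2 * (t (Suc i) - t i))"
proof -
  have disj: "indicator {t i<..t (Suc i)} s * indicator {t j<..t (Suc j)} s = (0::real)" if "i < j" for i j s
  proof -
    have "t (Suc i) \<le> t j" using t(1) that by (simp add: strict_mono_less_eq)
    then show ?thesis by (auto simp: indicator_def)
  qed
  have t0: "0 \<le> t i" for i using t strict_mono_less_eq[OF t(1), of 0 i] by linarith
  have lt: "t i < t (Suc i)" for i using t by (simp add: strict_mono_less)
  have "(\<Sum>i<m. d i * indicator {t i<..t (Suc i)} s)\<^sup>2 = (\<Sum>i<m. (d i)\<^sup>2 * indicator {t i<..t (Suc i)} s)" for s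
  proof -
    have "(\<Sum>i<m. d i * indicator {t i<..t (Suc i)} s)\<^sup>2
        = (\<Sum>i<m. \<Sum>j<m. (d i * indicator {t i<..t (Suc i)} s) * (d j * indicator {t j<..t (Suc j)} s))"
      unfolding power2_eq_square by (rule sum_product)
    also have "\<dots> = (\<Sum>i<m. \<Sum>j<m. if j = i then (d i)\<^sup>2 * indicator {t i<..t (Suc i)} s else 0)"
    proof (intro sum.cong refl)
      fix i j
      show "(d i * indicator {t i<..t (Suc i)} s) * (d j * indicator {t j<..t (Suc j)} s)
          = (if j = i then (d i)\<^sup>2 * indicator {t i<..t (Suc i)} s else 0)"
        using disj[of i j s] disj[of j i s]
        by (cases i j rule: linorder_cases) (auto simp: power2_eq_square indicator_def)
    qed
    finally show ?thesis by (simp add: sum.delta)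
  qed
  moreover have "(LINT s|half_line. (\<Sum>i<m. (d i)\<^sup>2 * indicator {t i<..t (Suc i)} s)) = (\<Sum>i<m. (d i)\<^sup>2 * (t (Suc i) - t i))"
  proof -
    have sub: "{t i<..t (Suc i)} \<subseteq> {0..}" for i using t0[of i] by auto
    have set: "{t i<..t (Suc i)} \<in> sets half_line" for i using sub by (simp add: sets_half_line)
    have em: "emeasure half_line {t i<..t (Suc i)} = ennreal (t (Suc i) - t i)" for i
      using lt[of i] by (subst emeasure_half_line[OF sub]) simp
    have "integrable half_line (indicator {t i<..t (Suc i)} :: real \<Rightarrow> real)" for i
      using set em by (intro integrable_real_indicator) auto
    moreover have "(LINT s|half_line. indicator {t i<..t (Suc i)} s) = t (Suc i) - t i" for i
      using set[of i] em[of i] lt[of i] sub[of i]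
      by (simp add: measure_def Int_absorb2)
    ultimately have "integrable half_line (\<lambda>s. (d i)\<^sup>2 * indicator {t i<..t (Suc i)} s)"
      "(LINT s|half_line. (d i)\<^sup>2 * indicator {t i<..t (Suc i)} s) = (d i)\<^sup>2 * (t (Suc i) - t i)" for i
      by (auto simp only: integral_mult_right_zero intro: integrable_mult_right)
    then show ?thesis by (subst Bochner_Integration.integral_sum) (simp_all only:)
  qed
  ultimately show ?thesis by simp
qed

section \<open>Isometry, linearity, existence and uniqueness of the Wiener integral\<close>

context wiener_space begin

lemma step_integral_Nil [simp]: "step_integral [] = (\<lambda>_. 0)"
  by (auto simp: step_integral_def)

lemma step_integral_Cons: "step_integral ((c, u, v) # ps) = (\<lambda>\<omega>. c * (W v \<omega> - W u \<omega>) + step_integral ps \<omega>)"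
  by (auto simp: step_integral_def)

lemma step_integral_append: "step_integral (ps @ qs) = (\<lambda>\<omega>. step_integral ps \<omega> + step_integral qs \<omega>)"
  by (auto simp: step_integral_def)

lemma step_integral_scale: "step_integral (scale_steps a ps) = (\<lambda>\<omega>. a * step_integral ps \<omega>)"
  by (induction ps) (auto simp: scale_steps_def step_integral_Cons algebra_simps)

text \<open>The point is that one and the same \<open>d\<close> serves the integral and the step
  function; this yields the isometry.\<close>

lemma step_common_grid:
  assumes t: "strict_mono t" and "valid_steps ps" "\<forall>(c, u, v)\<in>set ps. u \<in> t ` {..m} \<and> v \<in> t ` {..m}"
  shows "\<exists>d. step_integral ps = (\<lambda>\<omega>. \<Sum>i<m. d i * (W (t (Suc i)) \<omega> - W (t i) \<omega>)) \<and>
    step_fun ps = (\<lambda>s. \<Sum>i<m. d i * indicator {t i<..t (Suc i)} s)"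
  using assms(2,3)
proof (induction ps)
  case Nil
  then show ?case by (intro exI[of _ "\<lambda>_. 0"]) auto
next
  case (Cons p ps)
  obtain c u v where p: "p = (c, u, v)" by (cases p) auto
  from Cons p obtain d where d: "step_integral ps = (\<lambda>\<omega>. \<Sum>i<m. d i * (W (t (Suc i)) \<omega> - W (t i) \<omega>))"
    "step_fun ps = (\<lambda>s. \<Sum>i<m. d i * indicator {t i<..t (Suc i)} s)" by auto
  from Cons p obtain i j where ij: "u = t i" "v = t j" "i \<le> m" "j \<le> m" by auto
  have "i \<le> j" using Cons p ij t by (auto simp: strict_mono_less_eq)
  \<comment> \<open>The piece with value \<open>c\<close> on \<open>{u<..v}\<close> contributes
    \<open>c\<close> to each grid cell between \<open>u\<close> and \<open>v\<close>.\<close>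
  define e where "e l = (if l \<in> {i..<j} then c else 0)" for l
  have e: "(\<Sum>l<m. e l * f l) = c * (\<Sum>l\<in>{i..<j}. f l)" for f :: "nat \<Rightarrow> real"
  proof -
    have "(\<Sum>l<m. e l * f l) = (\<Sum>l\<in>{i..<j}. c * f l)"
      by (rule sum.mono_neutral_cong_right) (use ij in \<open>auto simp: e_def\<close>)
    then show ?thesis by (simp add: sum_distrib_left)
  qed
  have "W v \<omega> - W u \<omega> = (\<Sum>l\<in>{i..<j}. W (t (Suc l)) \<omega> - W (t l) \<omega>)" for \<omega>
    using sum_Suc_diff'[OF \<open>i \<le> j\<close>, of "\<lambda>l. W (t l) \<omega>"] ij by simp
  then show ?case using d indicator_Ioc_split[OF t \<open>i \<le> j\<close>] ij(1,2)
    by (intro exI[of _ "\<lambda>l. e l + d l"])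
      (simp add: p step_integral_Cons step_fun_Cons distrib_right sum.distrib e)
qed

text \<open>The Wiener isometry for step functions: on a common grid the integral is a sum of
  independent Gaussians, and its variance is the squared norm of the step function.\<close>

lemma step_integral_gauss:
  assumes "valid_steps ps"
  shows "gauss (step_integral ps) (LINT s|half_line. (step_fun ps s)\<^sup>2)"
proof -
  define S where "S = (\<lambda>(c, u, v). u) ` set ps \<union> (\<lambda>(c, u, v). v) ` set ps"
  have "finite S" "S \<subseteq> {0..}" using assms by (auto simp: S_def valid_steps_def)
  from finite_grid[OF this] obtain t :: "nat \<Rightarrow> real" and m
    where t: "strict_mono t" "0 \<le> t 0" "S \<subseteq> t ` {..m}" by blast
  have "\<forall>(c, u, v)\<in>set ps. u \<in> t ` {..m} \<and> v \<in> t ` {..m}"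
  proof safe
    fix c u v assume "(c, u, v) \<in> set ps"
    then have "u \<in> S" "v \<in> S" unfolding S_def by force+
    then show "u \<in> t ` {..m}" "v \<in> t ` {..m}" using t(3) by auto
  qed
  from step_common_grid[OF t(1) assms this] obtain d where
    d: "step_integral ps = (\<lambda>\<omega>. \<Sum>i<m. d i * (W (t (Suc i)) \<omega> - W (t i) \<omega>))"
    "step_fun ps = (\<lambda>s. \<Sum>i<m. d i * indicator {t i<..t (Suc i)} s)" by blast
  have t0: "0 \<le> t i" for i using t strict_mono_less_eq[OF t(1), of 0 i] by linarith
  have lt: "t i < t (Suc i)" for i using t by (simp add: strict_mono_less)
  have "gauss (\<lambda>\<omega>. d i * (W (t (Suc i)) \<omega> - W (t i) \<omega>)) ((d i)\<^sup>2 * (t (Suc i) - t i))" for i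
    using gauss_scale[OF gauss_distributed[OF W_normal[OF t0[of i] lt[of i]]], of "d i"] lt[of i] by simp
  then have "gauss (\<lambda>\<omega>. \<Sum>i<m. d i * (W (t (Suc i)) \<omega> - W (t i) \<omega>)) (\<Sum>i<m. (d i)\<^sup>2 * (t (Suc i) - t i))"
    by (intro gauss_sum indep_vars_compose2[OF W_indep[OF t(2,1)], of m "\<lambda>i x. d i * x" "\<lambda>_. borel"]) auto
  then show ?thesis unfolding d integral_simple_steps[OF t(1,2)] .
qed

lemma wiener_integral_sq_int: "is_wiener_integral h X \<Longrightarrow> sq_int M X"
  by (simp add: is_wiener_integral_def sq_int_def)

lemma wiener_integral_gauss:
  assumes h: "h \<in> L2H" and X: "is_wiener_integral h X"
  shows "gauss X (innerH h h)"
proof -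
  obtain ps where ps: "\<And>k. valid_steps (ps k)"
    "(\<lambda>k. LINT t|half_line. (h t - step_fun (ps k) t)\<^sup>2) \<longlonglongrightarrow> 0"
    "(\<lambda>k. expectation (\<lambda>\<omega>. (X \<omega> - step_integral (ps k) \<omega>)\<^sup>2)) \<longlonglongrightarrow> 0"
    using X by (auto simp: is_wiener_integral_def)
  have "(\<lambda>k. LINT t|half_line. (step_fun (ps k) t)\<^sup>2) \<longlonglongrightarrow> (LINT t|half_line. (h t)\<^sup>2)"
    using h ps by (intro sq_integral_tendsto) (auto simp: L2H_sq_int sq_int_step_fun)
  with gauss_limit[OF wiener_integral_sq_int[OF X] step_integral_gauss[OF ps(1)] ps(3)]
  show ?thesis by (simp add: innerH_self)
qed

text \<open>Linearity is stated for the relation, because \<open>WI\<close> picks representatives by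
  choice and is linear only up to null sets.\<close>

lemma wiener_integral_lincomb:
  assumes h: "h \<in> L2H" "is_wiener_integral h X" and g: "g \<in> L2H" "is_wiener_integral g Y"
  shows "is_wiener_integral (\<lambda>t. a * h t + b * g t) (\<lambda>\<omega>. a * X \<omega> + b * Y \<omega>)"
proof -
  obtain ps where ps: "\<And>k. valid_steps (ps k)"
    "(\<lambda>k. LINT t|half_line. (h t - step_fun (ps k) t)\<^sup>2) \<longlonglongrightarrow> 0"
    "(\<lambda>k. expectation (\<lambda>\<omega>. (X \<omega> - step_integral (ps k) \<omega>)\<^sup>2)) \<longlonglongrightarrow> 0"
    using h by (auto simp: is_wiener_integral_def)
  obtain qs where qs: "\<And>k. valid_steps (qs k)"
    "(\<lambda>k. LINT t|half_line. (g t - step_fun (qs k) t)\<^sup>2) \<longlonglongrightarrow> 0"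
    "(\<lambda>k. expectation (\<lambda>\<omega>. (Y \<omega> - step_integral (qs k) \<omega>)\<^sup>2)) \<longlonglongrightarrow> 0"
    using g by (auto simp: is_wiener_integral_def)
  define rs where "rs k = scale_steps a (ps k) @ scale_steps b (qs k)" for k
  have rs: "valid_steps (rs k)" for k using ps(1) qs(1) by (simp add: rs_def valid_steps_scale)
  \<comment> \<open>Stated over an arbitrary measure so that it serves both for the integrands on
    the half-line and for the integrals on the probability space.\<close>
  have lim: "(\<lambda>k. LINT x|N. (a * f x + b * f' x - (a * u k x + b * u' k x))\<^sup>2) \<longlonglongrightarrow> 0"
    if "\<And>k. sq_int N (\<lambda>x. f x - u k x)" "\<And>k. sq_int N (\<lambda>x. f' x - u' k x)"
      "(\<lambda>k. LINT x|N. (f x - u k x)\<^sup>2) \<longlonglongrightarrow> 0" "(\<lambda>k. LINT x|N. (f' x - u' k x)\<^sup>2) \<longlonglongrightarrow> 0"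
    for N :: "'z measure" and f f' u u'
  proof (rule tendsto_sandwich[where f = "\<lambda>_. 0"])
    have eq: "a * f x + b * f' x - (a * u k x + b * u' k x) = a * (f x - u k x) + b * (f' x - u' k x)" for k x
      by (simp add: algebra_simps)
    show "\<forall>\<^sub>F k in sequentially. (LINT x|N. (a * f x + b * f' x - (a * u k x + b * u' k x))\<^sup>2)
        \<le> 2 * a\<^sup>2 * (LINT x|N. (f x - u k x)\<^sup>2) + 2 * b\<^sup>2 * (LINT x|N. (f' x - u' k x)\<^sup>2)"
      unfolding eq by (intro always_eventually allI sq_integral_lincomb_le that)
    have "(\<lambda>k. 2 * a\<^sup>2 * (LINT x|N. (f x - u k x)\<^sup>2) + 2 * b\<^sup>2 * (LINT x|N. (f' x - u' k x)\<^sup>2))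
       \<longlonglongrightarrow> 2 * a\<^sup>2 * 0 + 2 * b\<^sup>2 * 0" by (intro tendsto_intros that)
    then show "(\<lambda>k. 2 * a\<^sup>2 * (LINT x|N. (f x - u k x)\<^sup>2) + 2 * b\<^sup>2 * (LINT x|N. (f' x - u' k x)\<^sup>2)) \<longlonglongrightarrow> 0"
      by simp
  qed auto
  have "(\<lambda>k. LINT t|half_line. (a * h t + b * g t - step_fun (rs k) t)\<^sup>2) \<longlonglongrightarrow> 0"
    unfolding rs_def step_fun_append step_fun_scale using h g ps qs
    by (intro lim sq_int_diff sq_int_step_fun) (auto simp: L2H_sq_int)
  moreover have "(\<lambda>k. expectation (\<lambda>\<omega>. (a * X \<omega> + b * Y \<omega> - step_integral (rs k) \<omega>)\<^sup>2)) \<longlonglongrightarrow> 0"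
    unfolding rs_def step_integral_append step_integral_scale using h g ps qs
    by (intro lim sq_int_diff gauss_sq_int[OF step_integral_gauss] wiener_integral_sq_int) auto
  moreover have "sq_int M (\<lambda>\<omega>. a * X \<omega> + b * Y \<omega>)"
    using h g by (intro sq_int_lincomb wiener_integral_sq_int)
  ultimately show ?thesis using rs by (auto simp: is_wiener_integral_def sq_int_def)
qed

text \<open>By the isometry, integrals of step functions converging to \<open>h\<close> form a
  mean-square Cauchy sequence. The isometry is applied to the difference, which is itself the
  integral of a step function.\<close>

lemma wiener_integral_exists:
  assumes h: "h \<in> L2H"
  shows "\<exists>X. is_wiener_integral h X"
proof -
  obtain ps where ps: "\<And>k. valid_steps (ps k)"
    "(\<lambda>k. LINT t|half_line. (h t - step_fun (ps k) t)\<^sup>2) \<longlonglongrightarrow> 0"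
    using step_sequence[OF h] by blast
  have d: "sq_int half_line (\<lambda>t. h t - step_fun (ps k) t)" for k
    using h ps(1) by (intro sq_int_diff sq_int_step_fun) (auto simp: L2H_sq_int)
  have le: "expectation (\<lambda>\<omega>. (step_integral (ps i) \<omega> - step_integral (ps j) \<omega>)\<^sup>2)
      \<le> 2 * (LINT t|half_line. (h t - step_fun (ps i) t)\<^sup>2) + 2 * (LINT t|half_line. (h t - step_fun (ps j) t)\<^sup>2)"
    for i j
  proof -
    have "valid_steps (scale_steps (-1) (ps j) @ ps i)" using ps by (simp add: valid_steps_scale)
    from gauss_square[OF step_integral_gauss[OF this]]
    have "expectation (\<lambda>\<omega>. (step_integral (ps i) \<omega> - step_integral (ps j) \<omega>)\<^sup>2)
        = (LINT t|half_line. (step_fun (ps i) t - step_fun (ps j) t)\<^sup>2)"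
      by (simp add: step_integral_append step_integral_scale step_fun_append step_fun_scale)
    also have "\<dots> = (LINT t|half_line. ((-1) * (h t - step_fun (ps i) t) + 1 * (h t - step_fun (ps j) t))\<^sup>2)"
      by simp
    also have "\<dots> \<le> 2 * (LINT t|half_line. (h t - step_fun (ps i) t)\<^sup>2) + 2 * (LINT t|half_line. (h t - step_fun (ps j) t)\<^sup>2)"
      using sq_integral_lincomb_le[OF d d, of "-1" i 1 j] by simp
    finally show ?thesis .
  qed
  have "\<exists>Y. sq_int M Y \<and> (\<lambda>k. expectation (\<lambda>\<omega>. (Y \<omega> - step_integral (ps k) \<omega>)\<^sup>2)) \<longlonglongrightarrow> 0"
  proof (rule L2_complete)
    show "sq_int M (step_integral (ps k))" for k by (rule gauss_sq_int[OF step_integral_gauss[OF ps(1)]])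
    fix e :: real assume "e > 0"
    then obtain K where K: "\<And>k. k \<ge> K \<Longrightarrow> (LINT t|half_line. (h t - step_fun (ps k) t)\<^sup>2) < e / 4"
      using order_tendstoD(2)[OF ps(2), of "e / 4"] by (auto simp: eventually_sequentially)
    have "expectation (\<lambda>\<omega>. (step_integral (ps i) \<omega> - step_integral (ps j) \<omega>)\<^sup>2) < e" if "i \<ge> K" "j \<ge> K" for i j
      using le[of i j] K[OF that(1)] K[OF that(2)] by simp
    then show "\<exists>K. \<forall>i\<ge>K. \<forall>j\<ge>K. expectation (\<lambda>\<omega>. (step_integral (ps i) \<omega> - step_integral (ps j) \<omega>)\<^sup>2) < e"
      by blast
  qed
  then show ?thesis using ps by (auto simp: is_wiener_integral_def sq_int_def)
qed

lemma is_wiener_integral_WI: "h \<in> L2H \<Longrightarrow> is_wiener_integral h (WI h)"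
  using someI_ex[OF wiener_integral_exists[of h]] by (simp add: WI_def)

text \<open>The difference of two integrals of \<open>h\<close> is an integral of the zero function,
  hence Gaussian with variance 0.\<close>

lemma wiener_integral_unique:
  assumes "h \<in> L2H" "is_wiener_integral h X" "is_wiener_integral h Y"
  shows "AE \<omega> in M. X \<omega> = Y \<omega>"
proof -
  let ?Z = "\<lambda>\<omega>. 1 * X \<omega> + (-1) * Y \<omega>"
  have "is_wiener_integral (\<lambda>t. 1 * h t + (-1) * h t) ?Z"
    using assms by (intro wiener_integral_lincomb)
  from wiener_integral_gauss[OF L2H_lincomb[OF assms(1,1)] this]
  have Z: "gauss ?Z 0" by (simp add: innerH_def)
  have "expectation (\<lambda>\<omega>. (?Z \<omega>)\<^sup>2) = 0" using gauss_square[OF Z] .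
  then have "AE \<omega> in M. (?Z \<omega>)\<^sup>2 = 0"
    using gauss_sq_int[OF Z] by (subst (asm) integral_nonneg_eq_0_iff_AE) (auto simp: sq_int_def)
  then show ?thesis by eventually_elim simp
qed

lemma WI_AE_eq: "h \<in> L2H \<Longrightarrow> is_wiener_integral h X \<Longrightarrow> AE \<omega> in M. WI h \<omega> = X \<omega>"
  using wiener_integral_unique is_wiener_integral_WI by blast

lemma is_wiener_integral_step:
  "valid_steps ps \<Longrightarrow> is_wiener_integral (step_fun ps) (step_integral ps)"
  using gauss_sq_int[OF step_integral_gauss]
  by (auto simp: is_wiener_integral_def sq_int_def intro!: exI[of _ "\<lambda>_. ps"])

lemma WI_measurable: "h \<in> L2H \<Longrightarrow> WI h \<in> borel_measurable M"
  using is_wiener_integral_WI by (auto simp: is_wiener_integral_def)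

end

section \<open>Integration by parts for polynomials in Wiener integrals\<close>

context prob_space begin

text \<open>Moments of all orders. This class is an algebra containing all polynomials in Wiener
  integrals, so that integrability conditions reduce to membership.\<close>

definition mom :: "('a \<Rightarrow> real) \<Rightarrow> bool" where
  "mom X \<longleftrightarrow> X \<in> borel_measurable M \<and> (\<forall>n. integrable M (\<lambda>\<omega>. X \<omega> ^ n))"

lemma mom_measurable: "mom X \<Longrightarrow> X \<in> borel_measurable M"
  by (simp add: mom_def)

lemma mom_integrable: "mom X \<Longrightarrow> integrable M X"
  unfolding mom_def by (metis (no_types, lifting) Bochner_Integration.integrable_cong power_one_right)

lemma mom_const [simp]: "mom (\<lambda>_. c)"
  by (simp add: mom_def)

lemma power_le_one_plus_even: "\<bar>x :: real\<bar> ^ n \<le> 1 + x ^ (2 * n)"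
proof -
  have "2 * \<bar>x\<bar> ^ n \<le> 1 + (\<bar>x\<bar> ^ n)\<^sup>2" using sum_squares_bound[of 1 "\<bar>x\<bar> ^ n"] by simp
  also have "(\<bar>x\<bar> ^ n)\<^sup>2 = x ^ (2 * n)" by (simp add: power_mult power2_eq_square power_mult_distrib[symmetric])
  finally show ?thesis using zero_le_power[of "\<bar>x\<bar>" n] by linarith
qed

lemma mom_mult:
  assumes X: "mom X" and Y: "mom Y"
  shows "mom (\<lambda>\<omega>. X \<omega> * Y \<omega>)"
  unfolding mom_def
proof (intro conjI allI)
  show m: "(\<lambda>\<omega>. X \<omega> * Y \<omega>) \<in> borel_measurable M"
    using X Y by (auto simp: mom_def intro: borel_measurable_times)
  fix n
  have "sq_int M (\<lambda>\<omega>. X \<omega> ^ n)" "sq_int M (\<lambda>\<omega>. Y \<omega> ^ n)"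
    using X Y by (auto simp: sq_int_def mom_def power_mult[symmetric])
  from sq_int_mult[OF this] show "integrable M (\<lambda>\<omega>. (X \<omega> * Y \<omega>) ^ n)"
    by (simp add: power_mult_distrib)
qed

lemma mom_add:
  assumes X: "mom X" and Y: "mom Y"
  shows "mom (\<lambda>\<omega>. X \<omega> + Y \<omega>)"
  unfolding mom_def
proof (intro conjI allI)
  show m: "(\<lambda>\<omega>. X \<omega> + Y \<omega>) \<in> borel_measurable M"
    using X Y by (auto simp: mom_def intro: borel_measurable_add)
  fix n
  show "integrable M (\<lambda>\<omega>. (X \<omega> + Y \<omega>) ^ n)"
  proof (rule Bochner_Integration.integrable_bound)
    show "integrable M (\<lambda>\<omega>. 2 ^ n * (2 + X \<omega> ^ (2 * n) + Y \<omega> ^ (2 * n)))"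
      using X Y by (auto simp: mom_def)
    have "\<bar>x + y\<bar> ^ n \<le> 2 ^ n * (2 + x ^ (2 * n) + y ^ (2 * n))" for x y :: real
    proof -
      have "\<bar>x + y\<bar> ^ n \<le> (2 * max \<bar>x\<bar> \<bar>y\<bar>) ^ n" by (intro power_mono) auto
      also have "\<dots> = 2 ^ n * max \<bar>x\<bar> \<bar>y\<bar> ^ n" by (simp add: power_mult_distrib)
      also have "max \<bar>x\<bar> \<bar>y\<bar> ^ n \<le> \<bar>x\<bar> ^ n + \<bar>y\<bar> ^ n" by (auto simp: max_def)
      also have "\<dots> \<le> 2 + x ^ (2 * n) + y ^ (2 * n)"
        using power_le_one_plus_even[of x n] power_le_one_plus_even[of y n] by linarith
      finally show ?thesis by simp
    qed
    moreover have "0 \<le> 2 + x ^ (2 * n) + y ^ (2 * n)" for x y :: real by (simp add: add_nonneg_nonneg)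
    ultimately show "AE \<omega> in M. norm ((X \<omega> + Y \<omega>) ^ n) \<le> norm (2 ^ n * (2 + X \<omega> ^ (2 * n) + Y \<omega> ^ (2 * n)))"
      by (simp add: power_abs abs_mult)
  qed (use m in measurable)
qed

lemma mom_scale: "mom X \<Longrightarrow> mom (\<lambda>\<omega>. c * X \<omega>)"
  by (intro mom_mult mom_const)

lemma mom_power: "mom X \<Longrightarrow> mom (\<lambda>\<omega>. X \<omega> ^ n)"
  by (induction n) (auto intro: mom_mult)

lemma mom_prod: "(\<And>i. i \<in> I \<Longrightarrow> mom (X i)) \<Longrightarrow> mom (\<lambda>\<omega>. \<Prod>i\<in>I. X i \<omega>)"
  by (induction I rule: infinite_finite_induct) (auto intro: mom_mult)

lemma mom_poly_fun:
  assumes "poly_fun k p" "\<And>i. i < k \<Longrightarrow> mom (X i)"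
  shows "mom (\<lambda>\<omega>. p (\<lambda>i. X i \<omega>))"
  using assms(1)
  by (induction rule: poly_fun_induct)
    (auto intro!: mom_add mom_scale mom_prod mom_power assms(2) simp: monom_fun_def)

lemma mom_gauss: "gauss X v \<Longrightarrow> mom X"
  using gauss_moment(1) by (auto simp: mom_def gauss_def)

lemma mom_AE_cong:
  assumes "mom X" "Y \<in> borel_measurable M" "AE \<omega> in M. X \<omega> = Y \<omega>"
  shows "mom Y"
  unfolding mom_def
proof (intro conjI allI assms(2))
  fix n
  have "AE \<omega> in M. X \<omega> ^ n = Y \<omega> ^ n" using assms(3) by eventually_elim simp
  then show "integrable M (\<lambda>\<omega>. Y \<omega> ^ n)"
    using assms by (subst integrable_cong_AE[symmetric, where f = "\<lambda>\<omega>. X \<omega> ^ n"]) (auto simp: mom_def)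
qed

lemma mom_AE_zero:
  assumes "mom X" "expectation (\<lambda>\<omega>. X \<omega> * X \<omega>) = 0"
  shows "AE \<omega> in M. X \<omega> = 0"
proof -
  have "AE \<omega> in M. X \<omega> * X \<omega> = 0"
    using assms mom_integrable[OF mom_mult, of X X]
    by (subst (asm) integral_nonneg_eq_0_iff_AE) auto
  then show ?thesis by eventually_elim simp
qed

text \<open>By the binomial theorem the expectation is a polynomial in \<open>t\<close>, so the
  derivative at 0 is its linear coefficient and no limit is exchanged with the integral.\<close>

lemma DERIV_moment_at_0:
  assumes Q: "mom Q" and X: "mom X" and Z: "mom Z"
  shows "((\<lambda>t. expectation (\<lambda>\<omega>. Q \<omega> * (X \<omega> + t * Z \<omega>) ^ m)) has_field_derivative
    real m * expectation (\<lambda>\<omega>. Q \<omega> * X \<omega> ^ (m - 1) * Z \<omega>)) (at 0)"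
proof -
  define c where "c k = real (m choose k) * expectation (\<lambda>\<omega>. Q \<omega> * (Z \<omega> ^ k * X \<omega> ^ (m - k)))" for k
  have "expectation (\<lambda>\<omega>. Q \<omega> * (X \<omega> + t * Z \<omega>) ^ m) = (\<Sum>k\<le>m. c k * t ^ k)" for t
  proof -
    have "Q \<omega> * (X \<omega> + t * Z \<omega>) ^ m
        = (\<Sum>k\<le>m. (real (m choose k) * t ^ k) * (Q \<omega> * (Z \<omega> ^ k * X \<omega> ^ (m - k))))" for \<omega>
      unfolding add.commute[of "X \<omega>"] binomial_ring
      by (simp add: sum_distrib_left power_mult_distrib mult_ac)
    moreover have "integrable M (\<lambda>\<omega>. Q \<omega> * (Z \<omega> ^ k * X \<omega> ^ (m - k)))" for k
      by (intro mom_integrable mom_mult mom_power assms)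
    ultimately have "expectation (\<lambda>\<omega>. Q \<omega> * (X \<omega> + t * Z \<omega>) ^ m) = (\<Sum>k\<le>m. expectation
        (\<lambda>\<omega>. (real (m choose k) * t ^ k) * (Q \<omega> * (Z \<omega> ^ k * X \<omega> ^ (m - k)))))"
      by (simp only: integrable_mult_right Bochner_Integration.integral_sum)
    then show ?thesis unfolding integral_mult_right_zero c_def by (simp add: mult_ac)
  qed
  moreover have "((\<lambda>t. \<Sum>k\<le>m. c k * t ^ k) has_field_derivative (\<Sum>k\<le>m. c k * (real k * 0 ^ (k - 1)))) (at 0)"
    by (auto intro!: derivative_eq_intros sum.cong)
  moreover have "(\<Sum>k\<le>m. c k * (real k * 0 ^ (k - 1))) = real m * expectation (\<lambda>\<omega>. Q \<omega> * X \<omega> ^ (m - 1) * Z \<omega>)"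
  proof (cases m)
    case (Suc l)
    have "(\<Sum>k\<le>m. c k * (real k * 0 ^ (k - 1))) = (\<Sum>k\<le>m. if k = 1 then c 1 else 0)"
      by (intro sum.cong refl) (auto simp: power_0_left)
    also have "\<dots> = c 1" using Suc by (simp add: sum.delta)
    finally show ?thesis by (simp add: c_def mult_ac)
  qed simp
  ultimately show ?thesis by simp
qed

end

text \<open>Builds a polynomial by multiplying with one variable at a time, matching the closure
  properties \<open>ibp_const\<close>, \<open>ibp_add\<close> and \<open>ibp_mult\<close>.\<close>

lemma poly_fun_ring_induct [consumes 1, case_names const add mult_var]:
  assumes "poly_fun k p"
    and const: "\<And>c. Q (\<lambda>_. c)"
    and add: "\<And>p q. poly_fun k p \<Longrightarrow> Q p \<Longrightarrow> poly_fun k q \<Longrightarrow> Q q \<Longrightarrow> Q (\<lambda>x. p x + q x)"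
    and mult: "\<And>p i. i < k \<Longrightarrow> poly_fun k p \<Longrightarrow> Q p \<Longrightarrow> Q (\<lambda>x. p x * x i)"
  shows "Q p"
  using assms(1)
proof (induction rule: poly_fun_induct)
  case (add a c q)
  have step: "poly_fun k (\<lambda>x. r x * x i ^ n) \<and> Q (\<lambda>x. r x * x i ^ n)"
    if "poly_fun k r" "Q r" "i < k" for r i n
  proof (induction n)
    case (Suc n)
    then show ?case using mult[OF \<open>i < k\<close>, of "\<lambda>x. r x * x i ^ n"] poly_fun_mult[OF _ poly_fun_var[OF \<open>i < k\<close>], of "\<lambda>x. r x * x i ^ n"]
      by (simp add: mult_ac)
  qed (use that in simp)
  have "poly_fun k (\<lambda>x. c * (\<Prod>i<j. x i ^ a i)) \<and> Q (\<lambda>x. c * (\<Prod>i<j. x i ^ a i))" if "j \<le> k" for j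
    using that
  proof (induction j)
    case (Suc j)
    then show ?case using step[of "\<lambda>x. c * (\<Prod>i<j. x i ^ a i)" j "a j"] by (simp add: mult_ac)
  qed (simp add: const)
  from this[of k] show ?case using add assms(3) by (simp add: monom_fun_def)
qed (rule const)

definition dirp :: "nat \<Rightarrow> (nat \<Rightarrow> real \<Rightarrow> real) \<Rightarrow> (real \<Rightarrow> real) \<Rightarrow> ((nat \<Rightarrow> real) \<Rightarrow> real) \<Rightarrow> (nat \<Rightarrow> real) \<Rightarrow> real" where
  "dirp k h g p x = (\<Sum>i<k. partial i p x * innerH (h i) g)"

lemma poly_fun_dirp: "poly_fun k p \<Longrightarrow> poly_fun k (dirp k h g p)"
  unfolding dirp_def by (intro poly_fun_sum poly_fun_mult poly_fun_partial) auto

lemma dirp_const [simp]: "dirp k h g (\<lambda>_. c) x = 0"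
  by (simp add: dirp_def)

lemma dirp_add:
  "poly_fun k p \<Longrightarrow> poly_fun k q \<Longrightarrow> dirp k h g (\<lambda>x. p x + q x) x = dirp k h g p x + dirp k h g q x"
  by (simp add: dirp_def partial_add[where k = k] sum.distrib distrib_right)

lemma dirp_scale: "poly_fun k p \<Longrightarrow> dirp k h g (\<lambda>x. c * p x) x = c * dirp k h g p x"
  by (simp add: dirp_def partial_scale[where k = k] sum_distrib_left mult_ac)

lemma dirp_mult:
  "poly_fun k p \<Longrightarrow> poly_fun k q \<Longrightarrow>
    dirp k h g (\<lambda>x. p x * q x) x = dirp k h g p x * q x + p x * dirp k h g q x"
  by (simp add: dirp_def partial_mult[where k = k] distrib_left sum.distrib sum_distrib_left mult_ac)

lemma dirp_var: "i < k \<Longrightarrow> dirp k h g (\<lambda>x. x i) x = innerH (h i) g"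
  by (simp add: dirp_def partial_var if_distrib[where f = "\<lambda>u. u * _"] sum.delta' cong: if_cong)

context wiener_space begin

text \<open>\<open>D g\<close> plays the role of the derivative of \<open>Q\<close> in direction \<open>g\<close>.  The extra power of a
  Wiener integral makes the property inductive: replacing \<open>X\<close> by \<open>X + t Z\<close> and differentiating
  at \<open>t = 0\<close> passes from \<open>Q\<close> to \<open>Q Z\<close>.\<close>

definition ibp :: "('a \<Rightarrow> real) \<Rightarrow> ((real \<Rightarrow> real) \<Rightarrow> 'a \<Rightarrow> real) \<Rightarrow> bool" where
  "ibp Q D \<longleftrightarrow> mom Q \<and> (\<forall>g\<in>L2H. mom (D g)) \<and>
     (\<forall>h g X Y n. h \<in> L2H \<longrightarrow> g \<in> L2H \<longrightarrow> is_wiener_integral h X \<longrightarrow> is_wiener_integral g Y \<longrightarrow>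
       expectation (\<lambda>\<omega>. Q \<omega> * Y \<omega> * X \<omega> ^ n) =
         expectation (\<lambda>\<omega>. D g \<omega> * X \<omega> ^ n) + real n * innerH h g * expectation (\<lambda>\<omega>. Q \<omega> * X \<omega> ^ (n - 1)))"

lemma wiener_integral_mom: "h \<in> L2H \<Longrightarrow> is_wiener_integral h X \<Longrightarrow> mom X"
  using mom_gauss wiener_integral_gauss by blast

text \<open>Polarization: \<open>X + t Y\<close> is a Wiener integral for every \<open>t\<close>, so
  the one-variable moment recursion holds along the whole line, and its derivative at
  \<open>t = 0\<close> is a recursion for mixed moments.\<close>

lemma ibp_one: "ibp (\<lambda>_. 1) (\<lambda>_ _. 0)"
proof -
  have "expectation (\<lambda>\<omega>. Y \<omega> * X \<omega> ^ n) = real n * innerH h g * expectation (\<lambda>\<omega>. X \<omega> ^ (n - 1))"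
    if h: "h \<in> L2H" "is_wiener_integral h X" and g: "g \<in> L2H" "is_wiener_integral g Y" for h g X Y n
  proof (induction n rule: less_induct)
    case (less n)
    have mX: "mom X" "mom Y" using h g wiener_integral_mom by auto
    note gX = wiener_integral_gauss[OF h]
    show ?case
    proof (cases n)
      case 0
      then show ?thesis using gauss_mean[OF wiener_integral_gauss[OF g]] by simp
    next
      case (Suc m)
      have lin: "innerH (\<lambda>s. 1 * h s + t * g s) (\<lambda>s. 1 * h s + t * g s)
          = innerH h h + 2 * t * innerH h g + t\<^sup>2 * innerH g g" for t
        unfolding innerH_lincomb_left[OF h(1) g(1) L2H_lincomb[OF h(1) g(1)]]
          innerH_commute[of _ "\<lambda>s. 1 * h s + t * g s"]
          innerH_lincomb_left[OF h(1) g(1) h(1)] innerH_lincomb_left[OF h(1) g(1) g(1)]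
        by (simp add: innerH_commute[of g h] algebra_simps power2_eq_square)
      let ?E = "\<lambda>m t. expectation (\<lambda>\<omega>. 1 * (X \<omega> + t * Y \<omega>) ^ m)"
      \<comment> \<open>The middle factor is the variance of \<open>X + t Y\<close>, a quadratic
        polynomial in \<open>t\<close>.\<close>
      have rec: "?E (Suc (Suc m)) t = real (Suc m) * (innerH h h + 2 * t * innerH h g + t\<^sup>2 * innerH g g) * ?E m t" for t
      proof -
        have "is_wiener_integral (\<lambda>s. 1 * h s + t * g s) (\<lambda>\<omega>. 1 * X \<omega> + t * Y \<omega>)"
          using h g by (intro wiener_integral_lincomb)
        from gauss_moment_rec[OF wiener_integral_gauss[OF L2H_lincomb[OF h(1) g(1)] this], of m]
        show ?thesis unfolding lin by (simp add: mult_ac)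
      qed
      have "((\<lambda>t. real (Suc m) * (innerH h h + 2 * t * innerH h g + t\<^sup>2 * innerH g g) * ?E m t) has_field_derivative
          real (Suc m) * (2 * innerH h g) * ?E m 0
          + real (Suc m) * innerH h h * (real m * expectation (\<lambda>\<omega>. 1 * X \<omega> ^ (m - 1) * Y \<omega>))) (at 0)"
        by (rule derivative_eq_intros refl DERIV_moment_at_0 mom_const mX)+ simp
      moreover have "((\<lambda>t. ?E (Suc (Suc m)) t) has_field_derivative
          real (Suc (Suc m)) * expectation (\<lambda>\<omega>. 1 * X \<omega> ^ (Suc (Suc m) - 1) * Y \<omega>)) (at 0)"
        by (rule DERIV_moment_at_0 mom_const mX)+
      ultimately have eq: "real (Suc (Suc m)) * expectation (\<lambda>\<omega>. X \<omega> ^ Suc m * Y \<omega>)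
          = real (Suc m) * (2 * innerH h g) * expectation (\<lambda>\<omega>. X \<omega> ^ m)
          + real (Suc m) * innerH h h * (real m * expectation (\<lambda>\<omega>. X \<omega> ^ (m - 1) * Y \<omega>))"
        unfolding rec using DERIV_unique by fastforce
      \<comment> \<open>The remaining mixed moment has a lower power of \<open>X\<close>. The
        induction hypothesis evaluates it and the moment recursion for \<open>X\<close> absorbs
        \<open>innerH h h\<close>; for \<open>m = 1\<close> both sides are zero because the means
        vanish.\<close>
      have "innerH h h * (real m * expectation (\<lambda>\<omega>. X \<omega> ^ (m - 1) * Y \<omega>)) = real m * innerH h g * expectation (\<lambda>\<omega>. X \<omega> ^ m)"
      proof (cases m)
        case (Suc l)
        have IH: "expectation (\<lambda>\<omega>. X \<omega> ^ l * Y \<omega>) = real l * innerH h g * expectation (\<lambda>\<omega>. X \<omega> ^ (l - 1))"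
          using less.IH[of l] Suc \<open>n = Suc m\<close> by (simp add: mult.commute)
        show ?thesis
        proof (cases l)
          case 0
          then show ?thesis using IH Suc gauss_mean[OF gX] by simp
        next
          case (Suc j)
          then show ?thesis using IH \<open>m = Suc l\<close> gauss_moment_rec[OF gX, of j] by simp
        qed
      qed simp
      \<comment> \<open>The contributions \<open>2\<close> and \<open>m\<close> add up to the factor
        \<open>m + 2\<close> of the left-hand side, which then cancels.\<close>
      from eq[unfolded mult.assoc[of "real (Suc m)" "innerH h h"] this]
      have "real (Suc (Suc m)) * expectation (\<lambda>\<omega>. X \<omega> ^ Suc m * Y \<omega>)
          = real (Suc (Suc m)) * (real (Suc m) * innerH h g * expectation (\<lambda>\<omega>. X \<omega> ^ m))"
        by (simp add: algebra_simps)
      then have "expectation (\<lambda>\<omega>. X \<omega> ^ Suc m * Y \<omega>) = real (Suc m) * innerH h g * expectation (\<lambda>\<omega>. X \<omega> ^ m)"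
        by (subst (asm) mult_cancel_left) simp
      then show ?thesis using Suc by (simp add: mult.commute)
    qed
  qed
  then show ?thesis unfolding ibp_def by simp
qed

lemma ibp_mult:
  assumes Q: "ibp Q D" and f: "f \<in> L2H" "is_wiener_integral f Z"
  shows "ibp (\<lambda>\<omega>. Q \<omega> * Z \<omega>) (\<lambda>g \<omega>. D g \<omega> * Z \<omega> + Q \<omega> * innerH f g)"
  unfolding ibp_def
proof (intro conjI ballI allI impI)
  have mQ: "mom Q" and mD: "\<And>g. g \<in> L2H \<Longrightarrow> mom (D g)" and mZ: "mom Z"
    using Q f wiener_integral_mom by (auto simp: ibp_def)
  show "mom (\<lambda>\<omega>. Q \<omega> * Z \<omega>)" by (intro mom_mult mQ mZ)
  show "mom (\<lambda>\<omega>. D g \<omega> * Z \<omega> + Q \<omega> * innerH f g)" if "g \<in> L2H" for g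
    using that by (intro mom_mult mom_add mQ mZ mD mom_const)
  fix h g X Y and n :: nat
  assume h: "h \<in> L2H" and g: "g \<in> L2H" and X: "is_wiener_integral h X" and Y: "is_wiener_integral g Y"
  have mX: "mom X" "mom Y" using h g X Y wiener_integral_mom by auto
  \<comment> \<open>The two sides of the property of \<open>Q\<close> for \<open>X + t Z\<close>,
    taken at exponent \<open>Suc n\<close>: differentiation lowers it to \<open>n\<close> and
    produces a factor \<open>Suc n\<close> that cancels in the end.\<close>
  let ?A = "\<lambda>t. expectation (\<lambda>\<omega>. (Q \<omega> * Y \<omega>) * (X \<omega> + t * Z \<omega>) ^ Suc n)"
  let ?B = "\<lambda>t. expectation (\<lambda>\<omega>. D g \<omega> * (X \<omega> + t * Z \<omega>) ^ Suc n)
     + real (Suc n) * (innerH h g + t * innerH f g) * expectation (\<lambda>\<omega>. Q \<omega> * (X \<omega> + t * Z \<omega>) ^ n)"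
  have "?A t = ?B t" for t
  proof -
    have "is_wiener_integral (\<lambda>s. 1 * h s + t * f s) (\<lambda>\<omega>. 1 * X \<omega> + t * Z \<omega>)"
      using h X f by (intro wiener_integral_lincomb)
    with Q g Y L2H_lincomb[OF h f(1), of 1 t]
    have "expectation (\<lambda>\<omega>. Q \<omega> * Y \<omega> * (1 * X \<omega> + t * Z \<omega>) ^ Suc n)
      = expectation (\<lambda>\<omega>. D g \<omega> * (1 * X \<omega> + t * Z \<omega>) ^ Suc n)
       + real (Suc n) * innerH (\<lambda>s. 1 * h s + t * f s) g * expectation (\<lambda>\<omega>. Q \<omega> * (1 * X \<omega> + t * Z \<omega>) ^ (Suc n - 1))"
      unfolding ibp_def by blast
    then show ?thesis unfolding innerH_lincomb_left[OF h f(1) g, of 1 t] by simp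
  qed
  then have AB: "?A = ?B" by blast
  have "(?A has_field_derivative real (Suc n) * expectation (\<lambda>\<omega>. (Q \<omega> * Y \<omega>) * X \<omega> ^ (Suc n - 1) * Z \<omega>)) (at 0)"
    by (intro DERIV_moment_at_0 mom_mult mQ mX mZ)
  moreover have "(?B has_field_derivative
      real (Suc n) * expectation (\<lambda>\<omega>. D g \<omega> * X \<omega> ^ (Suc n - 1) * Z \<omega>)
      + (real (Suc n) * innerH f g * expectation (\<lambda>\<omega>. Q \<omega> * X \<omega> ^ n)
        + real (Suc n) * innerH h g * (real n * expectation (\<lambda>\<omega>. Q \<omega> * X \<omega> ^ (n - 1) * Z \<omega>)))) (at 0)"
    by (rule derivative_eq_intros refl DERIV_moment_at_0 mQ mX mZ mD g)+ simp
  ultimately have "real (Suc n) * expectation (\<lambda>\<omega>. (Q \<omega> * Y \<omega>) * X \<omega> ^ (Suc n - 1) * Z \<omega>)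
     = real (Suc n) * expectation (\<lambda>\<omega>. D g \<omega> * X \<omega> ^ (Suc n - 1) * Z \<omega>)
      + (real (Suc n) * innerH f g * expectation (\<lambda>\<omega>. Q \<omega> * X \<omega> ^ n)
        + real (Suc n) * innerH h g * (real n * expectation (\<lambda>\<omega>. Q \<omega> * X \<omega> ^ (n - 1) * Z \<omega>)))"
    unfolding AB by (rule DERIV_unique)
  also have "\<dots> = real (Suc n) * (expectation (\<lambda>\<omega>. D g \<omega> * X \<omega> ^ n * Z \<omega>)
      + innerH f g * expectation (\<lambda>\<omega>. Q \<omega> * X \<omega> ^ n)
        + innerH h g * (real n * expectation (\<lambda>\<omega>. Q \<omega> * X \<omega> ^ (n - 1) * Z \<omega>)))"
    by (simp add: algebra_simps)
  finally have "expectation (\<lambda>\<omega>. (Q \<omega> * Y \<omega>) * X \<omega> ^ n * Z \<omega>)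
     = expectation (\<lambda>\<omega>. D g \<omega> * X \<omega> ^ n * Z \<omega>) + innerH f g * expectation (\<lambda>\<omega>. Q \<omega> * X \<omega> ^ n)
        + innerH h g * (real n * expectation (\<lambda>\<omega>. Q \<omega> * X \<omega> ^ (n - 1) * Z \<omega>))"
    by (subst (asm) mult_cancel_left) simp
  moreover have "expectation (\<lambda>\<omega>. (D g \<omega> * Z \<omega> + Q \<omega> * innerH f g) * X \<omega> ^ n)
    = expectation (\<lambda>\<omega>. D g \<omega> * X \<omega> ^ n * Z \<omega>) + innerH f g * expectation (\<lambda>\<omega>. Q \<omega> * X \<omega> ^ n)"
  proof -
    have "expectation (\<lambda>\<omega>. (D g \<omega> * Z \<omega> + Q \<omega> * innerH f g) * X \<omega> ^ n)
        = expectation (\<lambda>\<omega>. D g \<omega> * X \<omega> ^ n * Z \<omega> + innerH f g * (Q \<omega> * X \<omega> ^ n))"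
      by (simp add: algebra_simps)
    also have "\<dots> = expectation (\<lambda>\<omega>. D g \<omega> * X \<omega> ^ n * Z \<omega>) + expectation (\<lambda>\<omega>. innerH f g * (Q \<omega> * X \<omega> ^ n))"
      by (intro Bochner_Integration.integral_add mom_integrable mom_mult mom_power mom_const mQ mD mX mZ g)
    finally show ?thesis by simp
  qed
  ultimately show "expectation (\<lambda>\<omega>. Q \<omega> * Z \<omega> * Y \<omega> * X \<omega> ^ n) =
      expectation (\<lambda>\<omega>. (D g \<omega> * Z \<omega> + Q \<omega> * innerH f g) * X \<omega> ^ n) +
      real n * innerH h g * expectation (\<lambda>\<omega>. Q \<omega> * Z \<omega> * X \<omega> ^ (n - 1))"
    by (simp add: mult_ac)
qed

lemma ibp_add:
  assumes "ibp Q D" "ibp Q' D'"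
  shows "ibp (\<lambda>\<omega>. Q \<omega> + Q' \<omega>) (\<lambda>g \<omega>. D g \<omega> + D' g \<omega>)"
  unfolding ibp_def
proof (intro conjI ballI allI impI)
  fix h g X Y and n :: nat
  assume h: "h \<in> L2H" and g: "g \<in> L2H" and X: "is_wiener_integral h X" and Y: "is_wiener_integral g Y"
  have mX: "mom X" "mom Y" using h g X Y wiener_integral_mom by auto
  have mQ: "mom Q" "mom Q'" "mom (D g)" "mom (D' g)" using assms g by (auto simp: ibp_def)
  have i: "integrable M (\<lambda>\<omega>. U \<omega> * Y \<omega> * X \<omega> ^ m)" "integrable M (\<lambda>\<omega>. U \<omega> * X \<omega> ^ m)"
    if "mom U" for U m
    using that mX by (auto intro!: mom_integrable mom_mult mom_power)
  show "expectation (\<lambda>\<omega>. (Q \<omega> + Q' \<omega>) * Y \<omega> * X \<omega> ^ n) =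
      expectation (\<lambda>\<omega>. (D g \<omega> + D' g \<omega>) * X \<omega> ^ n) +
      real n * innerH h g * expectation (\<lambda>\<omega>. (Q \<omega> + Q' \<omega>) * X \<omega> ^ (n - 1))"
    using assms h g X Y unfolding ibp_def
    by (simp add: distrib_right i mQ distrib_left)
qed (use assms in \<open>auto simp: ibp_def intro: mom_add\<close>)

lemma ibp_const: "ibp (\<lambda>_. c) (\<lambda>_ _. 0)"
  using ibp_one unfolding ibp_def by (simp add: mult.assoc) 

abbreviation ev :: "(nat \<Rightarrow> real \<Rightarrow> real) \<Rightarrow> 'a \<Rightarrow> nat \<Rightarrow> real" where
  "ev h \<omega> \<equiv> (\<lambda>i. WI (h i) \<omega>)"

lemma ibp_poly:
  assumes h: "\<forall>i<k. h i \<in> L2H" and p: "poly_fun k p"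
  shows "ibp (\<lambda>\<omega>. p (ev h \<omega>)) (\<lambda>g \<omega>. dirp k h g p (ev h \<omega>))"
  using p
proof (induction rule: poly_fun_ring_induct)
  case (const c)
  then show ?case using ibp_const by simp
next
  case (add p q)
  then show ?case using ibp_add[OF add(3,4)] by (simp add: dirp_add)
next
  case (mult_var p i)
  have hi: "h i \<in> L2H" using h mult_var(1) by simp
  from ibp_mult[OF mult_var(3) hi is_wiener_integral_WI[OF hi]]
  show ?case using mult_var(1,2) by (simp add: dirp_mult poly_fun_var dirp_var)
qed

lemma mom_WI: "h \<in> L2H \<Longrightarrow> mom (WI h)"
  using wiener_integral_mom is_wiener_integral_WI by blast

lemma mom_poly: "\<forall>i<k. h i \<in> L2H \<Longrightarrow> poly_fun k p \<Longrightarrow> mom (\<lambda>\<omega>. p (ev h \<omega>))"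
  by (rule mom_poly_fun) (auto intro: mom_WI)

section \<open>Adjoint of the derivative and symmetry of the Ornstein--Uhlenbeck operator\<close>

lemma integration_by_parts:
  assumes h: "\<forall>i<k. h i \<in> L2H" and p: "poly_fun k p" and g: "g \<in> L2H"
  shows "expectation (\<lambda>\<omega>. p (ev h \<omega>) * WI g \<omega>) = expectation (\<lambda>\<omega>. dirp k h g p (ev h \<omega>))"
proof -
  from ibp_poly[OF h p] have "expectation (\<lambda>\<omega>. p (ev h \<omega>) * WI g \<omega> * WI g \<omega> ^ 0)
      = expectation (\<lambda>\<omega>. dirp k h g p (ev h \<omega>) * WI g \<omega> ^ 0) + real 0 * innerH g g * expectation (\<lambda>\<omega>. p (ev h \<omega>) * WI g \<omega> ^ (0 - 1))"
    using g is_wiener_integral_WI[OF g] unfolding ibp_def by blast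
  then show ?thesis by simp
qed

text \<open>Integration by parts for the product of \<open>p\<close> and \<open>q\<close>: the
  adjoint of the derivative is multiplication by \<open>WI g\<close> minus the derivative.\<close>

lemma dirp_adjoint:
  assumes h: "\<forall>i<k. h i \<in> L2H" and p: "poly_fun k p" and q: "poly_fun k q" and g: "g \<in> L2H"
  shows "expectation (\<lambda>\<omega>. dirp k h g p (ev h \<omega>) * q (ev h \<omega>))
    = expectation (\<lambda>\<omega>. p (ev h \<omega>) * (q (ev h \<omega>) * WI g \<omega> - dirp k h g q (ev h \<omega>)))"
proof -
  have m: "mom (\<lambda>\<omega>. dirp k h g p (ev h \<omega>) * q (ev h \<omega>))" "mom (\<lambda>\<omega>. p (ev h \<omega>) * dirp k h g q (ev h \<omega>))"
    "mom (\<lambda>\<omega>. p (ev h \<omega>) * q (ev h \<omega>) * WI g \<omega>)"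
    by (intro mom_mult mom_WI mom_poly[OF h] poly_fun_dirp p q g)+
  have "expectation (\<lambda>\<omega>. p (ev h \<omega>) * q (ev h \<omega>) * WI g \<omega>)
      = expectation (\<lambda>\<omega>. dirp k h g p (ev h \<omega>) * q (ev h \<omega>) + p (ev h \<omega>) * dirp k h g q (ev h \<omega>))"
    using integration_by_parts[OF h poly_fun_mult[OF p q] g] by (simp add: dirp_mult p q)
  also have "\<dots> = expectation (\<lambda>\<omega>. dirp k h g p (ev h \<omega>) * q (ev h \<omega>)) + expectation (\<lambda>\<omega>. p (ev h \<omega>) * dirp k h g q (ev h \<omega>))"
    by (intro Bochner_Integration.integral_add mom_integrable m)
  finally show ?thesis
    by (simp add: right_diff_distrib mult.assoc[symmetric] Bochner_Integration.integral_diff mom_integrable m)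
qed

abbreviation OUe :: "nat \<Rightarrow> (nat \<Rightarrow> real \<Rightarrow> real) \<Rightarrow> ((nat \<Rightarrow> real) \<Rightarrow> real) \<Rightarrow> (nat \<Rightarrow> real) \<Rightarrow> real" where
  "OUe k h \<equiv> OUp k (\<lambda>i j. innerH (h i) (h j))"

text \<open>Integrating the drift by parts reproduces the second-order terms, which cancel, and
  leaves the gradient form. That form is visibly symmetric.\<close>

lemma OUe_dirichlet_form:
  assumes h: "\<forall>i<k. h i \<in> L2H" and p: "poly_fun k p" and q: "poly_fun k q"
  shows "expectation (\<lambda>\<omega>. OUe k h p (ev h \<omega>) * q (ev h \<omega>))
    = - (\<Sum>i<k. \<Sum>j<k. innerH (h i) (h j) * expectation (\<lambda>\<omega>. partial i p (ev h \<omega>) * partial j q (ev h \<omega>)))"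
proof -
  let ?C = "\<lambda>i j. innerH (h i) (h j)"
  let ?a = "\<lambda>i j. expectation (\<lambda>\<omega>. partial i (partial j p) (ev h \<omega>) * q (ev h \<omega>))"
  let ?b = "\<lambda>i j. expectation (\<lambda>\<omega>. partial i p (ev h \<omega>) * partial j q (ev h \<omega>))"
  have pf: "poly_fun k (partial i p)" "poly_fun k (partial i q)" "poly_fun k (partial i (partial j p))" for i j
    using p q by (auto intro: poly_fun_partial)
  have m1: "mom (\<lambda>\<omega>. partial i (partial j p) (ev h \<omega>) * q (ev h \<omega>))"
    "mom (\<lambda>\<omega>. partial i p (ev h \<omega>) * partial j q (ev h \<omega>))" for i j
    by (intro mom_mult mom_poly[OF h] pf q)+
  have m2: "mom (\<lambda>\<omega>. partial i p (ev h \<omega>) * q (ev h \<omega>) * WI (h i) \<omega>)" if "i < k" for i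
    using that h by (intro mom_mult mom_poly[OF h] pf q mom_WI) auto
  have "expectation (\<lambda>\<omega>. OUe k h p (ev h \<omega>) * q (ev h \<omega>))
      = expectation (\<lambda>\<omega>. (\<Sum>i<k. \<Sum>j<k. ?C i j * (partial i (partial j p) (ev h \<omega>) * q (ev h \<omega>)))
          - (\<Sum>i<k. partial i p (ev h \<omega>) * q (ev h \<omega>) * WI (h i) \<omega>))"
    by (simp add: OUp_def right_diff_distrib sum_distrib_left mult_ac)
  also have "\<dots> = (\<Sum>i<k. \<Sum>j<k. ?C i j * ?a i j)
      - (\<Sum>i<k. expectation (\<lambda>\<omega>. partial i p (ev h \<omega>) * q (ev h \<omega>) * WI (h i) \<omega>))"
    by (subst Bochner_Integration.integral_diff;
        (intro Bochner_Integration.integrable_sum integrable_mult_right mom_integrable m1 m2)?)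
      (simp_all add: mom_integrable[OF m1(1)] mom_integrable[OF m2])
  also have "(\<Sum>i<k. expectation (\<lambda>\<omega>. partial i p (ev h \<omega>) * q (ev h \<omega>) * WI (h i) \<omega>))
      = (\<Sum>i<k. \<Sum>j<k. ?C j i * (?a j i + ?b i j))"
  proof (rule sum.cong[OF refl])
    fix i assume i: "i \<in> {..<k}"
    have "expectation (\<lambda>\<omega>. partial i p (ev h \<omega>) * q (ev h \<omega>) * WI (h i) \<omega>)
        = expectation (\<lambda>\<omega>. dirp k h (h i) (\<lambda>x. partial i p x * q x) (ev h \<omega>))"
      using integration_by_parts[OF h poly_fun_mult[OF pf(1) q], of "h i" i] h i by simp
    also have "\<dots> = expectation (\<lambda>\<omega>. \<Sum>j<k. ?C j i * (partial j (partial i p) (ev h \<omega>) * q (ev h \<omega>)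
        + partial i p (ev h \<omega>) * partial j q (ev h \<omega>)))"
      unfolding dirp_def partial_mult[OF pf(1) q] by (simp add: algebra_simps)
    also have "\<dots> = (\<Sum>j<k. ?C j i * (?a j i + ?b i j))"
      using mom_integrable[OF m1(1)] mom_integrable[OF m1(2)] by simp
    finally show "expectation (\<lambda>\<omega>. partial i p (ev h \<omega>) * q (ev h \<omega>) * WI (h i) \<omega>)
      = (\<Sum>j<k. ?C j i * (?a j i + ?b i j))" .
  qed
  also have "\<dots> = (\<Sum>i<k. \<Sum>j<k. ?C j i * ?a j i) + (\<Sum>i<k. \<Sum>j<k. ?C i j * ?b i j)"
    by (simp add: distrib_left sum.distrib innerH_commute)
  also have "(\<Sum>i<k. \<Sum>j<k. ?C j i * ?a j i) = (\<Sum>i<k. \<Sum>j<k. ?C i j * ?a i j)"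
    by (rule sum.swap)
  finally show ?thesis by simp
qed

lemma OUe_symmetric:
  assumes h: "\<forall>i<k. h i \<in> L2H" and p: "poly_fun k p" and q: "poly_fun k q"
  shows "expectation (\<lambda>\<omega>. OUe k h p (ev h \<omega>) * q (ev h \<omega>)) = expectation (\<lambda>\<omega>. p (ev h \<omega>) * OUe k h q (ev h \<omega>))"
proof -
  have "(\<Sum>i<k. \<Sum>j<k. innerH (h i) (h j) * expectation (\<lambda>\<omega>. partial i p (ev h \<omega>) * partial j q (ev h \<omega>)))
     = (\<Sum>i<k. \<Sum>j<k. innerH (h i) (h j) * expectation (\<lambda>\<omega>. partial i q (ev h \<omega>) * partial j p (ev h \<omega>)))"
    by (subst sum.swap) (simp add: innerH_commute mult.commute)
  then show ?thesis using OUe_dirichlet_form[OF h p q] OUe_dirichlet_form[OF h q p]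
    by (simp add: mult.commute)
qed

text \<open>With dependent integrands \<open>p\<close> need not vanish identically. Writing the mean
  square of the derivative through the adjoint leaves \<open>p\<close> as an undifferentiated
  factor, so this mean square is zero. For \<open>OUe\<close> symmetry does the same.\<close>

lemma AE_zero_dirp:
  assumes h: "\<forall>i<k. h i \<in> L2H" and p: "poly_fun k p" and g: "g \<in> L2H"
    and zero: "AE \<omega> in M. p (ev h \<omega>) = 0"
  shows "AE \<omega> in M. dirp k h g p (ev h \<omega>) = 0"
proof (rule mom_AE_zero)
  let ?d = "dirp k h g p"
  have d: "poly_fun k ?d" by (rule poly_fun_dirp[OF p])
  show "mom (\<lambda>\<omega>. ?d (ev h \<omega>))" by (rule mom_poly[OF h d])
  have "expectation (\<lambda>\<omega>. ?d (ev h \<omega>) * ?d (ev h \<omega>))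
      = expectation (\<lambda>\<omega>. p (ev h \<omega>) * (?d (ev h \<omega>) * WI g \<omega> - dirp k h g ?d (ev h \<omega>)))"
    by (rule dirp_adjoint[OF h p d g])
  also have "\<dots> = 0"
    by (rule integral_eq_zero_AE) (use zero in eventually_elim, simp)
  finally show "expectation (\<lambda>\<omega>. ?d (ev h \<omega>) * ?d (ev h \<omega>)) = 0" .
qed

lemma AE_zero_OUe:
  assumes h: "\<forall>i<k. h i \<in> L2H" and p: "poly_fun k p"
    and zero: "AE \<omega> in M. p (ev h \<omega>) = 0"
  shows "AE \<omega> in M. OUe k h p (ev h \<omega>) = 0"
proof (rule mom_AE_zero)
  let ?d = "OUe k h p"
  have d: "poly_fun k ?d" by (rule poly_fun_OUp[OF p])
  show "mom (\<lambda>\<omega>. ?d (ev h \<omega>))" by (rule mom_poly[OF h d])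
  have "expectation (\<lambda>\<omega>. ?d (ev h \<omega>) * ?d (ev h \<omega>)) = expectation (\<lambda>\<omega>. p (ev h \<omega>) * OUe k h ?d (ev h \<omega>))"
    by (rule OUe_symmetric[OF h p d])
  also have "\<dots> = 0"
    by (rule integral_eq_zero_AE) (use zero in eventually_elim, simp)
  finally show "expectation (\<lambda>\<omega>. ?d (ev h \<omega>) * ?d (ev h \<omega>)) = 0" .
qed

end

section \<open>Derivative and Ornstein--Uhlenbeck operator on polynomial random variables\<close>

lemma sum_lessThan_add:
  fixes f :: "nat \<Rightarrow> real"
  shows "(\<Sum>i<k + m. f i) = (\<Sum>i<k. f i) + (\<Sum>j<m. f (k + j))"
  by (induction m) auto

lemma AE_sum_cong:
  assumes "finite I" "\<And>i. i \<in> I \<Longrightarrow> AE x in M. f i x = (g i x :: real)"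
  shows "AE x in M. (\<Sum>i\<in>I. f i x) = (\<Sum>i\<in>I. g i x)"
proof -
  have "AE x in M. \<forall>i\<in>I. f i x = g i x" using assms by (intro AE_finite_allI)
  then show ?thesis by eventually_elim (simp cong: sum.cong)
qed

context wiener_space begin

text \<open>The two tuples are concatenated. The first polynomial stays as it is because it never
  reads past its first \<open>k\<close> variables; the second one is shifted. Every statement about
  two random variables or two representations starts from here.\<close>

lemma poly_rep_join:
  assumes F: "poly_rep F k h p" and G: "poly_rep G m h' q"
  obtains K H q' where "poly_rep F K H p" "poly_rep G K H q'"
    "\<And>g \<omega>. dirp K H g p (ev H \<omega>) = dirp k h g p (ev h \<omega>)"
    "\<And>g \<omega>. dirp K H g q' (ev H \<omega>) = dirp m h' g q (ev h' \<omega>)"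
    "\<And>\<omega>. OUe K H p (ev H \<omega>) = OUe k h p (ev h \<omega>)"
    "\<And>\<omega>. OUe K H q' (ev H \<omega>) = OUe m h' q (ev h' \<omega>)"
proof -
  define K where "K = k + m"
  define H where "H i = (if i < k then h i else h' (i - k))" for i
  define q' where "q' = (\<lambda>x. q (\<lambda>i. x (k + i)))"
  have p: "poly_fun k p" and q: "poly_fun m q" using F G by (auto simp: poly_rep_def)
  have Hk: "H (k + i) = h' i" for i by (simp add: H_def)
  have Hl: "i < k \<Longrightarrow> H i = h i" for i by (simp add: H_def)
  have cong: "r (ev H \<omega>) = r (ev h \<omega>)" if "poly_fun k r" for r \<omega>
    by (rule poly_fun_cong[OF that]) (simp add: H_def)
  have pp: "poly_fun k (partial i p)" for i by (rule poly_fun_partial[OF p])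
  have pge: "partial i r = (\<lambda>_. 0)" if "poly_fun k r" "\<not> i < k" for i r
    using partial_ge[OF that(1), of i] that(2) by simp
  have qp: "partial j q' = (if j < k then (\<lambda>_. 0) else (\<lambda>x. partial (j - k) q (\<lambda>i. x (k + i))))" for j
    unfolding q'_def by (auto simp: partial_shift[OF q])
  have qpp: "partial i (partial j q') = (if i < k \<or> j < k then (\<lambda>_. 0)
      else (\<lambda>x. partial (i - k) (partial (j - k) q) (\<lambda>l. x (k + l))))" for i j
    unfolding qp by (auto simp: partial_shift[OF poly_fun_partial[OF q]])
  have "\<forall>i<K. H i \<in> L2H" using F G by (auto simp: H_def K_def poly_rep_def)
  moreover have "poly_fun K p" "poly_fun K q'"
    using p q unfolding K_def q'_def by (auto intro: poly_fun_mono poly_fun_shift)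
  ultimately have "poly_rep F K H p" "poly_rep G K H q'"
    using F G by (auto simp: poly_rep_def cong[OF p] q'_def Hk)
  moreover have "dirp K H g p (ev H \<omega>) = dirp k h g p (ev h \<omega>)" for g \<omega>
    unfolding dirp_def K_def sum_lessThan_add
    by (simp add: cong[OF pp] pge[OF p] Hl)
  moreover have "dirp K H g q' (ev H \<omega>) = dirp m h' g q (ev h' \<omega>)" for g \<omega>
    unfolding dirp_def K_def sum_lessThan_add by (simp add: qp Hk)
  moreover have "OUe K H p (ev H \<omega>) = OUe k h p (ev h \<omega>)" for \<omega>
    unfolding OUp_def K_def sum_lessThan_add
    by (simp add: cong[OF pp] cong[OF poly_fun_partial[OF pp]] pge[OF p] pge[OF pp] Hl)
  moreover have "OUe K H q' (ev H \<omega>) = OUe m h' q (ev h' \<omega>)" for \<omega>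
    unfolding OUp_def K_def sum_lessThan_add qpp by (simp add: qp Hk)
  ultimately show ?thesis by (rule that)
qed

lemma poly_rep_self: "\<forall>i<k. h i \<in> L2H \<Longrightarrow> poly_fun k p \<Longrightarrow> poly_rep (\<lambda>\<omega>. p (ev h \<omega>)) k h p"
  using mom_measurable[OF mom_poly] by (auto simp: poly_rep_def)

lemma poly_rep_AE_cong:
  assumes "poly_rep F k h p" "G \<in> borel_measurable M" "AE \<omega> in M. F \<omega> = G \<omega>"
  shows "poly_rep G k h p"
proof -
  have "AE \<omega> in M. F \<omega> = p (ev h \<omega>)" using assms(1) by (simp add: poly_rep_def)
  with assms(3) have "AE \<omega> in M. G \<omega> = p (ev h \<omega>)" by eventually_elim simp
  then show ?thesis using assms by (simp add: poly_rep_def)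
qed

lemma poly_rep_lincomb:
  assumes "poly_rep F k h p" "poly_rep G k h q"
  shows "poly_rep (\<lambda>\<omega>. a * F \<omega> + b * G \<omega>) k h (\<lambda>x. a * p x + b * q x)"
proof -
  have "AE \<omega> in M. F \<omega> = p (ev h \<omega>)" "AE \<omega> in M. G \<omega> = q (ev h \<omega>)" using assms by (auto simp: poly_rep_def)
  then have "AE \<omega> in M. a * F \<omega> + b * G \<omega> = a * p (ev h \<omega>) + b * q (ev h \<omega>)" by eventually_elim simp
  then show ?thesis using assms by (auto simp: poly_rep_def intro!: poly_fun_add poly_fun_mult)
qed

lemma P_pair:
  assumes "F \<in> \<P>" "G \<in> \<P>"
  obtains k h p q where "poly_rep F k h p" "poly_rep G k h q"
proof -
  obtain k h p m h' q where "poly_rep F k h p" "poly_rep G m h' q"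
    using assms unfolding \<P>_def by blast
  then show ?thesis by (rule poly_rep_join) (rule that)
qed

lemma poly_rep_same_AE:
  assumes "poly_rep F k h p" "poly_rep F k h q"
  shows "AE \<omega> in M. p (ev h \<omega>) + (-1) * q (ev h \<omega>) = 0"
proof -
  have "AE \<omega> in M. F \<omega> = p (ev h \<omega>)" "AE \<omega> in M. F \<omega> = q (ev h \<omega>)" using assms by (auto simp: poly_rep_def)
  then show ?thesis by eventually_elim simp
qed

lemma dirp_rep_unique:
  assumes F: "poly_rep F k h p" and G: "poly_rep F m h' q" and g: "g \<in> L2H"
  shows "AE \<omega> in M. dirp k h g p (ev h \<omega>) = dirp m h' g q (ev h' \<omega>)"
proof -
  obtain K H q' where *: "poly_rep F K H p" "poly_rep F K H q'"
    "\<And>g \<omega>. dirp K H g p (ev H \<omega>) = dirp k h g p (ev h \<omega>)"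
    "\<And>g \<omega>. dirp K H g q' (ev H \<omega>) = dirp m h' g q (ev h' \<omega>)"
    by (rule poly_rep_join[OF F G]) (rule that)
  have pf: "poly_fun K p" "poly_fun K q'" and h: "\<forall>i<K. H i \<in> L2H"
    using *(1,2) by (auto simp: poly_rep_def)
  have pm: "poly_fun K (\<lambda>x. (-1) * q' x)" by (rule poly_fun_mult[OF poly_fun_const pf(2)])
  have "AE \<omega> in M. dirp K H g (\<lambda>x. p x + (-1) * q' x) (ev H \<omega>) = 0"
    by (rule AE_zero_dirp[OF h poly_fun_add[OF pf(1) pm] g poly_rep_same_AE[OF *(1,2)]])
  then show ?thesis
    unfolding dirp_add[OF pf(1) pm] dirp_scale[OF pf(2)] *(3,4) by eventually_elim simp
qed

lemma OUe_rep_unique: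
  assumes F: "poly_rep F k h p" and G: "poly_rep F m h' q"
  shows "AE \<omega> in M. OUe k h p (ev h \<omega>) = OUe m h' q (ev h' \<omega>)"
proof -
  obtain K H q' where *: "poly_rep F K H p" "poly_rep F K H q'"
    "\<And>\<omega>. OUe K H p (ev H \<omega>) = OUe k h p (ev h \<omega>)"
    "\<And>\<omega>. OUe K H q' (ev H \<omega>) = OUe m h' q (ev h' \<omega>)"
    by (rule poly_rep_join[OF F G]) (rule that)
  have pf: "poly_fun K p" "poly_fun K q'" and h: "\<forall>i<K. H i \<in> L2H"
    using *(1,2) by (auto simp: poly_rep_def)
  have pm: "poly_fun K (\<lambda>x. (-1) * q' x)" by (rule poly_fun_mult[OF poly_fun_const pf(2)])
  have "AE \<omega> in M. OUe K H (\<lambda>x. p x + (-1) * q' x) (ev H \<omega>) = 0"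
    by (rule AE_zero_OUe[OF h poly_fun_add[OF pf(1) pm] poly_rep_same_AE[OF *(1,2)]])
  then show ?thesis
    unfolding OUp_add[OF pf(1) pm] OUp_scale[OF pf(2)] *(3,4) by eventually_elim simp
qed

lemma dir_deriv_rep:
  assumes "F \<in> \<P>"
  obtains k h p where "poly_rep F k h p" "dir_deriv g F = (\<lambda>\<omega>. dirp k h g p (ev h \<omega>))"
proof -
  have "\<exists>G k h p. poly_rep F k h p \<and> G = (\<lambda>\<omega>. dirp k h g p (ev h \<omega>))"
    using assms by (auto simp: \<P>_def)
  from someI_ex[OF this] show ?thesis
    using that unfolding dir_deriv_def dirp_def by blast
qed

lemma OU_rep:
  assumes "F \<in> \<P>"
  obtains k h p where "poly_rep F k h p" "OU F = (\<lambda>\<omega>. OUe k h p (ev h \<omega>))"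
proof -
  have "\<exists>G k h p. poly_rep F k h p \<and> G = (\<lambda>\<omega>. OUe k h p (ev h \<omega>))"
    using assms by (auto simp: \<P>_def)
  from someI_ex[OF this] show ?thesis
    using that unfolding OU_def OUp_def by blast
qed

lemma in_P: "poly_rep F k h p \<Longrightarrow> F \<in> \<P>"
  by (auto simp: \<P>_def)

lemma dir_deriv_AE:
  assumes F: "poly_rep F k h p" and g: "g \<in> L2H"
  shows "AE \<omega> in M. dir_deriv g F \<omega> = dirp k h g p (ev h \<omega>)"
proof -
  obtain m h' q where "poly_rep F m h' q" "dir_deriv g F = (\<lambda>\<omega>. dirp m h' g q (ev h' \<omega>))"
    using dir_deriv_rep[OF in_P[OF F]] by blast
  with dirp_rep_unique[OF this(1) F g] show ?thesis by simp
qed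

lemma OU_AE:
  assumes F: "poly_rep F k h p"
  shows "AE \<omega> in M. OU F \<omega> = OUe k h p (ev h \<omega>)"
proof -
  obtain m h' q where "poly_rep F m h' q" "OU F = (\<lambda>\<omega>. OUe m h' q (ev h' \<omega>))"
    using OU_rep[OF in_P[OF F]] by blast
  with OUe_rep_unique[OF this(1) F] show ?thesis by simp
qed

lemma P_measurable: "F \<in> \<P> \<Longrightarrow> F \<in> borel_measurable M"
  by (auto simp: \<P>_def poly_rep_def)

lemma P_mom: "F \<in> \<P> \<Longrightarrow> mom F"
proof -
  assume "F \<in> \<P>"
  then obtain k h p where *: "poly_rep F k h p" by (auto simp: \<P>_def)
  then have "mom (\<lambda>\<omega>. p (ev h \<omega>))" by (intro mom_poly[of k]) (auto simp: poly_rep_def)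
  moreover have "AE \<omega> in M. p (ev h \<omega>) = F \<omega>" using * by (auto simp: poly_rep_def)
  ultimately show ?thesis using * by (intro mom_AE_cong[of "\<lambda>\<omega>. p (ev h \<omega>)" F]) (auto simp: poly_rep_def)
qed

lemma P_AE_cong: "F \<in> \<P> \<Longrightarrow> G \<in> borel_measurable M \<Longrightarrow> AE \<omega> in M. F \<omega> = G \<omega> \<Longrightarrow> G \<in> \<P>"
  using poly_rep_AE_cong unfolding \<P>_def by blast

lemma P_const [simp, intro]: "(\<lambda>_. c) \<in> \<P>"
  using poly_rep_self[of 0 "\<lambda>_ _. 0" "\<lambda>_. c"] by (auto intro: in_P)

lemma P_lincomb: "F \<in> \<P> \<Longrightarrow> G \<in> \<P> \<Longrightarrow> (\<lambda>\<omega>. a * F \<omega> + b * G \<omega>) \<in> \<P>"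
  using P_pair[of F G] in_P[OF poly_rep_lincomb] by metis

lemma P_add: "F \<in> \<P> \<Longrightarrow> G \<in> \<P> \<Longrightarrow> (\<lambda>\<omega>. F \<omega> + G \<omega>) \<in> \<P>"
  using P_lincomb[of F G 1 1] by simp

lemma P_diff: "F \<in> \<P> \<Longrightarrow> G \<in> \<P> \<Longrightarrow> (\<lambda>\<omega>. F \<omega> - G \<omega>) \<in> \<P>"
  using P_lincomb[of F G 1 "-1"] by simp

lemma P_scale: "F \<in> \<P> \<Longrightarrow> (\<lambda>\<omega>. a * F \<omega>) \<in> \<P>"
  using P_lincomb[of F F a 0] by simp

lemma P_sum: "(\<And>i. i \<in> I \<Longrightarrow> F i \<in> \<P>) \<Longrightarrow> (\<lambda>\<omega>. \<Sum>i\<in>I. F i \<omega>) \<in> \<P>"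
  by (induction I rule: infinite_finite_induct) (auto intro: P_add)

lemma P_mult_integrable: "F \<in> \<P> \<Longrightarrow> G \<in> \<P> \<Longrightarrow> integrable M (\<lambda>\<omega>. F \<omega> * G \<omega>)"
  by (intro mom_integrable mom_mult P_mom)

lemma dir_deriv_in_P: "F \<in> \<P> \<Longrightarrow> dir_deriv g F \<in> \<P>"
proof -
  assume "F \<in> \<P>"
  then obtain k h p where r: "poly_rep F k h p" "dir_deriv g F = (\<lambda>\<omega>. dirp k h g p (ev h \<omega>))"
    by (rule dir_deriv_rep)
  then show ?thesis
    using in_P[OF poly_rep_self[OF _ poly_fun_dirp]] by (simp add: poly_rep_def)
qed

lemma OU_in_P: "F \<in> \<P> \<Longrightarrow> OU F \<in> \<P>"
proof -
  assume "F \<in> \<P>"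
  then obtain k h p where r: "poly_rep F k h p" "OU F = (\<lambda>\<omega>. OUe k h p (ev h \<omega>))"
    by (rule OU_rep)
  then show ?thesis
    using in_P[OF poly_rep_self[OF _ poly_fun_OUp]] by (simp add: poly_rep_def)
qed

lemma expectation_mult_AE_cong:
  assumes "F \<in> \<P>" "G \<in> \<P>" "F' \<in> \<P>" "G' \<in> \<P>" "AE \<omega> in M. F \<omega> = F' \<omega>" "AE \<omega> in M. G \<omega> = G' \<omega>"
  shows "expectation (\<lambda>\<omega>. F \<omega> * G \<omega>) = expectation (\<lambda>\<omega>. F' \<omega> * G' \<omega>)"
proof (rule integral_cong_AE)
  show "AE \<omega> in M. F \<omega> * G \<omega> = F' \<omega> * G' \<omega>" using assms(5,6) by eventually_elim simp
qed (intro borel_measurable_times P_measurable assms)+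

lemma dir_deriv_adjoint:
  assumes F: "F \<in> \<P>" and G: "G \<in> \<P>" and g: "g \<in> L2H"
  shows "expectation (\<lambda>\<omega>. dir_deriv g F \<omega> * G \<omega>)
    = expectation (\<lambda>\<omega>. F \<omega> * (G \<omega> * WI g \<omega> - dir_deriv g G \<omega>))"
proof -
  obtain k h p q where r: "poly_rep F k h p" "poly_rep G k h q" using P_pair[OF F G] .
  then have h: "\<forall>i<k. h i \<in> L2H" and p: "poly_fun k p" "poly_fun k q"
    and AE: "AE \<omega> in M. F \<omega> = p (ev h \<omega>)" "AE \<omega> in M. G \<omega> = q (ev h \<omega>)" by (auto simp: poly_rep_def)
  note m = mom_measurable[OF mom_poly[OF h]] mom_measurable[OF mom_WI[OF g]] P_measurable F G
     dir_deriv_in_P poly_fun_dirp p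
  have "expectation (\<lambda>\<omega>. dir_deriv g F \<omega> * G \<omega>) = expectation (\<lambda>\<omega>. dirp k h g p (ev h \<omega>) * q (ev h \<omega>))"
    using dir_deriv_AE[OF r(1) g] AE
    by (intro integral_cong_AE borel_measurable_times m; eventually_elim) simp
  also have "\<dots> = expectation (\<lambda>\<omega>. p (ev h \<omega>) * (q (ev h \<omega>) * WI g \<omega> - dirp k h g q (ev h \<omega>)))"
    by (rule dirp_adjoint[OF h p g])
  also have "\<dots> = expectation (\<lambda>\<omega>. F \<omega> * (G \<omega> * WI g \<omega> - dir_deriv g G \<omega>))"
    using dir_deriv_AE[OF r(2) g] AE
    by (intro integral_cong_AE borel_measurable_times borel_measurable_diff m; eventually_elim) simp
  finally show ?thesis .
qed

lemma OU_symmetric: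
  assumes F: "F \<in> \<P>" and G: "G \<in> \<P>"
  shows "expectation (\<lambda>\<omega>. OU F \<omega> * G \<omega>) = expectation (\<lambda>\<omega>. F \<omega> * OU G \<omega>)"
proof -
  obtain k h p q where r: "poly_rep F k h p" "poly_rep G k h q" using P_pair[OF F G] .
  then have h: "\<forall>i<k. h i \<in> L2H" and p: "poly_fun k p" "poly_fun k q"
    and AE: "AE \<omega> in M. F \<omega> = p (ev h \<omega>)" "AE \<omega> in M. G \<omega> = q (ev h \<omega>)" by (auto simp: poly_rep_def)
  note m = mom_measurable[OF mom_poly[OF h]] P_measurable F G OU_in_P poly_fun_OUp p
  have "expectation (\<lambda>\<omega>. OU F \<omega> * G \<omega>) = expectation (\<lambda>\<omega>. OUe k h p (ev h \<omega>) * q (ev h \<omega>))"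
    using OU_AE[OF r(1)] AE
    by (intro integral_cong_AE borel_measurable_times m; eventually_elim) simp
  also have "\<dots> = expectation (\<lambda>\<omega>. p (ev h \<omega>) * OUe k h q (ev h \<omega>))"
    by (rule OUe_symmetric[OF h p])
  also have "\<dots> = expectation (\<lambda>\<omega>. F \<omega> * OU G \<omega>)"
    using OU_AE[OF r(2)] AE
    by (intro integral_cong_AE borel_measurable_times m; eventually_elim) simp
  finally show ?thesis .
qed

lemma OU_lincomb:
  assumes F: "F \<in> \<P>" and G: "G \<in> \<P>"
  shows "AE \<omega> in M. OU (\<lambda>\<omega>. a * F \<omega> + b * G \<omega>) \<omega> = a * OU F \<omega> + b * OU G \<omega>"
proof -
  obtain k h p q where r: "poly_rep F k h p" "poly_rep G k h q" using P_pair[OF F G] .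
  then have p: "poly_fun k p" "poly_fun k q" by (auto simp: poly_rep_def)
  have eq: "OUe k h (\<lambda>x. a * p x + b * q x) x = a * OUe k h p x + b * OUe k h q x" for x
    using p by (subst OUp_add) (auto intro!: poly_fun_mult simp: OUp_scale)
  from OU_AE[OF poly_rep_lincomb[OF r, of a b]] OU_AE[OF r(1)] OU_AE[OF r(2)]
  show ?thesis by eventually_elim (simp add: eq)
qed

section \<open>Spectral decomposition of the Ornstein--Uhlenbeck operator\<close>

definition eigen :: "nat \<Rightarrow> ('a \<Rightarrow> real) \<Rightarrow> bool" where
  "eigen m F \<longleftrightarrow> F \<in> \<P> \<and> (AE \<omega> in M. - OU F \<omega> = real m * F \<omega>)"

lemma eigen_P: "eigen m F \<Longrightarrow> F \<in> \<P>"
  by (simp add: eigen_def)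

lemma eigen_AE: "eigen m F \<Longrightarrow> AE \<omega> in M. OU F \<omega> = - real m * F \<omega>"
  unfolding eigen_def by (auto elim!: eventually_mono)

text \<open>The usual consequence of symmetry. No projections onto the chaoses are constructed; this
  orthogonality is what makes finite decompositions unique.\<close>

lemma eigen_orthogonal:
  assumes F: "eigen m F" and G: "eigen n G" and "m \<noteq> n"
  shows "expectation (\<lambda>\<omega>. F \<omega> * G \<omega>) = 0"
proof -
  have P: "F \<in> \<P>" "G \<in> \<P>" using F G by (auto simp: eigen_def)
  note AE = eigen_AE[OF F] eigen_AE[OF G]
  have "expectation (\<lambda>\<omega>. OU F \<omega> * G \<omega>) = - real m * expectation (\<lambda>\<omega>. F \<omega> * G \<omega>)"
    using expectation_mult_AE_cong[OF OU_in_P P(2) P_scale P(2) AE(1)] P by (simp add: mult.assoc)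
  moreover have "expectation (\<lambda>\<omega>. F \<omega> * OU G \<omega>) = - real n * expectation (\<lambda>\<omega>. F \<omega> * G \<omega>)"
    using expectation_mult_AE_cong[OF P(1) OU_in_P P(1) P_scale _ AE(2)] P by (simp add: mult.left_commute[of "F _" "real n"])
  ultimately have "real m * expectation (\<lambda>\<omega>. F \<omega> * G \<omega>) = real n * expectation (\<lambda>\<omega>. F \<omega> * G \<omega>)"
    using OU_symmetric[OF P] by linarith
  then show ?thesis using \<open>m \<noteq> n\<close> by simp
qed

lemma eigen_lincomb:
  assumes "eigen m F" "eigen m G"
  shows "eigen m (\<lambda>\<omega>. a * F \<omega> + b * G \<omega>)"
proof -
  have P: "F \<in> \<P>" "G \<in> \<P>" and AE: "AE \<omega> in M. - OU F \<omega> = real m * F \<omega>" "AE \<omega> in M. - OU G \<omega> = real m * G \<omega>"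
    using assms by (auto simp: eigen_def)
  from OU_lincomb[OF P, of a b] AE
  have "AE \<omega> in M. - OU (\<lambda>\<omega>. a * F \<omega> + b * G \<omega>) \<omega> = real m * (a * F \<omega> + b * G \<omega>)"
  proof eventually_elim
    case (elim \<omega>)
    then have "OU F \<omega> = - (real m * F \<omega>)" "OU G \<omega> = - (real m * G \<omega>)" by simp_all
    then show ?case unfolding elim(1) by (simp add: algebra_simps)
  qed
  with P show ?thesis by (simp add: eigen_def P_lincomb)
qed

lemma eigen_zero: "eigen m (\<lambda>_. 0)"
proof -
  have "poly_rep (\<lambda>_. 0) 0 (\<lambda>_ _. 0) (\<lambda>_. 0)" using poly_rep_self[of 0 "\<lambda>_ _. 0" "\<lambda>_. 0"] by simp
  from OU_AE[OF this] have "AE \<omega> in M. - OU (\<lambda>_. 0) \<omega> = real m * 0" by (simp add: OUp_0)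
  then show ?thesis by (simp add: eigen_def)
qed

definition decomp :: "('a \<Rightarrow> real) \<Rightarrow> nat \<Rightarrow> (nat \<Rightarrow> 'a \<Rightarrow> real) \<Rightarrow> bool" where
  "decomp F q \<Phi> \<longleftrightarrow> (\<forall>m\<le>q. eigen m (\<Phi> m)) \<and> (AE \<omega> in M. F \<omega> = (\<Sum>m\<le>q. \<Phi> m \<omega>))"

lemma decomp_exists:
  assumes "F \<in> \<P>" shows "\<exists>q \<Phi>. decomp F q \<Phi>"
proof -
  obtain k h p where r: "poly_rep F k h p" using assms by (auto simp: \<P>_def)
  then have h: "\<forall>i<k. h i \<in> L2H" and p: "poly_fun k p" and AE: "AE \<omega> in M. F \<omega> = p (ev h \<omega>)"
    by (auto simp: poly_rep_def)
  obtain d where "poly_deg k d p" using p by (auto simp: poly_fun_deg)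
  from poly_eigen_decomposition[OF this, of "\<lambda>i j. innerH (h i) (h j)"] obtain f where
    f: "\<And>m. m \<le> d \<Longrightarrow> poly_fun k (f m)" "\<And>m. m \<le> d \<Longrightarrow> OUe k h (f m) = (\<lambda>x. - real m * f m x)"
    "p = (\<lambda>x. \<Sum>m\<le>d. f m x)" by blast
  have "eigen m (\<lambda>\<omega>. f m (ev h \<omega>))" if "m \<le> d" for m
  proof -
    have r: "poly_rep (\<lambda>\<omega>. f m (ev h \<omega>)) k h (f m)" by (rule poly_rep_self[OF h f(1)[OF that]])
    show ?thesis using OU_AE[OF r] in_P[OF r] f(2)[OF that] by (auto simp: eigen_def)
  qed
  then have "decomp F d (\<lambda>m \<omega>. f m (ev h \<omega>))" using AE f(3) by (simp add: decomp_def)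
  then show ?thesis by blast
qed

lemma sum_atMost_extend:
  fixes f g :: "nat \<Rightarrow> real"
  shows "q \<le> q' \<Longrightarrow> (\<Sum>m\<le>q'. g m * (if m \<le> q then f m else 0)) = (\<Sum>m\<le>q. g m * f m)"
  by (rule sum.mono_neutral_cong_right) auto

text \<open>Padding with zero components lets two decompositions be compared at a common
  length.\<close>

lemma decomp_extend:
  assumes "decomp F q \<Phi>" "q \<le> q'"
  shows "decomp F q' (\<lambda>m \<omega>. if m \<le> q then \<Phi> m \<omega> else 0)"
proof -
  have "eigen m (\<lambda>\<omega>. if m \<le> q then \<Phi> m \<omega> else 0)" for m
    using assms by (cases "m \<le> q") (auto simp: decomp_def eigen_zero)
  then show ?thesis using assms sum_atMost_extend[OF assms(2), of "\<lambda>_. 1"] by (simp add: decomp_def)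
qed

lemma decomp_lincomb:
  assumes "decomp F q \<Phi>" "decomp G q \<Psi>"
  shows "decomp (\<lambda>\<omega>. a * F \<omega> + b * G \<omega>) q (\<lambda>m \<omega>. a * \<Phi> m \<omega> + b * \<Psi> m \<omega>)"
proof -
  have "AE \<omega> in M. F \<omega> = (\<Sum>m\<le>q. \<Phi> m \<omega>)" "AE \<omega> in M. G \<omega> = (\<Sum>m\<le>q. \<Psi> m \<omega>)"
    using assms by (auto simp: decomp_def)
  then have "AE \<omega> in M. a * F \<omega> + b * G \<omega> = (\<Sum>m\<le>q. a * \<Phi> m \<omega> + b * \<Psi> m \<omega>)"
    by eventually_elim (simp add: sum.distrib sum_distrib_left)
  then show ?thesis using assms eigen_lincomb by (auto simp: decomp_def)
qed

lemma decomp_zero_unique: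
  assumes "decomp (\<lambda>_. 0) q \<Phi>" "m \<le> q"
  shows "AE \<omega> in M. \<Phi> m \<omega> = 0"
proof (rule mom_AE_zero)
  have e: "eigen l (\<Phi> l)" if "l \<le> q" for l using assms that by (simp add: decomp_def)
  have P: "\<Phi> l \<in> \<P>" if "l \<le> q" for l using e[OF that] eigen_P by blast
  show "mom (\<Phi> m)" using P P_mom assms by blast
  have "0 = expectation (\<lambda>\<omega>. \<Phi> m \<omega> * (\<Sum>l\<le>q. \<Phi> l \<omega>))"
    using assms unfolding decomp_def
    by (intro integral_eq_zero_AE[symmetric]) (auto elim!: eventually_mono)
  also have "\<dots> = (\<Sum>l\<le>q. expectation (\<lambda>\<omega>. \<Phi> m \<omega> * \<Phi> l \<omega>))"
    using P assms by (simp add: sum_distrib_left P_mult_integrable)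
  also have "\<dots> = (\<Sum>l\<le>q. if l = m then expectation (\<lambda>\<omega>. \<Phi> m \<omega> * \<Phi> m \<omega>) else 0)"
    using eigen_orthogonal[OF e e, of m] assms by (intro sum.cong refl) auto
  also have "\<dots> = expectation (\<lambda>\<omega>. \<Phi> m \<omega> * \<Phi> m \<omega>)" using assms by (simp add: sum.delta)
  finally show "expectation (\<lambda>\<omega>. \<Phi> m \<omega> * \<Phi> m \<omega>) = 0" ..
qed

lemma decomp_unique:
  assumes "decomp F q \<Phi>" "decomp F q \<Psi>" "m \<le> q"
  shows "AE \<omega> in M. \<Phi> m \<omega> = \<Psi> m \<omega>"
proof -
  have "decomp (\<lambda>_. 0) q (\<lambda>m \<omega>. 1 * \<Phi> m \<omega> + (-1) * \<Psi> m \<omega>)"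
    using decomp_lincomb[OF assms(1,2), of 1 "-1"] by simp
  from decomp_zero_unique[OF this assms(3)] show ?thesis by eventually_elim simp
qed

section \<open>Powers of the operator and Sobolev inner products\<close>

lemma I_minus_OU_pow_decomp:
  assumes "F \<in> \<P>"
  obtains q \<Phi> where "decomp F q \<Phi>" "I_minus_OU_pow \<alpha> F = (\<lambda>\<omega>. \<Sum>m\<le>q. (1 + real m) powr \<alpha> * \<Phi> m \<omega>)"
proof -
  have "\<exists>G q \<Phi>. (\<forall>m\<le>q. \<Phi> m \<in> \<P> \<and> (AE \<omega> in M. - OU (\<Phi> m) \<omega> = real m * \<Phi> m \<omega>)) \<and>
     (AE \<omega> in M. F \<omega> = (\<Sum>m\<le>q. \<Phi> m \<omega>)) \<and>
     G = (\<lambda>\<omega>. \<Sum>m\<le>q. (1 + real m) powr \<alpha> * \<Phi> m \<omega>)"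
    using decomp_exists[OF assms] by (simp add: decomp_def eigen_def)
  from someI_ex[OF this] show ?thesis
    using that unfolding I_minus_OU_pow_def decomp_def eigen_def by blast
qed

lemma decomp_P: "decomp F q \<Phi> \<Longrightarrow> m \<le> q \<Longrightarrow> \<Phi> m \<in> \<P>"
  by (auto simp: decomp_def eigen_def)

lemma I_minus_OU_pow_in_P: "F \<in> \<P> \<Longrightarrow> I_minus_OU_pow \<alpha> F \<in> \<P>"
  by (erule I_minus_OU_pow_decomp[where \<alpha> = \<alpha>]) (auto intro!: P_sum P_scale decomp_P)

lemma I_minus_OU_pow_AE:
  assumes F: "F \<in> \<P>" and d: "decomp F q \<Phi>"
  shows "AE \<omega> in M. I_minus_OU_pow \<alpha> F \<omega> = (\<Sum>m\<le>q. (1 + real m) powr \<alpha> * \<Phi> m \<omega>)"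
proof -
  obtain q' \<Psi> where d': "decomp F q' \<Psi>"
    and eq: "I_minus_OU_pow \<alpha> F = (\<lambda>\<omega>. \<Sum>m\<le>q'. (1 + real m) powr \<alpha> * \<Psi> m \<omega>)"
    using I_minus_OU_pow_decomp[OF F] .
  let ?n = "max q q'"
  have "AE \<omega> in M. (\<Sum>m\<le>?n. (1 + real m) powr \<alpha> * (if m \<le> q' then \<Psi> m \<omega> else 0))
      = (\<Sum>m\<le>?n. (1 + real m) powr \<alpha> * (if m \<le> q then \<Phi> m \<omega> else 0))"
  proof (rule AE_sum_cong)
    fix m assume "m \<in> {..?n}"
    then have "AE \<omega> in M. (if m \<le> q' then \<Psi> m \<omega> else 0) = (if m \<le> q then \<Phi> m \<omega> else 0)"
      using decomp_unique[OF decomp_extend[OF d'] decomp_extend[OF d], of ?n m] by simp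
    then show "AE \<omega> in M. (1 + real m) powr \<alpha> * (if m \<le> q' then \<Psi> m \<omega> else 0)
      = (1 + real m) powr \<alpha> * (if m \<le> q then \<Phi> m \<omega> else 0)" by eventually_elim simp
  qed simp
  then show ?thesis by (simp add: eq sum_atMost_extend)
qed

text \<open>The spectral form of the inner product. It holds for any decompositions of common
  length, so bilinearity and monotonicity in \<open>s\<close> can be read off componentwise.\<close>

lemma innerP_decomp:
  assumes F: "F \<in> \<P>" "decomp F q \<Phi>" and G: "G \<in> \<P>" "decomp G q \<Psi>"
  shows "innerP s F G = (\<Sum>m\<le>q. (1 + real m) powr s * expectation (\<lambda>\<omega>. \<Phi> m \<omega> * \<Psi> m \<omega>))"
proof -
  let ?w = "\<lambda>m. (1 + real m) powr (s / 2)"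
  have P: "\<Phi> m \<in> \<P>" "\<Psi> m \<in> \<P>" if "m \<le> q" for m using F G decomp_P that by blast+
  have "innerP s F G = expectation (\<lambda>\<omega>. (\<Sum>m\<le>q. ?w m * \<Phi> m \<omega>) * (\<Sum>m\<le>q. ?w m * \<Psi> m \<omega>))"
    unfolding innerP_def
    by (rule expectation_mult_AE_cong)
      (auto intro!: I_minus_OU_pow_in_P P_sum P_scale P I_minus_OU_pow_AE F G)
  also have "\<dots> = (\<Sum>m\<le>q. \<Sum>l\<le>q. expectation (\<lambda>\<omega>. (?w m * \<Phi> m \<omega>) * (?w l * \<Psi> l \<omega>)))"
    unfolding sum_product
    by (subst Bochner_Integration.integral_sum, (intro Bochner_Integration.integrable_sum P_mult_integrable P_scale P; simp))
      (auto intro!: sum.cong Bochner_Integration.integral_sum P_mult_integrable P_scale P)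
  also have "\<dots> = (\<Sum>m\<le>q. \<Sum>l\<le>q. if l = m then (1 + real m) powr s * expectation (\<lambda>\<omega>. \<Phi> m \<omega> * \<Psi> m \<omega>) else 0)"
  proof (intro sum.cong refl)
    fix m l assume ml: "m \<in> {..q}" "l \<in> {..q}"
    have "expectation (\<lambda>\<omega>. (?w m * \<Phi> m \<omega>) * (?w l * \<Psi> l \<omega>)) = ?w m * ?w l * expectation (\<lambda>\<omega>. \<Phi> m \<omega> * \<Psi> l \<omega>)"
    proof -
      have "(?w m * \<Phi> m \<omega>) * (?w l * \<Psi> l \<omega>) = (?w m * ?w l) * (\<Phi> m \<omega> * \<Psi> l \<omega>)" for \<omega>
        by (simp add: mult_ac)
      then show ?thesis by (simp only: integral_mult_right_zero)
    qed
    moreover have "l \<noteq> m \<Longrightarrow> expectation (\<lambda>\<omega>. \<Phi> m \<omega> * \<Psi> l \<omega>) = 0"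
      using F G ml by (intro eigen_orthogonal[of m _ l]) (auto simp: decomp_def)
    moreover have "?w m * ?w m = (1 + real m) powr s" by (simp flip: powr_add)
    ultimately show "expectation (\<lambda>\<omega>. (?w m * \<Phi> m \<omega>) * (?w l * \<Psi> l \<omega>))
      = (if l = m then (1 + real m) powr s * expectation (\<lambda>\<omega>. \<Phi> m \<omega> * \<Psi> m \<omega>) else 0)" by simp
  qed
  also have "\<dots> = (\<Sum>m\<le>q. (1 + real m) powr s * expectation (\<lambda>\<omega>. \<Phi> m \<omega> * \<Psi> m \<omega>))"
    by (simp add: sum.delta)
  finally show ?thesis .
qed

lemma common_decomp:
  assumes "F \<in> \<P>" "G \<in> \<P>"
  obtains q \<Phi> \<Psi> where "decomp F q \<Phi>" "decomp G q \<Psi>"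
proof -
  obtain q1 \<Phi> q2 \<Psi> where "decomp F q1 \<Phi>" "decomp G q2 \<Psi>" using assms decomp_exists by blast
  from that[OF decomp_extend[OF this(1)] decomp_extend[OF this(2)], of "max q1 q2"] show ?thesis by simp
qed

lemma innerP_AE_cong:
  assumes "F \<in> \<P>" "F' \<in> \<P>" "AE \<omega> in M. F \<omega> = F' \<omega>" "G \<in> \<P>" "G' \<in> \<P>" "AE \<omega> in M. G \<omega> = G' \<omega>"
  shows "innerP s F G = innerP s F' G'"
proof -
  have *: "decomp F' q \<Phi>" if "AE \<omega> in M. F \<omega> = F' \<omega>" "decomp F q \<Phi>" for F F' q \<Phi>
  proof -
    have "AE \<omega> in M. F \<omega> = (\<Sum>m\<le>q. \<Phi> m \<omega>)" using that by (simp add: decomp_def)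
    with that(1) have "AE \<omega> in M. F' \<omega> = (\<Sum>m\<le>q. \<Phi> m \<omega>)" by eventually_elim simp
    with that show ?thesis by (simp add: decomp_def)
  qed
  obtain q \<Phi> \<Psi> where d: "decomp F q \<Phi>" "decomp G q \<Psi>" using common_decomp assms by blast
  with assms show ?thesis
    by (simp add: innerP_decomp[OF _ d(1) _ d(2)] innerP_decomp[OF _ *[OF assms(3) d(1)] _ *[OF assms(6) d(2)]])
qed

lemma innerP_commute: "innerP s F G = innerP s G F"
  by (simp add: innerP_def mult.commute)

lemma innerP_nonneg: "0 \<le> innerP s F F"
  unfolding innerP_def by (rule integral_nonneg_AE) simp

lemma innerP_lincomb_left:
  assumes F: "F \<in> \<P>" and G: "G \<in> \<P>" and H: "H \<in> \<P>"
  shows "innerP s (\<lambda>\<omega>. a * F \<omega> + b * G \<omega>) H = a * innerP s F H + b * innerP s G H"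
proof -
  obtain q1 \<Phi> \<Psi> where d1: "decomp F q1 \<Phi>" "decomp G q1 \<Psi>" using common_decomp F G by blast
  obtain q2 \<Theta> where d2: "decomp H q2 \<Theta>" using decomp_exists H by blast
  obtain q \<Phi> \<Psi> \<Theta> where d: "decomp F q \<Phi>" "decomp G q \<Psi>" "decomp H q \<Theta>"
    using decomp_extend[OF d1(1), of "max q1 q2"] decomp_extend[OF d1(2), of "max q1 q2"]
      decomp_extend[OF d2, of "max q1 q2"] by fastforce
  have "expectation (\<lambda>\<omega>. (a * \<Phi> m \<omega> + b * \<Psi> m \<omega>) * \<Theta> m \<omega>)
      = a * expectation (\<lambda>\<omega>. \<Phi> m \<omega> * \<Theta> m \<omega>) + b * expectation (\<lambda>\<omega>. \<Psi> m \<omega> * \<Theta> m \<omega>)" if "m \<le> q" for m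
    using decomp_P[OF d(1) that] decomp_P[OF d(2) that] decomp_P[OF d(3) that]
    by (simp add: distrib_right mult.assoc P_mult_integrable)
  then show ?thesis
    unfolding innerP_decomp[OF P_lincomb[OF F G] decomp_lincomb[OF d(1,2)] H d(3)]
      innerP_decomp[OF F d(1) H d(3)] innerP_decomp[OF G d(2) H d(3)]
    by (simp add: sum_distrib_left sum.distrib[symmetric] algebra_simps)
qed

lemma innerP_lincomb_right:
  "F \<in> \<P> \<Longrightarrow> G \<in> \<P> \<Longrightarrow> H \<in> \<P> \<Longrightarrow>
    innerP s H (\<lambda>\<omega>. a * F \<omega> + b * G \<omega>) = a * innerP s H F + b * innerP s H G"
  using innerP_lincomb_left[of F G H s a b] by (simp add: innerP_commute)

lemma innerP_mono:
  assumes F: "F \<in> \<P>" and "s \<le> s'"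
  shows "innerP s F F \<le> innerP s' F F"
proof -
  obtain q \<Phi> where d: "decomp F q \<Phi>" using decomp_exists[OF F] by blast
  show ?thesis unfolding innerP_decomp[OF F d F d]
    using \<open>s \<le> s'\<close> by (intro sum_mono mult_right_mono powr_mono) auto
qed

text \<open>Against an eigenfunction only the component of the same degree counts, so the Sobolev
  pairing is an explicit multiple of the plain expectation. Coefficients can therefore be computed
  as expectations whatever \<open>s\<close> is.\<close>

lemma innerP_eigen:
  assumes F: "F \<in> \<P>" and H: "eigen n H"
  shows "innerP s F H = (1 + real n) powr s * expectation (\<lambda>\<omega>. F \<omega> * H \<omega>)"
proof -
  have HP: "H \<in> \<P>" by (rule eigen_P[OF H])
  obtain q0 \<Phi>0 where d0: "decomp F q0 \<Phi>0" using decomp_exists[OF F] by blast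
  obtain q \<Phi> where d: "decomp F q \<Phi>" and "n \<le> q" using decomp_extend[OF d0, of "max q0 n"] by fastforce
  have e: "eigen m (\<Phi> m)" "\<Phi> m \<in> \<P>" if "m \<le> q" for m using d that by (auto simp: decomp_def eigen_def)
  \<comment> \<open>The eigenfunction is its own decomposition, with a single nonzero
    component.\<close>
  let ?\<Psi> = "\<lambda>m \<omega>. if m = n then H \<omega> else 0"
  have "eigen m (?\<Psi> m)" for m using H eigen_zero by (cases "m = n") auto
  then have dH: "decomp H q ?\<Psi>" using \<open>n \<le> q\<close> by (simp add: decomp_def)
  have "innerP s F H = (\<Sum>m\<le>q. if m = n then (1 + real n) powr s * expectation (\<lambda>\<omega>. \<Phi> n \<omega> * H \<omega>) else 0)"
    unfolding innerP_decomp[OF F d HP dH] by (intro sum.cong) auto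
  also have "\<dots> = (1 + real n) powr s * expectation (\<lambda>\<omega>. \<Phi> n \<omega> * H \<omega>)"
    using \<open>n \<le> q\<close> by (simp add: sum.delta)
  also have "expectation (\<lambda>\<omega>. \<Phi> n \<omega> * H \<omega>) = (\<Sum>m\<le>q. expectation (\<lambda>\<omega>. \<Phi> m \<omega> * H \<omega>))"
  proof -
    have "(\<Sum>m\<le>q. expectation (\<lambda>\<omega>. \<Phi> m \<omega> * H \<omega>)) = (\<Sum>m\<le>q. if m = n then expectation (\<lambda>\<omega>. \<Phi> n \<omega> * H \<omega>) else 0)"
      using eigen_orthogonal[OF e(1) H] by (intro sum.cong) auto
    then show ?thesis using \<open>n \<le> q\<close> by (simp add: sum.delta)
  qed
  also have "\<dots> = expectation (\<lambda>\<omega>. (\<Sum>m\<le>q. \<Phi> m \<omega>) * H \<omega>)"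
    unfolding sum_distrib_right
    by (rule Bochner_Integration.integral_sum[symmetric]) (auto intro: P_mult_integrable e HP)
  also have "\<dots> = expectation (\<lambda>\<omega>. F \<omega> * H \<omega>)"
  proof (rule expectation_mult_AE_cong)
    show "AE \<omega> in M. (\<Sum>m\<le>q. \<Phi> m \<omega>) = F \<omega>" using d by (auto simp: decomp_def elim!: eventually_mono)
  qed (auto intro!: P_sum e HP F)
  finally show ?thesis .
qed

lemma innerP_Cauchy_Schwarz:
  assumes F: "F \<in> \<P>" and G: "G \<in> \<P>"
  shows "(innerP s F G)\<^sup>2 \<le> innerP s F F * innerP s G G"
proof (rule quadratic_nonneg_discriminant)
  fix t
  have "0 \<le> innerP s (\<lambda>\<omega>. t * F \<omega> + 1 * G \<omega>) (\<lambda>\<omega>. t * F \<omega> + 1 * G \<omega>)" by (rule innerP_nonneg)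
  then show "0 \<le> innerP s F F * t\<^sup>2 + 2 * innerP s F G * t + innerP s G G"
    unfolding innerP_lincomb_left[OF F G P_lincomb[OF F G]] innerP_lincomb_right[OF F G F] innerP_lincomb_right[OF F G G]
    by (simp add: innerP_commute[of s G F] algebra_simps power2_eq_square)
qed (rule innerP_nonneg)

lemma innerP_abs_le:
  assumes F: "F \<in> \<P>" and G: "G \<in> \<P>"
  shows "\<bar>innerP s F G\<bar> \<le> normP s F * normP s G"
proof -
  have "\<bar>innerP s F G\<bar> \<le> sqrt (innerP s F F * innerP s G G)"
    using innerP_Cauchy_Schwarz[OF F G] by (intro real_le_rsqrt) simp
  then show ?thesis by (simp add: normP_def real_sqrt_mult)
qed

lemma normP_nonneg [simp]: "0 \<le> normP s F"
  by (simp add: normP_def innerP_nonneg)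

lemma normP_square: "(normP s F)\<^sup>2 = innerP s F F"
  by (simp add: normP_def innerP_nonneg)

lemma normP_AE_cong: "F \<in> \<P> \<Longrightarrow> G \<in> \<P> \<Longrightarrow> AE \<omega> in M. F \<omega> = G \<omega> \<Longrightarrow> normP s F = normP s G"
  unfolding normP_def using innerP_AE_cong[of F G F G] by simp

lemma normP_mono: "F \<in> \<P> \<Longrightarrow> s \<le> s' \<Longrightarrow> normP s F \<le> normP s' F"
  unfolding normP_def by (simp add: innerP_mono)

lemma normP_lincomb_le:
  assumes F: "F \<in> \<P>" and G: "G \<in> \<P>"
  shows "normP s (\<lambda>\<omega>. a * F \<omega> + b * G \<omega>) \<le> \<bar>a\<bar> * normP s F + \<bar>b\<bar> * normP s G"
proof (rule power2_le_imp_le)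
  have "(normP s (\<lambda>\<omega>. a * F \<omega> + b * G \<omega>))\<^sup>2 = a\<^sup>2 * (normP s F)\<^sup>2 + 2 * (a * b * innerP s F G) + b\<^sup>2 * (normP s G)\<^sup>2"
    unfolding normP_square innerP_lincomb_left[OF F G P_lincomb[OF F G]] innerP_lincomb_right[OF F G F] innerP_lincomb_right[OF F G G]
    by (simp add: innerP_commute[of s G F] algebra_simps power2_eq_square)
  moreover have "a * b * innerP s F G \<le> \<bar>a\<bar> * \<bar>b\<bar> * (normP s F * normP s G)"
  proof -
    have "a * b * innerP s F G \<le> \<bar>a * b * innerP s F G\<bar>" by simp
    also have "\<dots> = \<bar>a\<bar> * \<bar>b\<bar> * \<bar>innerP s F G\<bar>" by (simp add: abs_mult)
    also have "\<dots> \<le> \<bar>a\<bar> * \<bar>b\<bar> * (normP s F * normP s G)"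
      using innerP_abs_le[OF F G] by (intro mult_left_mono) auto
    finally show ?thesis .
  qed
  ultimately show "(normP s (\<lambda>\<omega>. a * F \<omega> + b * G \<omega>))\<^sup>2 \<le> (\<bar>a\<bar> * normP s F + \<bar>b\<bar> * normP s G)\<^sup>2"
    by (simp add: power2_sum power_mult_distrib algebra_simps)
qed simp

lemma normP_add_le: "F \<in> \<P> \<Longrightarrow> G \<in> \<P> \<Longrightarrow> normP s (\<lambda>\<omega>. F \<omega> + G \<omega>) \<le> normP s F + normP s G"
  using normP_lincomb_le[of F G s 1 1] by simp

lemma normP_diff_le: "F \<in> \<P> \<Longrightarrow> G \<in> \<P> \<Longrightarrow> normP s (\<lambda>\<omega>. F \<omega> - G \<omega>) \<le> normP s F + normP s G"
  using normP_lincomb_le[of F G s 1 "-1"] by simp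

lemma normP_diff_commute:
  assumes "F \<in> \<P>" "G \<in> \<P>"
  shows "normP s (\<lambda>\<omega>. F \<omega> - G \<omega>) = normP s (\<lambda>\<omega>. G \<omega> - F \<omega>)"
proof -
  have "normP s (\<lambda>\<omega>. F \<omega> - G \<omega>) \<le> normP s (\<lambda>\<omega>. G \<omega> - F \<omega>)" if "F \<in> \<P>" "G \<in> \<P>" for F G
    using normP_lincomb_le[OF P_diff[OF that(2,1)] P_const, of s "-1" 0 0] by simp
  then show ?thesis using assms by (intro antisym) auto
qed

lemma normP_triangle:
  assumes "F \<in> \<P>" "G \<in> \<P>" "H \<in> \<P>"
  shows "normP s (\<lambda>\<omega>. F \<omega> - H \<omega>) \<le> normP s (\<lambda>\<omega>. F \<omega> - G \<omega>) + normP s (\<lambda>\<omega>. G \<omega> - H \<omega>)"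
  using normP_add_le[OF P_diff[OF assms(1,2)] P_diff[OF assms(2,3)]] by simp

lemma normP_reverse_triangle:
  assumes "F \<in> \<P>" "G \<in> \<P>"
  shows "\<bar>normP s F - normP s G\<bar> \<le> normP s (\<lambda>\<omega>. F \<omega> - G \<omega>)"
  using normP_add_le[OF P_diff[OF assms] assms(2), of s]
    normP_add_le[OF P_diff[OF assms(2,1)] assms(1), of s] normP_diff_commute[OF assms, of s] by simp

section \<open>The completed spaces\<close>


lemma D_P: "F \<in> \<D> s \<Longrightarrow> F k \<in> \<P>"
  by (simp add: \<D>_def)

lemma normP_zero [simp]: "normP s (\<lambda>_. 0) = 0"
  using innerP_lincomb_left[OF P_const[of 0] P_const[of 0] P_const[of 0], of s 0 0] by (simp add: normP_def)

lemma D_const: "H \<in> \<P> \<Longrightarrow> (\<lambda>_. H) \<in> \<D> s"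
  by (simp add: \<D>_def)

lemma D_Cauchy: "F \<in> \<D> s \<Longrightarrow> e > 0 \<Longrightarrow> \<exists>K. \<forall>i\<ge>K. \<forall>j\<ge>K. normP s (\<lambda>\<omega>. F i \<omega> - F j \<omega>) < e"
  by (simp add: \<D>_def)

text \<open>\<open>innerD\<close> is a \<open>lim\<close>, which says something only once
  convergence is known. Here it follows from the reverse triangle inequality; for the pairing with a
  fixed element it follows from Cauchy-Schwarz.\<close>

lemma normP_tendsto_normD:
  assumes F: "F \<in> \<D> s"
  shows "(\<lambda>k. normP s (F k)) \<longlonglongrightarrow> normD s F"
proof -
  have "Cauchy (\<lambda>k. normP s (F k))"
    unfolding Cauchy_def dist_real_def
    using D_Cauchy[OF F] normP_reverse_triangle[OF D_P[OF F] D_P[OF F]] by (meson le_less_trans)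
  then obtain L where L: "(\<lambda>k. normP s (F k)) \<longlonglongrightarrow> L" using real_Cauchy_convergent convergent_def by blast
  then have "0 \<le> L" by (rule LIMSEQ_le_const) simp
  have "(\<lambda>k. innerP s (F k) (F k)) \<longlonglongrightarrow> L\<^sup>2"
    unfolding normP_square[symmetric] by (intro tendsto_intros L)
  then have "innerD s F F = L\<^sup>2" unfolding innerD_def by (rule limI)
  then show ?thesis using L \<open>0 \<le> L\<close> by (simp add: normD_def)
qed

lemma normD_nonneg: "F \<in> \<D> s \<Longrightarrow> 0 \<le> normD s F"
  using normP_tendsto_normD by (rule LIMSEQ_le_const) simp_all

lemma innerP_tendsto_innerD:
  assumes F: "F \<in> \<D> s" and H: "H \<in> \<P>"
  shows "(\<lambda>k. innerP s (F k) H) \<longlonglongrightarrow> innerD s F (\<lambda>_. H)"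
proof -
  have "Cauchy (\<lambda>k. innerP s (F k) H)"
    unfolding Cauchy_def dist_real_def
  proof (intro allI impI)
    fix e :: real assume "e > 0"
    then have "e / (normP s H + 1) > 0" by (simp add: add_nonneg_pos)
    from D_Cauchy[OF F this] obtain K where
      K: "\<And>i j. i \<ge> K \<Longrightarrow> j \<ge> K \<Longrightarrow> normP s (\<lambda>\<omega>. F i \<omega> - F j \<omega>) < e / (normP s H + 1)" by blast
    have "\<bar>innerP s (F i) H - innerP s (F j) H\<bar> < e" if "i \<ge> K" "j \<ge> K" for i j
    proof -
      have "innerP s (F i) H - innerP s (F j) H = innerP s (\<lambda>\<omega>. F i \<omega> - F j \<omega>) H"
        using innerP_lincomb_left[OF D_P[OF F] D_P[OF F] H, of s 1 i "-1" j] by simp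
      also have "\<bar>\<dots>\<bar> \<le> normP s (\<lambda>\<omega>. F i \<omega> - F j \<omega>) * normP s H"
        by (intro innerP_abs_le P_diff D_P[OF F] H)
      also have "\<dots> \<le> normP s (\<lambda>\<omega>. F i \<omega> - F j \<omega>) * (normP s H + 1)"
        by (intro mult_left_mono) auto
      also have "\<dots> < e"
        using K[OF that] normP_nonneg[of s H] by (simp add: pos_less_divide_eq add_nonneg_pos)
      finally show ?thesis .
    qed
    then show "\<exists>K. \<forall>i\<ge>K. \<forall>j\<ge>K. \<bar>innerP s (F i) H - innerP s (F j) H\<bar> < e" by blast
  qed
  then show ?thesis unfolding innerD_def
    using real_Cauchy_convergent convergent_LIMSEQ_iff by blast
qed

text \<open>The generalized expectation is the limit of the ordinary ones along the representing
  sequence; in particular the choice of \<open>s\<close> does not matter.\<close>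

lemma gen_exp_limit:
  assumes F: "F \<in> \<D> s" and H: "eigen n H"
  shows "(\<lambda>k. expectation (\<lambda>\<omega>. F k \<omega> * H \<omega>)) \<longlonglongrightarrow> (1 + real n) powr (- s) * innerD s F (\<lambda>_. H)"
proof -
  have "expectation (\<lambda>\<omega>. F k \<omega> * H \<omega>) = (1 + real n) powr (- s) * innerP s (F k) H" for k
    unfolding innerP_eigen[OF D_P[OF F] H] by (simp flip: mult.assoc powr_add)
  then show ?thesis using tendsto_mult_left[OF innerP_tendsto_innerD[OF F eigen_P[OF H]]] by simp
qed

lemma D_diff:
  assumes F: "F \<in> \<D> s" and G: "G \<in> \<D> s"
  shows "(\<lambda>k \<omega>. F k \<omega> - G k \<omega>) \<in> \<D> s"
  unfolding \<D>_def
proof (intro CollectI conjI allI impI)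
  show "(\<lambda>\<omega>. F k \<omega> - G k \<omega>) \<in> \<P>" for k by (intro P_diff D_P[OF F] D_P[OF G])
  fix e :: real assume "e > 0"
  then have e2: "e / 2 > 0" by simp
  obtain K1 where K1: "\<And>i j. i \<ge> K1 \<Longrightarrow> j \<ge> K1 \<Longrightarrow> normP s (\<lambda>\<omega>. F i \<omega> - F j \<omega>) < e / 2"
    using D_Cauchy[OF F e2] by blast
  obtain K2 where K2: "\<And>i j. i \<ge> K2 \<Longrightarrow> j \<ge> K2 \<Longrightarrow> normP s (\<lambda>\<omega>. G i \<omega> - G j \<omega>) < e / 2"
    using D_Cauchy[OF G e2] by blast
  have "normP s (\<lambda>\<omega>. F i \<omega> - G i \<omega> - (F j \<omega> - G j \<omega>)) < e" if "i \<ge> max K1 K2" "j \<ge> max K1 K2" for i j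
  proof -
    have "(\<lambda>\<omega>. F i \<omega> - G i \<omega> - (F j \<omega> - G j \<omega>)) = (\<lambda>\<omega>. (F i \<omega> - F j \<omega>) - (G i \<omega> - G j \<omega>))" by auto
    then show ?thesis
      using normP_diff_le[OF P_diff[OF D_P[OF F] D_P[OF F]] P_diff[OF D_P[OF G] D_P[OF G]], of s i j i j]
        K1[of i j] K2[of i j] that by simp
  qed
  then show "\<exists>K. \<forall>i\<ge>K. \<forall>j\<ge>K. normP s (\<lambda>\<omega>. F i \<omega> - G i \<omega> - (F j \<omega> - G j \<omega>)) < e" by blast
qed

lemma D_mono: "s \<le> s' \<Longrightarrow> F \<in> \<D> s' \<Longrightarrow> F \<in> \<D> s"
  unfolding \<D>_def using normP_mono[OF P_diff] by (simp, meson le_less_trans)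

lemma normD_mono:
  assumes "s \<le> s'" "F \<in> \<D> s'"
  shows "normD s F \<le> normD s' F"
  by (rule LIMSEQ_le[OF normP_tendsto_normD[OF D_mono[OF assms]] normP_tendsto_normD[OF assms(2)]])
    (use normP_mono[OF D_P[OF assms(2)] assms(1)] in blast)

text \<open>Sequences at vanishing distance represent the same element of the completion. This
  permits replacing \<open>Err\<close> by explicit partial sums.\<close>

lemma D_perturb:
  assumes F: "F \<in> \<D> s" and G: "\<And>k. G k \<in> \<P>" and lim: "(\<lambda>k. normP s (\<lambda>\<omega>. G k \<omega> - F k \<omega>)) \<longlonglongrightarrow> 0"
  shows "G \<in> \<D> s" "normD s G = normD s F"
proof -
  show GD: "G \<in> \<D> s" unfolding \<D>_def
  proof (intro CollectI conjI allI impI G)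
    fix e :: real assume "e > 0"
    then have e3: "e / 3 > 0" by simp
    obtain K1 where K1: "\<And>i j. i \<ge> K1 \<Longrightarrow> j \<ge> K1 \<Longrightarrow> normP s (\<lambda>\<omega>. F i \<omega> - F j \<omega>) < e / 3"
      using D_Cauchy[OF F e3] by blast
    obtain K2 where K2: "\<And>i. i \<ge> K2 \<Longrightarrow> normP s (\<lambda>\<omega>. G i \<omega> - F i \<omega>) < e / 3"
      using order_tendstoD(2)[OF lim e3] by (auto simp: eventually_sequentially)
    have "normP s (\<lambda>\<omega>. G i \<omega> - G j \<omega>) < e" if "i \<ge> max K1 K2" "j \<ge> max K1 K2" for i j
      using normP_triangle[of "G i" "F i" "G j" s] normP_triangle[of "F i" "F j" "G j" s]
        normP_diff_commute[of "F j" "G j" s] K1[of i j] K2[of i] K2[of j] that G D_P[OF F] by simp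
    then show "\<exists>K. \<forall>i\<ge>K. \<forall>j\<ge>K. normP s (\<lambda>\<omega>. G i \<omega> - G j \<omega>) < e" by blast
  qed
  have "(\<lambda>k. normP s (G k) - normP s (F k)) \<longlonglongrightarrow> 0"
    by (rule Lim_null_comparison[OF _ lim])
      (use normP_reverse_triangle[OF G D_P[OF F]] in \<open>auto intro!: always_eventually\<close>)
  moreover have "(\<lambda>k. normP s (G k) - normP s (F k)) \<longlonglongrightarrow> normD s G - normD s F"
    by (intro tendsto_diff normP_tendsto_normD GD F)
  ultimately have "normD s G - normD s F = 0" by (rule LIMSEQ_unique[symmetric])
  then show "normD s G = normD s F" by simp
qed

section \<open>Orthonormal families of eigenfunctions\<close>

definition eigen_family :: "'i set \<Rightarrow> ('i \<Rightarrow> 'a \<Rightarrow> real) \<Rightarrow> ('i \<Rightarrow> nat) \<Rightarrow> bool" where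
  "eigen_family I H n \<longleftrightarrow> (\<forall>a\<in>I. eigen (n a) (H a)) \<and>
     (\<forall>a\<in>I. \<forall>b\<in>I. expectation (\<lambda>\<omega>. H a \<omega> * H b \<omega>) = (if a = b then 1 else 0))"

lemma eigen_family_P: "eigen_family I H n \<Longrightarrow> a \<in> I \<Longrightarrow> H a \<in> \<P>"
  by (auto simp: eigen_family_def eigen_def)

lemma innerP_sum_left:
  assumes "finite S" "\<And>a. a \<in> S \<Longrightarrow> H a \<in> \<P>" "F \<in> \<P>"
  shows "innerP s (\<lambda>\<omega>. \<Sum>a\<in>S. c a * H a \<omega>) F = (\<Sum>a\<in>S. c a * innerP s (H a) F)"
  using assms(1,2)
proof (induction S)
  case empty
  then show ?case using innerP_lincomb_left[OF assms(3,3,3), of s 0 0] by simp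
next
  case (insert a S)
  have "(\<lambda>\<omega>. \<Sum>a\<in>insert a S. c a * H a \<omega>) = (\<lambda>\<omega>. c a * H a \<omega> + 1 * (\<Sum>a\<in>S. c a * H a \<omega>))"
    using insert by simp
  moreover have "(\<lambda>\<omega>. \<Sum>a\<in>S. c a * H a \<omega>) \<in> \<P>" using insert by (intro P_sum P_scale) auto
  ultimately show ?case using insert assms(3)
    innerP_lincomb_left[of "H a" "\<lambda>\<omega>. \<Sum>a\<in>S. c a * H a \<omega>" F s "c a" 1] by simp
qed

lemma innerP_family_right:
  assumes fam: "eigen_family I H n" and S: "finite S" "S \<subseteq> I" and F: "F \<in> \<P>"
  shows "innerP s F (\<lambda>\<omega>. \<Sum>a\<in>S. c a * H a \<omega>)
    = (\<Sum>a\<in>S. c a * ((1 + real (n a)) powr s * expectation (\<lambda>\<omega>. F \<omega> * H a \<omega>)))"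
proof -
  have "innerP s F (\<lambda>\<omega>. \<Sum>a\<in>S. c a * H a \<omega>) = (\<Sum>a\<in>S. c a * innerP s (H a) F)"
    using innerP_sum_left[of S H F s c] eigen_family_P[OF fam] S F by (auto simp: innerP_commute)
  also have "\<dots> = (\<Sum>a\<in>S. c a * ((1 + real (n a)) powr s * expectation (\<lambda>\<omega>. F \<omega> * H a \<omega>)))"
  proof (rule sum.cong[OF refl])
    fix a assume "a \<in> S"
    then have "eigen (n a) (H a)" using fam S by (auto simp: eigen_family_def)
    then show "c a * innerP s (H a) F = c a * ((1 + real (n a)) powr s * expectation (\<lambda>\<omega>. F \<omega> * H a \<omega>))"
      using innerP_eigen[OF F] innerP_commute[of s "H a" F] by simp
  qed
  finally show ?thesis .
qed

lemma expectation_family_sum: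
  assumes fam: "eigen_family I H n" and S: "finite S" "S \<subseteq> I" and b: "b \<in> I"
  shows "expectation (\<lambda>\<omega>. (\<Sum>a\<in>S. c a * H a \<omega>) * H b \<omega>) = (if b \<in> S then c b else 0)"
proof -
  have int: "integrable M (\<lambda>\<omega>. H a \<omega> * H b \<omega>)" if "a \<in> S" for a
    using that S b eigen_family_P[OF fam] by (intro P_mult_integrable) auto
  have "expectation (\<lambda>\<omega>. (\<Sum>a\<in>S. c a * H a \<omega>) * H b \<omega>) = (\<Sum>a\<in>S. c a * expectation (\<lambda>\<omega>. H a \<omega> * H b \<omega>))"
    unfolding sum_distrib_right mult.assoc using int by simp
  also have "\<dots> = (\<Sum>a\<in>S. if a = b then c b else 0)"
    using fam S b by (intro sum.cong) (auto simp: eigen_family_def)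
  finally show ?thesis using S by (simp add: sum.delta)
qed

lemma normP_family_sum:
  assumes fam: "eigen_family I H n" and S: "finite S" "S \<subseteq> I"
  shows "(normP s (\<lambda>\<omega>. \<Sum>a\<in>S. c a * H a \<omega>))\<^sup>2 = (\<Sum>a\<in>S. (1 + real (n a)) powr s * (c a)\<^sup>2)"
proof -
  have P: "(\<lambda>\<omega>. \<Sum>a\<in>S. c a * H a \<omega>) \<in> \<P>" using eigen_family_P[OF fam] S by (intro P_sum P_scale) auto
  show ?thesis unfolding normP_square innerP_family_right[OF fam S P]
    using expectation_family_sum[OF fam S] S
    by (intro sum.cong) (auto simp: power2_eq_square)
qed

lemma bessel_P:
  assumes fam: "eigen_family I H n" and S: "finite S" "S \<subseteq> I" and F: "F \<in> \<P>"
  shows "(\<Sum>a\<in>S. (1 + real (n a)) powr s * (expectation (\<lambda>\<omega>. F \<omega> * H a \<omega>))\<^sup>2) \<le> (normP s F)\<^sup>2"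
proof -
  let ?U = "\<lambda>\<omega>. \<Sum>a\<in>S. expectation (\<lambda>\<omega>. F \<omega> * H a \<omega>) * H a \<omega>"
  let ?B = "\<Sum>a\<in>S. (1 + real (n a)) powr s * (expectation (\<lambda>\<omega>. F \<omega> * H a \<omega>))\<^sup>2"
  have U: "?U \<in> \<P>" using eigen_family_P[OF fam] S by (intro P_sum P_scale) auto
  have FU: "innerP s F ?U = ?B"
    unfolding innerP_family_right[OF fam S F] by (simp add: power2_eq_square mult_ac)
  have UU: "innerP s ?U ?U = ?B" using normP_family_sum[OF fam S] by (simp add: normP_square)
  have "0 \<le> innerP s (\<lambda>\<omega>. 1 * F \<omega> + (-1) * ?U \<omega>) (\<lambda>\<omega>. 1 * F \<omega> + (-1) * ?U \<omega>)" by (rule innerP_nonneg)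
  also have "\<dots> = innerP s F F - ?B"
    unfolding innerP_lincomb_left[OF F U P_lincomb[OF F U]] innerP_lincomb_right[OF F U F]
      innerP_lincomb_right[OF F U U] innerP_commute[of s ?U F] FU UU by simp
  finally show ?thesis by (simp add: normP_square)
qed

lemma bessel_D:
  assumes fam: "eigen_family I H n" and S: "finite S" "S \<subseteq> I" and F: "F \<in> \<D> s"
    and f: "\<And>a. a \<in> S \<Longrightarrow> (\<lambda>k. expectation (\<lambda>\<omega>. F k \<omega> * H a \<omega>)) \<longlonglongrightarrow> f a"
  shows "(\<Sum>a\<in>S. (1 + real (n a)) powr s * (f a)\<^sup>2) \<le> (normD s F)\<^sup>2"
proof (rule LIMSEQ_le)
  show "(\<lambda>k. \<Sum>a\<in>S. (1 + real (n a)) powr s * (expectation (\<lambda>\<omega>. F k \<omega> * H a \<omega>))\<^sup>2)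
      \<longlonglongrightarrow> (\<Sum>a\<in>S. (1 + real (n a)) powr s * (f a)\<^sup>2)"
    by (intro tendsto_intros f)
  show "(\<lambda>k. (normP s (F k))\<^sup>2) \<longlonglongrightarrow> (normD s F)\<^sup>2"
    by (intro tendsto_intros normP_tendsto_normD F)
qed (use bessel_P[OF fam S D_P[OF F]] in blast)

text \<open>Membership in the closed span of the family; for Hermite products on a grid it is
  membership in \<open>\<D>N\<close>.\<close>

definition family_dense :: "real \<Rightarrow> 'i set \<Rightarrow> ('i \<Rightarrow> 'a \<Rightarrow> real) \<Rightarrow> (nat \<Rightarrow> 'a \<Rightarrow> real) \<Rightarrow> bool" where
  "family_dense s I H F \<longleftrightarrow> F \<in> \<D> s \<and>
     (\<forall>e>0. \<exists>S c. finite S \<and> S \<subseteq> I \<and> normD s (\<lambda>k \<omega>. F k \<omega> - (\<Sum>a\<in>S. c a * H a \<omega>)) < e)"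

text \<open>The approximants \<open>F k\<close> need not lie in the span, yet the
  \<open>k\<close>-th partial sum of the limit coefficients approaches \<open>F k\<close>. Compare
  both with one element \<open>G\<close> of the span close to \<open>F\<close>: once
  \<open>S k\<close> contains the indices of \<open>G\<close>, Bessel's inequality for
  \<open>F - G\<close> bounds the distance from \<open>G\<close> to the partial sum.\<close>

lemma family_expansion:
  assumes fam: "eigen_family I H n" and F: "family_dense s I H F"
    and f: "\<And>a. a \<in> I \<Longrightarrow> (\<lambda>k. expectation (\<lambda>\<omega>. F k \<omega> * H a \<omega>)) \<longlonglongrightarrow> f a"
    and S: "\<And>k. finite (S k)" "\<And>k. S k \<subseteq> I" "\<And>k a. a \<in> I \<Longrightarrow> n a \<le> k \<Longrightarrow> a \<in> S k"
  shows "(\<lambda>k. normP s (\<lambda>\<omega>. F k \<omega> - (\<Sum>a\<in>S k. f a * H a \<omega>))) \<longlonglongrightarrow> 0"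
proof (rule LIMSEQ_I)
  fix e :: real assume "e > 0"
  have FD: "F \<in> \<D> s" using F by (simp add: family_dense_def)
  obtain A c where A: "finite A" "A \<subseteq> I" "normD s (\<lambda>k \<omega>. F k \<omega> - (\<Sum>a\<in>A. c a * H a \<omega>)) < e / 2"
    using F \<open>e > 0\<close> half_gt_zero unfolding family_dense_def by blast
  define G where "G = (\<lambda>\<omega>. \<Sum>a\<in>A. c a * H a \<omega>)"
  define d where "d a = (if a \<in> A then c a else 0)" for a
  have sumP: "(\<lambda>\<omega>. \<Sum>a\<in>B. u a * H a \<omega>) \<in> \<P>" if "B \<subseteq> I" for B u
    using eigen_family_P[OF fam] that by (intro P_sum P_scale) auto
  have GP: "G \<in> \<P>" unfolding G_def by (rule sumP[OF A(2)])
  have FG: "(\<lambda>k \<omega>. F k \<omega> - G \<omega>) \<in> \<D> s" by (intro D_diff FD D_const GP)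
  obtain K0 where K0: "\<And>k. k \<ge> K0 \<Longrightarrow> normP s (\<lambda>\<omega>. F k \<omega> - G \<omega>) < e / 2"
    using order_tendstoD(2)[OF normP_tendsto_normD[OF FG], of "e / 2"] A(3)
    by (auto simp: eventually_sequentially G_def)
  \<comment> \<open>Beyond the sum of the degrees of all indices in \<open>A\<close>, each of them
    has degree at most \<open>k\<close> and so lies in \<open>S k\<close>.\<close>
  define K where "K = max K0 (\<Sum>a\<in>A. n a)"
  have "norm (normP s (\<lambda>\<omega>. F k \<omega> - (\<Sum>a\<in>S k. f a * H a \<omega>)) - 0) < e" if "k \<ge> K" for k
  proof -
    have sub: "A \<subseteq> S k"
    proof
      fix a assume "a \<in> A"
      then have "n a \<le> (\<Sum>a\<in>A. n a)" using A(1) by (intro member_le_sum) auto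
      then show "a \<in> S k" using S(3)[of a k] \<open>a \<in> A\<close> A(2) that by (auto simp: K_def)
    qed
    have G': "G = (\<lambda>\<omega>. \<Sum>a\<in>S k. d a * H a \<omega>)" unfolding G_def
      by (intro ext sum.mono_neutral_cong_left S(1) sub) (auto simp: d_def)
    have coef: "(\<lambda>j. expectation (\<lambda>\<omega>. (F j \<omega> - G \<omega>) * H a \<omega>)) \<longlonglongrightarrow> f a - d a" if "a \<in> I" for a
    proof -
      have "expectation (\<lambda>\<omega>. (F j \<omega> - G \<omega>) * H a \<omega>) = expectation (\<lambda>\<omega>. F j \<omega> * H a \<omega>) - d a" for j
      proof -
        have "expectation (\<lambda>\<omega>. G \<omega> * H a \<omega>) = d a"
          unfolding G_def expectation_family_sum[OF fam A(1,2) that] by (simp add: d_def)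
        then show ?thesis
          by (simp add: left_diff_distrib P_mult_integrable D_P[OF FD] GP eigen_family_P[OF fam that])
      qed
      then show ?thesis using tendsto_diff[OF f[OF that] tendsto_const] by simp
    qed
    have "(normP s (\<lambda>\<omega>. G \<omega> - (\<Sum>a\<in>S k. f a * H a \<omega>)))\<^sup>2 = (normP s (\<lambda>\<omega>. \<Sum>a\<in>S k. (d a - f a) * H a \<omega>))\<^sup>2"
      unfolding G' by (simp add: left_diff_distrib sum_subtractf)
    also have "\<dots> = (\<Sum>a\<in>S k. (1 + real (n a)) powr s * (f a - d a)\<^sup>2)"
      unfolding normP_family_sum[OF fam S(1,2)] by (simp add: power2_commute)
    also have "\<dots> \<le> (normD s (\<lambda>k \<omega>. F k \<omega> - G \<omega>))\<^sup>2"
      using coef S(2) by (intro bessel_D[OF fam S(1,2) FG]) auto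
    finally have "normP s (\<lambda>\<omega>. G \<omega> - (\<Sum>a\<in>S k. f a * H a \<omega>)) \<le> normD s (\<lambda>k \<omega>. F k \<omega> - G \<omega>)"
      by (rule power2_le_imp_le) (rule normD_nonneg[OF FG])
    then have "normP s (\<lambda>\<omega>. G \<omega> - (\<Sum>a\<in>S k. f a * H a \<omega>)) < e / 2" using A(3) by (simp add: G_def)
    moreover have "normP s (\<lambda>\<omega>. F k \<omega> - G \<omega>) < e / 2" using K0 that by (simp add: K_def)
    ultimately show ?thesis
      using normP_triangle[of "F k" G "\<lambda>\<omega>. \<Sum>a\<in>S k. f a * H a \<omega>" s] D_P[OF FD] GP sumP[OF S(2)]
      by simp
  qed
  then show "\<exists>K. \<forall>k\<ge>K. norm (normP s (\<lambda>\<omega>. F k \<omega> - (\<Sum>a\<in>S k. f a * H a \<omega>)) - 0) < e" by blast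
qed

text \<open>By orthogonality the squared distance of two partial sums is a difference of values of a
  bounded increasing sequence.\<close>

lemma family_sums_Cauchy:
  assumes fam: "eigen_family I H n" and S: "\<And>k. finite (S k)" "\<And>k. S k \<subseteq> I" "\<And>i j. i \<le> j \<Longrightarrow> S i \<subseteq> S j"
    and bound: "\<And>k. (\<Sum>a\<in>S k. (1 + real (n a)) powr s * (f a)\<^sup>2) \<le> B"
  shows "(\<lambda>k \<omega>. \<Sum>a\<in>S k. f a * H a \<omega>) \<in> \<D> s"
  unfolding \<D>_def
proof (intro CollectI conjI allI impI)
  show P: "(\<lambda>\<omega>. \<Sum>a\<in>S k. f a * H a \<omega>) \<in> \<P>" for k
    using eigen_family_P[OF fam] S(2)[of k] by (intro P_sum P_scale) auto
  define Q where "Q k = (\<Sum>a\<in>S k. (1 + real (n a)) powr s * (f a)\<^sup>2)" for k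
  have "incseq Q" unfolding Q_def incseq_def using S by (intro allI impI sum_mono2) auto
  moreover have "\<forall>k. Q k \<le> B" using bound by (simp add: Q_def)
  ultimately obtain L where "Q \<longlonglongrightarrow> L" by (rule incseq_convergent)
  then have C: "Cauchy Q" by (rule LIMSEQ_imp_Cauchy)
  fix e :: real assume "e > 0"
  then obtain K where K: "\<And>i j. i \<ge> K \<Longrightarrow> j \<ge> K \<Longrightarrow> \<bar>Q i - Q j\<bar> < e\<^sup>2"
    using C unfolding Cauchy_def dist_real_def by (meson zero_less_power)
  have main: "normP s (\<lambda>\<omega>. (\<Sum>a\<in>S j. f a * H a \<omega>) - (\<Sum>a\<in>S i. f a * H a \<omega>)) < e"
    if "i \<ge> K" "i \<le> j" for i j
  proof (rule power2_less_imp_less)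
    have sub: "S i \<subseteq> S j" using S(3) that by simp
    have "(normP s (\<lambda>\<omega>. (\<Sum>a\<in>S j. f a * H a \<omega>) - (\<Sum>a\<in>S i. f a * H a \<omega>)))\<^sup>2
        = (normP s (\<lambda>\<omega>. \<Sum>a\<in>S j - S i. f a * H a \<omega>))\<^sup>2"
      using S(1) sub by (simp add: sum_diff)
    also have "\<dots> = (\<Sum>a\<in>S j - S i. (1 + real (n a)) powr s * (f a)\<^sup>2)"
      using S(1,2) by (intro normP_family_sum[OF fam]) auto
    also have "\<dots> = Q j - Q i" unfolding Q_def using S(1) sub by (simp add: sum_diff)
    also have "\<dots> < e\<^sup>2" using K[of j i] that by auto
    finally show "(normP s (\<lambda>\<omega>. (\<Sum>a\<in>S j. f a * H a \<omega>) - (\<Sum>a\<in>S i. f a * H a \<omega>)))\<^sup>2 < e\<^sup>2" .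
  qed (use \<open>e > 0\<close> in simp)
  have "normP s (\<lambda>\<omega>. (\<Sum>a\<in>S i. f a * H a \<omega>) - (\<Sum>a\<in>S j. f a * H a \<omega>)) < e" if "i \<ge> K" "j \<ge> K" for i j
    using main[of i j] main[of j i] normP_diff_commute[OF P P, of s i j] that by (cases "i \<le> j") auto
  then show "\<exists>K. \<forall>i\<ge>K. \<forall>j\<ge>K. normP s (\<lambda>\<omega>. (\<Sum>a\<in>S i. f a * H a \<omega>) - (\<Sum>a\<in>S j. f a * H a \<omega>)) < e"
    by blast
qed

end

section \<open>Hermite products\<close>

lemma multi_index_fun_upd: "a \<in> multi_index N \<Longrightarrow> l \<in> {1..N} \<Longrightarrow> a(l := m) \<in> multi_index N"
  by (auto simp: multi_index_def)

lemma multi_index_zero: "a \<in> multi_index N \<Longrightarrow> i \<notin> {1..N} \<Longrightarrow> a i = 0"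
  by (auto simp: multi_index_def)

lemma weight_multi_index: "a \<in> multi_index N \<Longrightarrow> weight a = (\<Sum>i=1..N. a i)"
  unfolding weight_def by (rule sum.mono_neutral_left) (auto simp: multi_index_def)

lemma weight_fun_upd:
  assumes "a \<in> multi_index N" "l \<in> {1..N}"
  shows "weight (a(l := m)) + a l = weight a + m"
proof -
  have "(\<Sum>i\<in>{1..N} - {l}. (a(l := m)) i) = (\<Sum>i\<in>{1..N} - {l}. a i)" by (rule sum.cong) auto
  then show ?thesis
    unfolding weight_multi_index[OF assms(1)] weight_multi_index[OF multi_index_fun_upd[OF assms]]
    using assms(2) by (simp add: sum.remove[of _ l])
qed

lemma finite_multi_index_le: "finite {a. a \<in> multi_index N \<and> weight a \<le> k}"
proof (rule finite_subset)
  show "{a. a \<in> multi_index N \<and> weight a \<le> k}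
      \<subseteq> {f. \<forall>i. (i \<in> {1..N} \<longrightarrow> f i \<in> {..k}) \<and> (i \<notin> {1..N} \<longrightarrow> f i = 0)}"
  proof safe
    fix a i assume a: "a \<in> multi_index N" "weight a \<le> k" "i \<in> {1..N}"
    then have "a i \<le> (\<Sum>i=1..N. a i)" by (intro member_le_sum) auto
    then show "a i \<le> k" using a weight_multi_index[OF a(1)] by simp
  qed (auto simp: multi_index_def)
  show "finite {f. \<forall>i. (i \<in> {1..N} \<longrightarrow> f i \<in> {..k}) \<and> (i \<notin> {1..N} \<longrightarrow> f i = (0::nat))}"
    by (rule finite_set_of_finite_funs) auto
qed

text \<open>The polynomial behind \<open>HH\<close>. Entries are counted from 1 but variables of
  polynomials from 0, so it is a polynomial in \<open>Suc N\<close> variables whose variable 0 is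
  idle.\<close>

definition hprod :: "nat \<Rightarrow> (nat \<Rightarrow> nat) \<Rightarrow> (nat \<Rightarrow> real) \<Rightarrow> real" where
  "hprod N a x = (\<Prod>i=1..N. hermite (a i) (x i))"

lemma poly_fun_hprod: "poly_fun (Suc N) (hprod N a)"
  unfolding hprod_def by (intro poly_fun_prod poly_fun_hermite) auto

lemma hprod_remove:
  "l \<in> {1..N} \<Longrightarrow> hprod N a x = hermite (a l) (x l) * (\<Prod>i\<in>{1..N} - {l}. hermite (a i) (x i))"
  unfolding hprod_def by (subst prod.remove[of _ l]) auto

lemma hprod_fun_upd:
  "l \<in> {1..N} \<Longrightarrow> hprod N (a(l := m)) x = hermite m (x l) * (\<Prod>i\<in>{1..N} - {l}. hermite (a i) (x i))"
  unfolding hprod_remove[of l N "a(l := m)" x] by (auto intro!: prod.cong)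

lemma partial_hprod:
  "partial l (hprod N a) = (if l \<in> {1..N} then (\<lambda>x. sqrt (a l) * hprod N (a(l := a l - 1)) x) else (\<lambda>_. 0))"
proof (cases "l \<in> {1..N}")
  case True
  have "((\<lambda>t. hprod N a (x(l := t))) has_field_derivative sqrt (a l) * hprod N (a(l := a l - 1)) x) (at (x l))" for x
  proof -
    have "(\<lambda>t. hprod N a (x(l := t))) = (\<lambda>t. hermite (a l) t * (\<Prod>i\<in>{1..N} - {l}. hermite (a i) (x i)))"
      unfolding hprod_remove[OF True] by (auto intro!: prod.cong)
    then show ?thesis unfolding hprod_fun_upd[OF True]
      using DERIV_cmult_right[OF DERIV_hermite] by (simp add: mult.assoc)
  qed
  then show ?thesis using True partial_eqI by auto
next
  case False
  have "((\<lambda>t. hprod N a (x(l := t))) has_field_derivative 0) (at (x l))" for x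
  proof -
    have "(\<lambda>t. hprod N a (x(l := t))) = (\<lambda>t. hprod N a x)"
      unfolding hprod_def using False by (auto intro!: prod.cong)
    then show ?thesis by simp
  qed
  then show ?thesis using False partial_eqI by auto
qed

context wiener_space begin

lemma HH_hprod:
  assumes "a \<in> multi_index N" shows "HH h a \<omega> = hprod N a (ev h \<omega>)"
  unfolding HH_def hprod_def
  by (rule prod.mono_neutral_left) (use assms in \<open>auto simp: multi_index_def\<close>)

text \<open>Index 0 does not occur in multi-indices; giving it the zero function keeps the tuple in \<open>L2H\<close>.\<close>

definition tuple :: "nat \<Rightarrow> (nat \<Rightarrow> real \<Rightarrow> real) \<Rightarrow> nat \<Rightarrow> real \<Rightarrow> real" where
  "tuple N h i = (if i \<in> {1..N} then h i else (\<lambda>_. 0))"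

lemma HH_poly_rep:
  assumes h: "\<forall>i\<in>{1..N}. h i \<in> L2H" and a: "a \<in> multi_index N"
  shows "poly_rep (HH h a) (Suc N) (tuple N h) (hprod N a)"
proof -
  have "\<forall>i<Suc N. tuple N h i \<in> L2H" using h by (auto simp: tuple_def L2H_sq_int sq_int_zero)
  from poly_rep_self[OF this poly_fun_hprod[of N a]]
  have "poly_rep (\<lambda>\<omega>. hprod N a (ev (tuple N h) \<omega>)) (Suc N) (tuple N h) (hprod N a)" .
  moreover have "hprod N a (ev (tuple N h) \<omega>) = HH h a \<omega>" for \<omega>
    unfolding HH_hprod[OF a] hprod_def by (rule prod.cong) (auto simp: tuple_def)
  ultimately show ?thesis by simp
qed

lemma HH_in_P: "\<forall>i\<in>{1..N}. h i \<in> L2H \<Longrightarrow> a \<in> multi_index N \<Longrightarrow> HH h a \<in> \<P>"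
  using in_P[OF HH_poly_rep] .

lemma dir_deriv_HH:
  assumes h: "\<forall>i\<in>{1..N}. h i \<in> L2H" and a: "a \<in> multi_index N" and g: "g \<in> L2H"
  shows "AE \<omega> in M. dir_deriv g (HH h a) \<omega>
    = (\<Sum>i=1..N. sqrt (a i) * innerH (h i) g * HH h (a(i := a i - 1)) \<omega>)"
proof -
  have "dirp (Suc N) (tuple N h) g (hprod N a) (ev (tuple N h) \<omega>)
      = (\<Sum>i=1..N. sqrt (a i) * innerH (h i) g * HH h (a(i := a i - 1)) \<omega>)" for \<omega>
  proof -
    have "dirp (Suc N) (tuple N h) g (hprod N a) (ev (tuple N h) \<omega>)
        = (\<Sum>i=1..N. partial i (hprod N a) (ev (tuple N h) \<omega>) * innerH (tuple N h i) g)"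
      unfolding dirp_def by (rule sum.mono_neutral_right) (auto simp: partial_hprod)
    also have "\<dots> = (\<Sum>i=1..N. sqrt (a i) * innerH (h i) g * HH h (a(i := a i - 1)) \<omega>)"
    proof (rule sum.cong[OF refl])
      fix i assume i: "i \<in> {1..N}"
      have "hprod N (a(i := a i - 1)) (ev (tuple N h) \<omega>) = HH h (a(i := a i - 1)) \<omega>"
        unfolding HH_hprod[OF multi_index_fun_upd[OF a i]] hprod_def by (rule prod.cong) (auto simp: tuple_def)
      then show "partial i (hprod N a) (ev (tuple N h) \<omega>) * innerH (tuple N h i) g
          = sqrt (a i) * innerH (h i) g * HH h (a(i := a i - 1)) \<omega>"
        using i by (simp add: partial_hprod tuple_def)
    qed
    finally show ?thesis .
  qed
  with dir_deriv_AE[OF HH_poly_rep[OF h a] g] show ?thesis by simp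
qed

lemma HH_mult_WI:
  assumes a: "a \<in> multi_index N" and l: "l \<in> {1..N}"
  shows "HH h a \<omega> * WI (h l) \<omega> = sqrt (Suc (a l)) * HH h (a(l := Suc (a l))) \<omega> + sqrt (a l) * HH h (a(l := a l - 1)) \<omega>"
proof -
  let ?P = "\<Prod>i\<in>{1..N} - {l}. hermite (a i) (WI (h i) \<omega>)"
  have "HH h a \<omega> * WI (h l) \<omega> = (WI (h l) \<omega> * hermite (a l) (WI (h l) \<omega>)) * ?P"
    unfolding HH_hprod[OF a] hprod_remove[OF l] by simp
  also have "\<dots> = sqrt (Suc (a l)) * (hermite (Suc (a l)) (WI (h l) \<omega>) * ?P) + sqrt (a l) * (hermite (a l - 1) (WI (h l) \<omega>) * ?P)"
    unfolding hermite_three_term by (simp add: distrib_right)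
  finally show ?thesis
    unfolding HH_hprod[OF multi_index_fun_upd[OF a l]] hprod_fun_upd[OF l] .
qed

definition orthonormal :: "nat \<Rightarrow> (nat \<Rightarrow> real \<Rightarrow> real) \<Rightarrow> bool" where
  "orthonormal N h \<longleftrightarrow> (\<forall>i\<in>{1..N}. h i \<in> L2H) \<and>
     (\<forall>i\<in>{1..N}. \<forall>j\<in>{1..N}. innerH (h i) (h j) = (if i = j then 1 else 0))"

text \<open>Orthonormality removes the mixed second derivatives, so the operator splits into
  one-dimensional Hermite operators whose eigenvalues add up to the weight.\<close>

lemma eigen_HH:
  assumes on: "orthonormal N h" and a: "a \<in> multi_index N"
  shows "eigen (weight a) (HH h a)"
proof -
  have h: "\<forall>i\<in>{1..N}. h i \<in> L2H" using on by (simp add: orthonormal_def)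
  let ?C = "\<lambda>i j. innerH (tuple N h i) (tuple N h j)"
  let ?p = "hprod N a"
  have "OUe (Suc N) (tuple N h) ?p x = - real (weight a) * ?p x" for x
  proof -
    have pp: "partial i (partial j ?p) x = 0" if "i \<notin> {1..N} \<or> j \<notin> {1..N}" for i j
      using that partial_scale[OF poly_fun_hprod] by (auto simp: partial_hprod cong: if_cong)
    have "(\<Sum>i<Suc N. \<Sum>j<Suc N. partial i (partial j ?p) x * ?C i j)
        = (\<Sum>i=1..N. \<Sum>j=1..N. partial i (partial j ?p) x * ?C i j)"
    proof (rule sum.mono_neutral_cong_right)
      show "(\<Sum>j<Suc N. partial i (partial j ?p) x * ?C i j) = (\<Sum>j=1..N. partial i (partial j ?p) x * ?C i j)" for i
        by (rule sum.mono_neutral_right) (auto simp: pp)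
      show "\<forall>i\<in>{..<Suc N} - {1..N}. (\<Sum>j<Suc N. partial i (partial j ?p) x * ?C i j) = 0"
        using pp by (auto intro!: sum.neutral)
    qed auto
    also have "\<dots> = (\<Sum>i=1..N. \<Sum>j=1..N. if j = i then partial i (partial i ?p) x else 0)"
      using on by (intro sum.cong refl) (auto simp: tuple_def orthonormal_def)
    also have "\<dots> = (\<Sum>i=1..N. partial i (partial i ?p) x)" by (simp add: sum.delta)
    finally have 1: "(\<Sum>i<Suc N. \<Sum>j<Suc N. partial i (partial j ?p) x * ?C i j) = (\<Sum>i=1..N. partial i (partial i ?p) x)" .
    have 2: "(\<Sum>i<Suc N. partial i ?p x * x i) = (\<Sum>i=1..N. partial i ?p x * x i)"
      by (rule sum.mono_neutral_right) (auto simp: partial_hprod)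
    have "partial i (partial i ?p) x - partial i ?p x * x i = - real (a i) * ?p x" if i: "i \<in> {1..N}" for i
    proof -
      let ?P = "\<Prod>j\<in>{1..N} - {i}. hermite (a j) (x j)"
      have "partial i (partial i ?p) x = sqrt (a i) * (sqrt (real (a i - 1)) * hprod N (a(i := a i - 1 - 1)) x)"
        using i by (simp add: partial_hprod partial_scale[OF poly_fun_hprod])
      then have "partial i (partial i ?p) x - partial i ?p x * x i
         = (sqrt (a i) * (sqrt (real (a i - 1)) * hermite (a i - 1 - 1) (x i)) - x i * (sqrt (a i) * hermite (a i - 1) (x i))) * ?P"
        using i by (simp add: partial_hprod hprod_fun_upd[OF i] algebra_simps)
      also have "\<dots> = - real (a i) * ?p x"
        unfolding hermite_ode hprod_remove[OF i, of a] by simp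
      finally show ?thesis .
    qed
    then have "(\<Sum>i=1..N. partial i (partial i ?p) x) - (\<Sum>i=1..N. partial i ?p x * x i) = (\<Sum>i=1..N. - real (a i) * ?p x)"
      unfolding sum_subtractf[symmetric] by (intro sum.cong) auto
    then show ?thesis unfolding OUp_def 1 2 weight_multi_index[OF a]
      by (simp add: sum_distrib_right sum_negf)
  qed
  with OU_AE[OF HH_poly_rep[OF h a]]
  have "AE \<omega> in M. OU (HH h a) \<omega> = - real (weight a) * hprod N a (ev (tuple N h) \<omega>)" by simp
  moreover have "AE \<omega> in M. HH h a \<omega> = hprod N a (ev (tuple N h) \<omega>)"
    using HH_poly_rep[OF h a] by (simp add: poly_rep_def)
  ultimately have "AE \<omega> in M. - OU (HH h a) \<omega> = real (weight a) * HH h a \<omega>" by eventually_elim simp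
  then show ?thesis using HH_in_P[OF h a] by (simp add: eigen_def)
qed

text \<open>Multiplication by \<open>WI (h l)\<close> raises and lowers the entry \<open>l\<close>;
  subtracting the derivative removes the lowered part, so the adjoint is a pure raising
  operator.\<close>

lemma HH_dir_deriv_adjoint:
  assumes on: "orthonormal N h" and c: "c \<in> multi_index N" and l: "l \<in> {1..N}" and F: "F \<in> \<P>"
  shows "expectation (\<lambda>\<omega>. dir_deriv (h l) F \<omega> * HH h c \<omega>)
    = sqrt (Suc (c l)) * expectation (\<lambda>\<omega>. F \<omega> * HH h (c(l := Suc (c l))) \<omega>)"
proof -
  have h: "\<forall>i\<in>{1..N}. h i \<in> L2H" using on by (simp add: orthonormal_def)
  then have hl: "h l \<in> L2H" using l by blast
  have HP: "HH h c \<in> \<P>" "HH h (c(l := m)) \<in> \<P>" for m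
    using HH_in_P[OF h] c multi_index_fun_upd[OF c l] by auto
  have "AE \<omega> in M. dir_deriv (h l) (HH h c) \<omega> = sqrt (c l) * HH h (c(l := c l - 1)) \<omega>"
  proof -
    have "(\<Sum>i=1..N. sqrt (c i) * innerH (h i) (h l) * HH h (c(i := c i - 1)) \<omega>)
        = (\<Sum>i=1..N. if i = l then sqrt (c l) * HH h (c(l := c l - 1)) \<omega> else 0)" for \<omega>
      using on l by (intro sum.cong) (auto simp: orthonormal_def)
    then show ?thesis using dir_deriv_HH[OF h c hl] l by (simp add: sum.delta)
  qed
  then have "AE \<omega> in M. F \<omega> * (HH h c \<omega> * WI (h l) \<omega> - dir_deriv (h l) (HH h c) \<omega>)
      = F \<omega> * (sqrt (Suc (c l)) * HH h (c(l := Suc (c l))) \<omega>)"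
    by eventually_elim (simp add: HH_mult_WI[OF c l])
  then have "expectation (\<lambda>\<omega>. F \<omega> * (HH h c \<omega> * WI (h l) \<omega> - dir_deriv (h l) (HH h c) \<omega>))
      = expectation (\<lambda>\<omega>. F \<omega> * (sqrt (Suc (c l)) * HH h (c(l := Suc (c l))) \<omega>))"
    by (intro integral_cong_AE borel_measurable_times borel_measurable_diff borel_measurable_const
        P_measurable dir_deriv_in_P F HP WI_measurable hl)
  also have "\<dots> = sqrt (Suc (c l)) * expectation (\<lambda>\<omega>. F \<omega> * HH h (c(l := Suc (c l))) \<omega>)"
    by (simp add: mult.left_commute[of "F _" "sqrt _"])
  finally show ?thesis using dir_deriv_adjoint[OF F HP(1) hl] by simp
qed

text \<open>Write the product at \<open>b\<close> as the raised product at \<open>b\<close> minus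
  one in entry \<open>l\<close>, and move the raising operator to the other factor as a derivative.
  The two families may differ, so the same recursion gives orthonormality on one grid and the
  transition between two grids.\<close>

lemma HH_cross:
  assumes h: "\<forall>i\<in>{1..N0}. h i \<in> L2H" and a: "a \<in> multi_index N0"
    and on: "orthonormal N g" and b: "b \<in> multi_index N" and l: "l \<in> {1..N}" "0 < b l"
  shows "sqrt (b l) * expectation (\<lambda>\<omega>. HH h a \<omega> * HH g b \<omega>)
    = (\<Sum>i=1..N0. sqrt (a i) * innerH (h i) (g l)
        * expectation (\<lambda>\<omega>. HH h (a(i := a i - 1)) \<omega> * HH g (b(l := b l - 1)) \<omega>))"
proof -
  define c where "c = b(l := b l - 1)"
  have c: "c \<in> multi_index N" unfolding c_def by (rule multi_index_fun_upd[OF b l(1)])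
  have cb: "c(l := Suc (c l)) = b" "Suc (c l) = b l" using l by (auto simp: c_def)
  have g: "\<forall>i\<in>{1..N}. g i \<in> L2H" "g l \<in> L2H" using on l by (auto simp: orthonormal_def)
  have P: "HH h a \<in> \<P>" "HH g c \<in> \<P>" "\<And>i. i \<in> {1..N0} \<Longrightarrow> HH h (a(i := a i - 1)) \<in> \<P>"
    using HH_in_P[OF h] HH_in_P[OF g(1)] a c multi_index_fun_upd[OF a] by auto
  have "sqrt (b l) * expectation (\<lambda>\<omega>. HH h a \<omega> * HH g b \<omega>) = expectation (\<lambda>\<omega>. dir_deriv (g l) (HH h a) \<omega> * HH g c \<omega>)"
    using HH_dir_deriv_adjoint[OF on c l(1) P(1)] unfolding cb(1) unfolding cb(2) by simp
  also have "\<dots> = expectation (\<lambda>\<omega>. (\<Sum>i=1..N0. (sqrt (a i) * innerH (h i) (g l)) * HH h (a(i := a i - 1)) \<omega>) * HH g c \<omega>)"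
    using dir_deriv_HH[OF h a g(2)]
    by (intro expectation_mult_AE_cong dir_deriv_in_P P_sum P_scale P) auto
  also have "\<dots> = (\<Sum>i=1..N0. (sqrt (a i) * innerH (h i) (g l)) * expectation (\<lambda>\<omega>. HH h (a(i := a i - 1)) \<omega> * HH g c \<omega>))"
    unfolding sum_distrib_right mult.assoc[of "sqrt _ * innerH _ _"]
    using P_mult_integrable[OF P(3) P(2)] by simp
  finally show ?thesis by (simp add: c_def)
qed

lemma HH_zero: "HH h (\<lambda>_. 0) = (\<lambda>_. 1)"
  by (rule ext) (simp add: HH_def)

lemma multi_index_zero_mem: "(\<lambda>_. 0) \<in> multi_index N"
  by (simp add: multi_index_def)

lemma multi_index_nonzero:
  assumes "b \<in> multi_index N" "b \<noteq> (\<lambda>_. 0)"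
  obtains l where "l \<in> {1..N}" "0 < b l"
  using assms multi_index_zero[OF assms(1)] by (metis ext gr0I)

lemma weight_decrease:
  assumes "b \<in> multi_index N" "l \<in> {1..N}" "0 < b l"
  shows "weight (b(l := b l - 1)) = weight b - 1" "0 < weight b"
  using weight_fun_upd[OF assms(1,2), of "b l - 1"] assms(3) weight_multi_index[OF assms(1)] assms(2)
    member_le_sum[of l "{1..N}" b] by auto

lemma HH_mean_zero:
  assumes on: "orthonormal N g" and b: "b \<in> multi_index N" "b \<noteq> (\<lambda>_. 0)"
  shows "expectation (\<lambda>\<omega>. HH g b \<omega>) = 0"
proof -
  obtain l where l: "l \<in> {1..N}" "0 < b l" using multi_index_nonzero[OF b] .
  have "sqrt (b l) * expectation (\<lambda>\<omega>. HH g (\<lambda>_. 0) \<omega> * HH g b \<omega>) = 0"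
    using on by (subst HH_cross[OF _ multi_index_zero_mem on b(1) l]) (auto simp: orthonormal_def)
  then show ?thesis using l by (simp add: HH_zero)
qed

text \<open>With both families equal, \<open>HH_cross\<close> collapses to one term in which both
  indices are lowered at \<open>l\<close>; the induction is on the weight of
  \<open>b\<close>.\<close>

lemma HH_orthonormal:
  assumes on: "orthonormal N h" and "a \<in> multi_index N" "b \<in> multi_index N"
  shows "expectation (\<lambda>\<omega>. HH h a \<omega> * HH h b \<omega>) = (if a = b then 1 else 0)"
  using assms(2,3)
proof (induction "weight b" arbitrary: a b rule: less_induct)
  case less
  have h: "\<forall>i\<in>{1..N}. h i \<in> L2H" using on by (simp add: orthonormal_def)
  show ?case
  proof (cases "b = (\<lambda>_. 0)")
    case True
    then show ?thesis using HH_mean_zero[OF on less.prems(1)] by (simp add: HH_zero prob_space)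
  next
    case False
    obtain l where l: "l \<in> {1..N}" "0 < b l" using multi_index_nonzero[OF less.prems(2) False] .
    let ?b = "b(l := b l - 1)" and ?a = "a(l := a l - 1)"
    have "sqrt (b l) * expectation (\<lambda>\<omega>. HH h a \<omega> * HH h b \<omega>)
      = (\<Sum>i=1..N. if i = l then sqrt (a l) * expectation (\<lambda>\<omega>. HH h ?a \<omega> * HH h ?b \<omega>) else 0)"
      unfolding HH_cross[OF h less.prems(1) on less.prems(2) l]
      using on l by (intro sum.cong) (auto simp: orthonormal_def)
    also have "\<dots> = sqrt (a l) * expectation (\<lambda>\<omega>. HH h ?a \<omega> * HH h ?b \<omega>)" using l by (simp add: sum.delta)
    also have "expectation (\<lambda>\<omega>. HH h ?a \<omega> * HH h ?b \<omega>) = (if ?a = ?b then 1 else 0)"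
      using weight_decrease[OF less.prems(2) l]
      by (intro less.hyps multi_index_fun_upd less.prems l(1)) auto
    finally have eq: "sqrt (b l) * expectation (\<lambda>\<omega>. HH h a \<omega> * HH h b \<omega>) = sqrt (a l) * (if ?a = ?b then 1 else 0)" .
    show ?thesis
    \<comment> \<open>Truncated lowering would identify entries 0 and 1, but for
      \<open>a l = 0\<close> the coefficient is zero. For positive entries lowering is
      injective.\<close>
    proof (cases "a l = 0")
      case True
      then have "a \<noteq> b" using l by auto
      then show ?thesis using eq True l by simp
    next
      case nz: False
      have "?a = ?b \<longleftrightarrow> a = b \<or> False" if "a l = b l" using that by (metis fun_upd_triv fun_upd_upd)
      moreover have "?a \<noteq> ?b" if "a l \<noteq> b l"
      proof
        assume "?a = ?b"
        then have "?a l = ?b l" by simp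
        then show False using that nz l by simp
      qed
      ultimately show ?thesis using eq l by (cases "a l = b l") auto
    qed
  qed
qed

lemma HH_eigen_family: "orthonormal N h \<Longrightarrow> eigen_family (multi_index N) (HH h) weight"
  by (simp add: eigen_family_def eigen_HH HH_orthonormal)

end

section \<open>Refining a grid\<close>

text \<open>\<open>blk N1 l\<close> is the coarse cell containing the fine cell \<open>l\<close>, both counted from 1.\<close>

definition blk :: "nat \<Rightarrow> nat \<Rightarrow> nat" where
  "blk N1 l = (l - 1) div N1 + 1"

lemma blk_iff:
  assumes "1 \<le> N1" "1 \<le> l" "1 \<le> i"
  shows "blk N1 l = i \<longleftrightarrow> (i - 1) * N1 \<le> l - 1 \<and> l \<le> i * N1"
proof -
  have "blk N1 l = i \<longleftrightarrow> (l - 1) div N1 = i - 1" using assms by (auto simp: blk_def)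
  also have "\<dots> \<longleftrightarrow> (i - 1) * N1 \<le> l - 1 \<and> l - 1 < (i - 1) * N1 + N1"
  proof
    assume "(l - 1) div N1 = i - 1"
    then show "(i - 1) * N1 \<le> l - 1 \<and> l - 1 < (i - 1) * N1 + N1"
      using assms(1) dividend_less_div_times[of N1 "l - 1"] div_times_less_eq_dividend[of "l - 1" N1]
      by (metis add.commute less_le_trans zero_less_one)
  next
    assume "(i - 1) * N1 \<le> l - 1 \<and> l - 1 < (i - 1) * N1 + N1"
    then show "(l - 1) div N1 = i - 1" by (intro div_nat_eqI) (auto simp: mult.commute)
  qed
  also have "(i - 1) * N1 + N1 = i * N1" using assms(3) by (cases i) auto
  finally show ?thesis using assms(2) by linarith
qed

lemma blk_in:
  assumes "1 \<le> N1" "l \<in> {1..N0 * N1}" shows "blk N1 l \<in> {1..N0}"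
proof -
  have "(l - 1) div N1 < N0" using assms by (intro less_mult_imp_div_less) auto
  then show ?thesis by (simp add: blk_def)
qed

lemma blk_set:
  assumes "1 \<le> N1" "i \<in> {1..N0}"
  shows "{l \<in> {1..N0 * N1}. blk N1 l = i} = {(i - 1) * N1 + 1..i * N1}"
proof -
  have "i * N1 \<le> N0 * N1" using assms by (intro mult_right_mono) auto
  show ?thesis
  proof (rule set_eqI)
    fix l
    have "l \<in> {l \<in> {1..N0 * N1}. blk N1 l = i} \<longleftrightarrow> 1 \<le> l \<and> l \<le> N0 * N1 \<and> (i - 1) * N1 \<le> l - 1 \<and> l \<le> i * N1"
      using blk_iff[OF assms(1), of l i] assms(2) by auto
    also have "\<dots> \<longleftrightarrow> (i - 1) * N1 + 1 \<le> l \<and> l \<le> i * N1" using \<open>i * N1 \<le> N0 * N1\<close> by linarith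
    finally show "l \<in> {l \<in> {1..N0 * N1}. blk N1 l = i} \<longleftrightarrow> l \<in> {(i - 1) * N1 + 1..i * N1}" by simp
  qed
qed

lemma card_blk_set:
  assumes "1 \<le> N1" "i \<in> {1..N0}"
  shows "card {l \<in> {1..N0 * N1}. blk N1 l = i} = N1"
  unfolding blk_set[OF assms] using assms(2) by (cases i) auto

lemma blk_mono: "l \<le> l' \<Longrightarrow> blk N1 l \<le> blk N1 l'"
  by (simp add: blk_def div_le_mono)

definition coarsen :: "nat \<Rightarrow> nat \<Rightarrow> (nat \<Rightarrow> nat) \<Rightarrow> nat \<Rightarrow> nat" where
  "coarsen N0 N1 b j = (\<Sum>l | l \<in> {1..N0 * N1} \<and> blk N1 l = j. b l)"

lemma coarsen_multi_index: "1 \<le> N1 \<Longrightarrow> coarsen N0 N1 b \<in> multi_index N0"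
  using blk_in unfolding multi_index_def coarsen_def by (auto intro!: sum.neutral)

lemma weight_coarsen:
  assumes "1 \<le> N1" "b \<in> multi_index (N0 * N1)"
  shows "weight (coarsen N0 N1 b) = weight b"
  unfolding weight_multi_index[OF coarsen_multi_index[OF assms(1)]] weight_multi_index[OF assms(2)]
  unfolding coarsen_def using blk_in[OF assms(1)] by (intro sum.group) auto

lemma coarsen_ge: "l \<in> {1..N0 * N1} \<Longrightarrow> b l \<le> coarsen N0 N1 b (blk N1 l)"
  unfolding coarsen_def by (rule member_le_sum) auto

lemma coarsen_fun_upd:
  assumes l: "l \<in> {1..N0 * N1}" and i: "i = blk N1 l"
  shows "coarsen N0 N1 (b(l := m)) = (coarsen N0 N1 b)(i := coarsen N0 N1 b i - b l + m)"
proof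
  fix j
  show "coarsen N0 N1 (b(l := m)) j = ((coarsen N0 N1 b)(i := coarsen N0 N1 b i - b l + m)) j"
  proof (cases "j = i")
    case True
    let ?B = "{l \<in> {1..N0 * N1}. blk N1 l = i}"
    have lB: "finite ?B" "l \<in> ?B" using l i by auto
    have "(\<Sum>k\<in>?B - {l}. (b(l := m)) k) = (\<Sum>k\<in>?B - {l}. b k)" by (rule sum.cong) auto
    then have "sum (b(l := m)) ?B = m + sum b (?B - {l})" using sum.remove[OF lB, of "b(l := m)"] by simp
    moreover have "sum b ?B = b l + sum b (?B - {l})" by (rule sum.remove[OF lB])
    ultimately show ?thesis using True unfolding coarsen_def by simp
  next
    case False
    then show ?thesis unfolding coarsen_def using i by (auto intro!: sum.cong)
  qed
qed

lemma coarsen_decrease: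
  assumes "l \<in> {1..N0 * N1}" "n \<le> b l"
  shows "coarsen N0 N1 (b(l := b l - n)) = (coarsen N0 N1 b)(blk N1 l := coarsen N0 N1 b (blk N1 l) - n)"
  unfolding coarsen_fun_upd[OF assms(1) refl] using coarsen_ge[OF assms(1), of b] assms(2) by auto

lemma coarsen_zero: "coarsen N0 N1 (\<lambda>_. 0) = (\<lambda>_. 0)"
  by (rule ext) (simp add: coarsen_def)

definition fibre :: "nat \<Rightarrow> nat \<Rightarrow> (nat \<Rightarrow> nat) \<Rightarrow> (nat \<Rightarrow> nat) set" where
  "fibre N0 N1 a = {b \<in> multi_index (N0 * N1). coarsen N0 N1 b = a}"

lemma finite_fibre: "1 \<le> N1 \<Longrightarrow> finite (fibre N0 N1 a)"
  by (rule finite_subset[OF _ finite_multi_index_le[of "N0 * N1" "weight a"]])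
    (auto simp: fibre_def weight_coarsen)

lemma weight_zero: "b \<in> multi_index N \<Longrightarrow> weight b = 0 \<longleftrightarrow> b = (\<lambda>_. 0)"
  using multi_index_zero by (fastforce simp: weight_multi_index)

section \<open>The last nonzero entry of a multi-index\<close>

text \<open>For the zero multi-index this is the maximum of the empty set; all uses assume a nonzero
  entry.\<close>

definition lst :: "(nat \<Rightarrow> nat) \<Rightarrow> nat" where
  "lst b = Max {i. b i \<noteq> 0}"

lemma finite_support: "b \<in> multi_index N \<Longrightarrow> finite {i. b i \<noteq> 0}"
  by (rule finite_subset[of _ "{1..N}"]) (auto simp: multi_index_def)

lemma lst_props:
  assumes b: "b \<in> multi_index N" "b \<noteq> (\<lambda>_. 0)"
  shows "lst b \<in> {1..N}" "0 < b (lst b)" "\<And>j. lst b < j \<Longrightarrow> b j = 0"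
proof -
  have ne: "{i. b i \<noteq> 0} \<noteq> {}" using b by auto
  have in_: "lst b \<in> {i. b i \<noteq> 0}" unfolding lst_def by (rule Max_in[OF finite_support[OF b(1)] ne])
  then show "0 < b (lst b)" by simp
  then show "lst b \<in> {1..N}" using multi_index_zero[OF b(1), of "lst b"] by auto
  show "b j = 0" if "lst b < j" for j
    using Max_ge[OF finite_support[OF b(1)], of j] that by (force simp: lst_def)
qed

lemma lst_eqI:
  assumes "b \<in> multi_index N" "0 < b l" "\<And>j. l < j \<Longrightarrow> b j = 0"
  shows "lst b = l"
  unfolding lst_def
proof (rule Max_eqI[OF finite_support[OF assms(1)]])
  show "y \<le> l" if "y \<in> {i. b i \<noteq> 0}" for y using that assms(3)[of y] by (auto simp: not_less[symmetric])
qed (use assms in auto)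

lemma lst_fun_upd:
  assumes b: "b \<in> multi_index N" "b \<noteq> (\<lambda>_. 0)" and "0 < m"
  shows "lst (b(lst b := m)) = lst b"
  using lst_props[OF b] assms(3) by (intro lst_eqI[of _ N] multi_index_fun_upd b) auto

text \<open>The block map is monotone and block sums of natural numbers do not cancel. Hence all
  fine indices over the same nonzero coarse index end in the same block.\<close>

lemma lst_coarsen:
  assumes N1: "1 \<le> N1" and b: "b \<in> multi_index (N0 * N1)" "b \<noteq> (\<lambda>_. 0)"
  shows "lst (coarsen N0 N1 b) = blk N1 (lst b)"
proof (rule lst_eqI[OF coarsen_multi_index[OF N1]])
  note l = lst_props[OF b]
  show "0 < coarsen N0 N1 b (blk N1 (lst b))" using coarsen_ge[OF l(1), of b] l(2) by linarith
  fix j assume j: "blk N1 (lst b) < j"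
  show "coarsen N0 N1 b j = 0" unfolding coarsen_def
  proof (intro sum.neutral ballI)
    fix l' assume "l' \<in> {l \<in> {1..N0 * N1}. blk N1 l = j}"
    then have "lst b < l'" using j blk_mono[of l' "lst b" N1] by (auto simp: not_le[symmetric])
    then show "b l' = 0" by (rule l(3))
  qed
qed

definition last_gt :: "nat \<Rightarrow> nat \<Rightarrow> (nat \<Rightarrow> nat) set" where
  "last_gt N n = {b \<in> multi_index N. b \<noteq> (\<lambda>_. 0) \<and> n < b (lst b)}"

section \<open>Hermite products on a grid\<close>

lemma integral_indicator_half_line:
  assumes "0 \<le> u" "u \<le> v"
  shows "(LINT t|half_line. indicator {u<..v} t) = v - u"
proof -
  have sub: "{u<..v} \<subseteq> {0..}" using assms by auto
  then show ?thesis using assms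
    by (simp add: measure_def emeasure_half_line[OF sub] sets_half_line Int_absorb2)
qed

lemma grid_h_step:
  "grid_h T N i = step_fun [((T / N) powr (- 1 / 2), (real i - 1) / N * T, real i / N * T)]"
  by (simp add: grid_h_def step_fun_Cons)

lemma valid_grid_step:
  "0 < T \<Longrightarrow> 1 \<le> i \<Longrightarrow> valid_steps [(c, (real i - 1) / real N * T, real i / real N * T)]"
  by (simp add: mult_right_mono divide_right_mono)

lemma grid_h_L2H: "0 < T \<Longrightarrow> 1 \<le> i \<Longrightarrow> grid_h T N i \<in> L2H"
  unfolding grid_h_step L2H_sq_int by (intro sq_int_step_fun valid_grid_step)

text \<open>A fine cell lies inside a coarse cell or is disjoint from it. In the first case the
  product of the two normalizations with the length \<open>T / (N0 * N1)\<close> is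
  \<open>sqrt (N0 / (N0 * N1))\<close>.\<close>

lemma innerH_grid:
  assumes T: "0 < T" and N: "1 \<le> N0" "1 \<le> N1" and i: "i \<in> {1..N0}" and l: "l \<in> {1..N0 * N1}"
  shows "innerH (grid_h T N0 i) (grid_h T (N0 * N1) l) = (if blk N1 l = i then 1 / sqrt N1 else 0)"
proof -
  let ?N = "N0 * N1"
  have pos: "0 < real N0" "0 < real N1" "0 < real ?N" using N by auto
  \<comment> \<open>The nodes of the fine grid. The endpoints of coarse cells are such nodes too, so
    all comparisons become comparisons of natural numbers.\<close>
  define x where "x m = real m / real ?N * T" for m
  have x_le: "x m \<le> x m' \<longleftrightarrow> m \<le> m'" for m m' using pos T
    by (simp add: x_def divide_le_cancel mult_less_0_iff)
  have fine: "{(real l - 1) / real ?N * T<..real l / real ?N * T} = {x (l - 1)<..x l}"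
    using l by (simp add: x_def of_nat_diff)
  have coarse: "{(real i - 1) / N0 * T<..real i / N0 * T} = {x ((i - 1) * N1)<..x (i * N1)}"
    using pos i by (simp add: x_def of_nat_diff)
  let ?c = "(T / N0) powr (- 1 / 2) * (T / ?N) powr (- 1 / 2)"
  have "innerH (grid_h T N0 i) (grid_h T ?N l)
      = (LINT t|half_line. ?c * indicator ({x ((i - 1) * N1)<..x (i * N1)} \<inter> {x (l - 1)<..x l}) t)"
  proof -
    have "(a * indicator A t) * (b * indicator B t) = a * b * indicator (A \<inter> B) t" for a b t :: real and A B
      by (simp add: indicator_inter_arith)
    then show ?thesis unfolding innerH_def grid_h_def fine coarse by (simp only:)
  qed
  also have "\<dots> = ?c * (LINT t|half_line. indicator ({x ((i - 1) * N1)<..x (i * N1)} \<inter> {x (l - 1)<..x l}) t)"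
    by (rule integral_mult_right_zero)
  also have "\<dots> = (if blk N1 l = i then 1 / sqrt N1 else 0)"
  proof (cases "blk N1 l = i")
    case True
    then have "(i - 1) * N1 \<le> l - 1" "l \<le> i * N1" using blk_iff[OF N(2), of l i] i l by auto
    then have "x ((i - 1) * N1) \<le> x (l - 1)" "x l \<le> x (i * N1)" by (auto simp: x_le)
    then have "{x ((i - 1) * N1)<..x (i * N1)} \<inter> {x (l - 1)<..x l} = {x (l - 1)<..x l}" by auto
    then have "?c * (LINT t|half_line. indicator ({x ((i - 1) * N1)<..x (i * N1)} \<inter> {x (l - 1)<..x l}) t) = ?c * (x l - x (l - 1))"
    proof -
      assume eq: "{x ((i - 1) * N1)<..x (i * N1)} \<inter> {x (l - 1)<..x l} = {x (l - 1)<..x l}"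
      have "0 \<le> x (l - 1)" "x (l - 1) \<le> x l" using T x_le[of "l - 1" l] by (auto simp: x_def)
      then show ?thesis unfolding eq by (simp only: integral_indicator_half_line)
    qed
    also have "x l - x (l - 1) = T / ?N"
      using l by (simp add: x_def of_nat_diff left_diff_distrib diff_divide_distrib)
    also have "?c * (T / ?N) = (T / N0) powr (- 1 / 2) * (T / ?N) powr (1 / 2)"
    proof -
      have "(T / ?N) powr (- 1 / 2) * (T / ?N) = (T / ?N) powr (- 1 / 2) * (T / ?N) powr 1"
        using T pos by simp
      also have "\<dots> = (T / ?N) powr (1 / 2)" unfolding powr_add[symmetric] by simp
      finally show ?thesis by (simp only: mult.assoc)
    qed
    also have "\<dots> = sqrt (T / ?N) / sqrt (T / N0)"
      using T pos by (simp add: powr_half_sqrt powr_minus_divide)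
    also have "\<dots> = 1 / sqrt N1" using T pos by (simp add: real_sqrt_divide real_sqrt_mult)
    finally show ?thesis using True by simp
  next
    case False
    then have "i * N1 \<le> l - 1 \<or> l \<le> (i - 1) * N1"
      using blk_iff[OF N(2), of l i] i l by auto
    then have "x (i * N1) \<le> x (l - 1) \<or> x l \<le> x ((i - 1) * N1)" by (auto simp: x_le)
    then have "{x ((i - 1) * N1)<..x (i * N1)} \<inter> {x (l - 1)<..x l} = {}" by auto
    then show ?thesis using False by (simp only:) simp
  qed
  finally show ?thesis .
qed

context wiener_space begin

lemma WI_grid:
  assumes "0 < T" "1 \<le> N" "1 \<le> i"
  shows "AE \<omega> in M. WI (grid_h T N i) \<omega> = \<Delta>W T N i \<omega> / sqrt (T / N)"
proof -
  have wi: "is_wiener_integral (grid_h T N i)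
      (step_integral [((T / N) powr (- 1 / 2), (real i - 1) / N * T, real i / N * T)])"
    unfolding grid_h_step using assms by (intro is_wiener_integral_step valid_grid_step)
  have eq: "step_integral [((T / N) powr (- 1 / 2), (real i - 1) / N * T, real i / N * T)] \<omega>
      = \<Delta>W T N i \<omega> / sqrt (T / N)" for \<omega>
    using assms by (simp add: step_integral_Cons \<Delta>W_def powr_half_sqrt powr_minus_divide)
  show ?thesis using WI_AE_eq[OF grid_h_L2H[OF assms(1,3)] wi] unfolding eq .
qed

text \<open>The trivial refinement \<open>N1 = 1\<close> of \<open>innerH_grid\<close>, where each
  block is a single cell.\<close>

lemma orthonormal_grid:
  assumes "0 < T" "1 \<le> N" shows "orthonormal N (grid_h T N)"
  unfolding orthonormal_def
proof (intro conjI ballI)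
  fix i j assume ij: "i \<in> {1..N}" "j \<in> {1..N}"
  then show "innerH (grid_h T N i) (grid_h T N j) = (if i = j then 1 else 0)"
    using innerH_grid[of T N 1 i j] assms by (simp add: blk_def)
qed (use assms grid_h_L2H in auto)

text \<open>The coefficient of a coarse Hermite product along the fine product at \<open>b\<close>,
  at the only coarse index for which it can be nonzero (\<open>cross_support\<close>). Its square is
  the probability of the allocation \<open>b\<close>, which is accessed through the recursion
  \<open>rho_rec\<close>.\<close>

definition rho :: "real \<Rightarrow> nat \<Rightarrow> nat \<Rightarrow> (nat \<Rightarrow> nat) \<Rightarrow> real" where
  "rho T N0 N1 b = expectation (\<lambda>\<omega>. HH (grid_h T N0) (coarsen N0 N1 b) \<omega> * HH (grid_h T (N0 * N1)) b \<omega>)"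

section \<open>Transition from the coarse to the fine grid\<close>

context
  fixes T :: real and N0 N1 :: nat
  assumes T: "0 < T" and N0: "1 \<le> N0" and N1: "1 \<le> N1"
begin

abbreviation (input) "NN \<equiv> N0 * N1"
abbreviation (input) "Hc \<equiv> HH (grid_h T N0)"
abbreviation (input) "Hf \<equiv> HH (grid_h T (N0 * N1))"
abbreviation (input) "co \<equiv> coarsen N0 N1"
abbreviation (input) "R \<equiv> rho T N0 N1"

lemma NN: "1 \<le> NN"
  using N0 N1 by simp

lemma on_coarse: "orthonormal N0 (grid_h T N0)"
  by (rule orthonormal_grid[OF T N0])

lemma on_fine: "orthonormal NN (grid_h T NN)"
  by (rule orthonormal_grid[OF T NN])

lemma L2H_coarse: "\<forall>i\<in>{1..N0}. grid_h T N0 i \<in> L2H"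
  using on_coarse by (simp add: orthonormal_def)

text \<open>The sum in \<open>HH_cross\<close> has one term, because the fine cell \<open>l\<close>
  meets a single coarse cell.\<close>

lemma cross_rec:
  assumes a: "a \<in> multi_index N0" and b: "b \<in> multi_index NN" and l: "l \<in> {1..NN}" "0 < b l"
    and i: "i = blk N1 l"
  shows "sqrt (b l) * expectation (\<lambda>\<omega>. Hc a \<omega> * Hf b \<omega>)
    = sqrt (a i) / sqrt N1 * expectation (\<lambda>\<omega>. Hc (a(i := a i - 1)) \<omega> * Hf (b(l := b l - 1)) \<omega>)"
proof -
  have "i \<in> {1..N0}" using blk_in[OF N1 l(1)] i by simp
  moreover have "sqrt (b l) * expectation (\<lambda>\<omega>. Hc a \<omega> * Hf b \<omega>) = (\<Sum>j=1..N0. if j = i then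
      sqrt (a i) / sqrt N1 * expectation (\<lambda>\<omega>. Hc (a(i := a i - 1)) \<omega> * Hf (b(l := b l - 1)) \<omega>) else 0)"
    unfolding HH_cross[OF L2H_coarse a on_fine b l]
    using innerH_grid[OF T N0 N1 _ l(1)] i by (intro sum.cong) auto
  ultimately show ?thesis by (simp add: sum.delta)
qed

text \<open>Lowering \<open>b\<close> at a cell and \<open>a\<close> at its block preserves the
  mismatch with the block sums, unless \<open>a i = 0\<close>, where the coefficient vanishes. The
  induction ends at the mean of a nonconstant coarse product.\<close>

lemma cross_support:
  assumes "a \<in> multi_index N0" "b \<in> multi_index NN" "a \<noteq> co b"
  shows "expectation (\<lambda>\<omega>. Hc a \<omega> * Hf b \<omega>) = 0"
  using assms
proof (induction "weight b" arbitrary: a b rule: less_induct)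
  case less
  show ?case
  proof (cases "b = (\<lambda>_. 0)")
    case True
    then have "a \<noteq> (\<lambda>_. 0)" using less.prems by (simp add: coarsen_zero)
    then show ?thesis using True HH_mean_zero[OF on_coarse less.prems(1)] by (simp add: HH_zero)
  next
    case False
    obtain l where l: "l \<in> {1..NN}" "0 < b l" using multi_index_nonzero[OF less.prems(2) False] .
    define i where "i = blk N1 l"
    have i: "i \<in> {1..N0}" using blk_in[OF N1 l(1)] by (simp add: i_def)
    have co: "co (b(l := b l - 1)) = (co b)(i := co b i - 1)" "0 < co b i"
      using coarsen_decrease[OF l(1), of 1 b] coarsen_ge[OF l(1), of b] l(2) by (auto simp: i_def)
    have "sqrt (a i) * expectation (\<lambda>\<omega>. Hc (a(i := a i - 1)) \<omega> * Hf (b(l := b l - 1)) \<omega>) = 0"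
    proof (cases "a i = 0")
      case nz: False
      have "a(i := a i - 1) \<noteq> (co b)(i := co b i - 1)"
      proof
        assume eq: "a(i := a i - 1) = (co b)(i := co b i - 1)"
        have "a j = co b j" for j
          using fun_cong[OF eq, of j] nz co(2) by (cases "j = i") auto
        then show False using less.prems(3) by auto
      qed
      then show ?thesis using co weight_decrease[OF less.prems(2) l]
        by (subst less.hyps) (auto intro!: multi_index_fun_upd less.prems i l(1))
    qed simp
    then have "sqrt (b l) * expectation (\<lambda>\<omega>. Hc a \<omega> * Hf b \<omega>) = 0"
      unfolding cross_rec[OF less.prems(1,2) l i_def] by simp
    then show ?thesis using l by simp
  qed
qed

text \<open>The multinomial recursion for removing one ball from cell \<open>l\<close>: each ball of
  the block chooses this cell with probability \<open>1 / N1\<close>. Squaring disposes of the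
  square roots.\<close>

lemma rho_rec:
  assumes b: "b \<in> multi_index NN" and l: "l \<in> {1..NN}" "0 < b l"
  shows "real (b l) * (R b)\<^sup>2 = real (co b (blk N1 l)) / real N1 * (R (b(l := b l - 1)))\<^sup>2"
proof -
  have co: "co (b(l := b l - 1)) = (co b)(blk N1 l := co b (blk N1 l) - 1)"
    using coarsen_decrease[OF l(1), of 1 b] l(2) by simp
  have "sqrt (b l) * R b = sqrt (co b (blk N1 l)) / sqrt N1 * R (b(l := b l - 1))"
    unfolding rho_def co by (rule cross_rec[OF coarsen_multi_index[OF N1] b l refl])
  then have "(sqrt (b l) * R b)\<^sup>2 = (sqrt (co b (blk N1 l)) / sqrt N1 * R (b(l := b l - 1)))\<^sup>2" by simp
  then show ?thesis by (simp add: power_mult_distrib power_divide)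
qed

text \<open>Expanding \<open>a i\<close> copies of the square of \<open>R\<close> as a sum over the cells in block \<open>i\<close> reduces to a smaller fibre.\<close>

lemma fibre_sum:
  assumes "a \<in> multi_index N0"
  shows "(\<Sum>b\<in>fibre N0 N1 a. (R b)\<^sup>2) = 1"
  using assms
proof (induction "weight a" arbitrary: a rule: less_induct)
  case less
  show ?case
  proof (cases "a = (\<lambda>_. 0)")
    case True
    have "b = (\<lambda>_. 0)" if "b \<in> fibre N0 N1 a" for b
      using that True weight_coarsen[OF N1, of b N0] weight_zero[of b NN] weight_zero[OF multi_index_zero_mem]
      by (simp add: fibre_def)
    then have "fibre N0 N1 a = {\<lambda>_. 0}"
      using True multi_index_zero_mem coarsen_zero by (auto simp: fibre_def)
    then show ?thesis by (simp add: rho_def coarsen_zero HH_zero prob_space)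
  next
    case False
    obtain i where i: "i \<in> {1..N0}" "0 < a i" using multi_index_nonzero[OF less.prems False] .
    let ?a = "a(i := a i - 1)"
    let ?B = "{l \<in> {1..NN}. blk N1 l = i}"
    have IH: "(\<Sum>b\<in>fibre N0 N1 ?a. (R b)\<^sup>2) = 1"
      using weight_decrease[OF less.prems i] by (intro less.hyps multi_index_fun_upd less.prems i(1)) auto
    have fin: "finite (fibre N0 N1 a)" by (rule finite_fibre[OF N1])
    have inner: "(\<Sum>b\<in>fibre N0 N1 a. real (b l) * (R b)\<^sup>2) = real (a i) / real N1" if l: "l \<in> ?B" for l
    proof -
      have l': "l \<in> {1..NN}" "blk N1 l = i" using l by auto
      have "(\<Sum>b\<in>fibre N0 N1 a. real (b l) * (R b)\<^sup>2) = (\<Sum>b | b \<in> fibre N0 N1 a \<and> 0 < b l. real (b l) * (R b)\<^sup>2)"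
        by (rule sum.mono_neutral_right) (use fin in auto)
      also have "\<dots> = (\<Sum>b | b \<in> fibre N0 N1 a \<and> 0 < b l. real (a i) / real N1 * (R (b(l := b l - 1)))\<^sup>2)"
        using rho_rec[OF _ l'(1)] l' by (intro sum.cong refl) (auto simp: fibre_def)
      also have "\<dots> = (\<Sum>b\<in>fibre N0 N1 ?a. real (a i) / real N1 * (R b)\<^sup>2)"
      proof (rule sum.reindex_bij_witness[where i = "\<lambda>b. b(l := Suc (b l))" and j = "\<lambda>b. b(l := b l - 1)"])
        fix b assume b: "b \<in> {b. b \<in> fibre N0 N1 a \<and> 0 < b l}"
        then show "b(l := b l - 1) \<in> fibre N0 N1 ?a"
          using coarsen_decrease[OF l'(1), of 1 b] l' by (auto simp: fibre_def intro: multi_index_fun_upd)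
      next
        fix b assume b: "b \<in> fibre N0 N1 ?a"
        then have "co b i = a i - 1" "b \<in> multi_index NN" by (auto simp: fibre_def)
        moreover have "b l \<le> co b i" using coarsen_ge[OF l'(1), of b] l' by simp
        moreover have "co b j = a j" if "j \<noteq> i" for j using b that by (auto simp: fibre_def)
        ultimately have "co (b(l := Suc (b l))) = a" "b(l := Suc (b l)) \<in> multi_index NN"
          unfolding coarsen_fun_upd[OF l'(1) l'(2)[symmetric]] using i l'
          by (auto intro!: ext multi_index_fun_upd)
        then show "b(l := Suc (b l)) \<in> {b. b \<in> fibre N0 N1 a \<and> 0 < b l}" by (auto simp: fibre_def)
      qed auto
      also have "\<dots> = real (a i) / real N1" unfolding sum_distrib_left[symmetric] IH by simp
      finally show ?thesis .
    qed
    have "real (a i) * (\<Sum>b\<in>fibre N0 N1 a. (R b)\<^sup>2) = (\<Sum>b\<in>fibre N0 N1 a. \<Sum>l\<in>?B. real (b l) * (R b)\<^sup>2)"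
      unfolding sum_distrib_left sum_distrib_right[symmetric]
      by (intro sum.cong refl) (auto simp: fibre_def coarsen_def)
    also have "\<dots> = (\<Sum>l\<in>?B. real (a i) / real N1)"
      by (subst sum.swap) (rule sum.cong[OF refl inner])
    also have "\<dots> = real (a i)" using card_blk_set[OF N1 i(1)] N1 by simp
    finally show ?thesis using i by simp
  qed
qed

text \<open>Removing balls from one cell one after the other produces falling factorials on both
  sides; dividing by \<open>n!\<close> turns them into binomial coefficients.\<close>

lemma rho_iterate:
  assumes b: "b \<in> multi_index NN" and l: "l \<in> {1..NN}" and "n \<le> b l"
  shows "real (b l choose n) * (R b)\<^sup>2 = real (co b (blk N1 l) choose n) / real N1 ^ n * (R (b(l := b l - n)))\<^sup>2"
  using assms(3)
proof (induction n)
  case 0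
  have "b(l := b l) = b" by simp
  then show ?case by simp
next
  case (Suc n)
  let ?c = "co b (blk N1 l)"
  let ?b = "b(l := b l - n)"
  have le: "b l \<le> ?c" by (rule coarsen_ge[OF l])
  \<comment> \<open>The absorption identity, which advances the binomial coefficients on both sides
    by one.\<close>
  have ch: "real (Suc n) * real (m choose Suc n) = real (m - n) * real (m choose n)" for m
    by (metis binomial_absorb_comp binomial_absorption mult.commute of_nat_mult Suc_times_binomial_eq diff_Suc_1 mult_Suc_right times_binomial_minus1_eq)
  have co: "co ?b (blk N1 l) = ?c - n" using coarsen_decrease[OF l, of n b] Suc.prems by simp
  have "real (b l - n) * (R ?b)\<^sup>2 = real (?c - n) / real N1 * (R (b(l := b l - Suc n)))\<^sup>2"
    using rho_rec[OF multi_index_fun_upd[OF b l, of "b l - n"] l] Suc.prems by (simp add: co)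
  then have "real (Suc n) * (real (b l choose Suc n) * (R b)\<^sup>2)
      = real (Suc n) * (real (?c choose Suc n) / real N1 ^ Suc n * (R (b(l := b l - Suc n)))\<^sup>2)"
  proof -
    assume step: "real (b l - n) * (R ?b)\<^sup>2 = real (?c - n) / real N1 * (R (b(l := b l - Suc n)))\<^sup>2"
    have "real (Suc n) * (real (b l choose Suc n) * (R b)\<^sup>2) = real (b l - n) * (real (b l choose n) * (R b)\<^sup>2)"
      by (simp only: mult.assoc[symmetric] ch)
    also have "\<dots> = real (?c choose n) / real N1 ^ n * (real (b l - n) * (R ?b)\<^sup>2)"
      unfolding Suc.IH[OF Suc_leD[OF Suc.prems]] by (rule mult.left_commute)
    also have "\<dots> = (real (?c - n) * real (?c choose n)) / real N1 ^ Suc n * (R (b(l := b l - Suc n)))\<^sup>2"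
      unfolding step by (simp add: mult_ac)
    also have "\<dots> = real (Suc n) * (real (?c choose Suc n) / real N1 ^ Suc n * (R (b(l := b l - Suc n)))\<^sup>2)"
      unfolding ch[symmetric] by simp
    finally show ?thesis .
  qed
  then show ?case by (simp only: mult_cancel_left of_nat_eq_0_iff nat.distinct simp_thms)
qed

text \<open>Since the last nonempty cell holds strictly more than \<open>n\<close> balls, it stays
  nonempty after the removal and is still the last one, so the removal can be undone. All these
  cells lie in one block, so the images belong to a single fibre, of total mass 1.\<close>

lemma fibre_last_gt_sum:
  assumes a: "a \<in> multi_index N0"
  shows "(\<Sum>b\<in>fibre N0 N1 a \<inter> last_gt NN n. (R b)\<^sup>2) \<le> (1 + real (weight a)) ^ n / (fact n * real N1 ^ n)"
proof (cases "fibre N0 N1 a \<inter> last_gt NN n = {}")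
  case False
  let ?B = "fibre N0 N1 a \<inter> last_gt NN n"
  let ?\<phi> = "\<lambda>b. b(lst b := b (lst b) - n)"
  define i where "i = lst a"
  have B: "b \<in> multi_index NN" "b \<noteq> (\<lambda>_. 0)" "n < b (lst b)" "co b = a" if "b \<in> ?B" for b
    using that by (auto simp: fibre_def last_gt_def)
  note l = lst_props[OF B(1,2)]
  have blk: "blk N1 (lst b) = i" if "b \<in> ?B" for b
    using lst_coarsen[OF N1 B(1,2)[OF that]] B(4)[OF that] by (simp add: i_def)
  have i: "i \<in> {1..N0}" using False blk blk_in[OF N1 l(1)] by blast
  have phi: "?\<phi> b \<in> fibre N0 N1 (a(i := a i - n))" if "b \<in> ?B" for b
    using coarsen_decrease[OF l(1)[OF that that], of n] B[OF that] blk[OF that] l(1)[OF that that]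
    by (auto simp: fibre_def intro!: multi_index_fun_upd)
  have inj: "inj_on ?\<phi> ?B"
  proof (rule inj_onI)
    fix b b' assume b: "b \<in> ?B" "b' \<in> ?B" and eq: "?\<phi> b = ?\<phi> b'"
    have lst: "lst (?\<phi> c) = lst c" if "c \<in> ?B" for c using lst_fun_upd[OF B(1,2)[OF that]] B(3)[OF that] by simp
    have ll: "lst b = lst b'" using lst[OF b(1)] lst[OF b(2)] eq by simp
    show "b = b'"
    proof
      fix j
      show "b j = b' j" using fun_cong[OF eq, of j] ll B(3)[OF b(1)] B(3)[OF b(2)]
        by (cases "j = lst b") (auto split: if_splits)
    qed
  qed
  have "(\<Sum>b\<in>?B. (R b)\<^sup>2) \<le> (\<Sum>b\<in>?B. real (a i choose n) / real N1 ^ n * (R (?\<phi> b))\<^sup>2)"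
  proof (rule sum_mono)
    fix b assume b: "b \<in> ?B"
    have "1 * (R b)\<^sup>2 \<le> real (b (lst b) choose n) * (R b)\<^sup>2"
      using B(3)[OF b] zero_less_binomial[of n "b (lst b)"] by (intro mult_right_mono) (auto simp: Suc_le_eq)
    also have "\<dots> = real (a i choose n) / real N1 ^ n * (R (?\<phi> b))\<^sup>2"
      using rho_iterate[OF B(1)[OF b] l(1)[OF b b], of n] B(3,4)[OF b] blk[OF b] by simp
    finally show "(R b)\<^sup>2 \<le> real (a i choose n) / real N1 ^ n * (R (?\<phi> b))\<^sup>2" by simp
  qed
  also have "\<dots> = real (a i choose n) / real N1 ^ n * (\<Sum>b\<in>?\<phi> ` ?B. (R b)\<^sup>2)"
    unfolding sum.reindex[OF inj] by (simp add: sum_distrib_left)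
  also have "\<dots> \<le> real (a i choose n) / real N1 ^ n * 1"
  proof (rule mult_left_mono)
    have "(\<Sum>b\<in>?\<phi> ` ?B. (R b)\<^sup>2) \<le> (\<Sum>b\<in>fibre N0 N1 (a(i := a i - n)). (R b)\<^sup>2)"
      using phi by (intro sum_mono2 finite_fibre[OF N1]) auto
    then show "(\<Sum>b\<in>?\<phi> ` ?B. (R b)\<^sup>2) \<le> 1" using fibre_sum[OF multi_index_fun_upd[OF a i]] by simp
  qed simp
  \<comment> \<open>From \<open>(m choose n) * n! \<le> m^n\<close>. Passing from the entry
    \<open>a i\<close> to \<open>1 + weight a\<close> produces the factor by which Sobolev weights
    of different order differ.\<close>
  also have "real (a i choose n) / real N1 ^ n * 1 \<le> ((1 + real (weight a)) ^ n / fact n) / real N1 ^ n"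
  proof -
    have "a i \<le> weight a" unfolding weight_multi_index[OF a] using i by (intro member_le_sum) auto
    have "real (a i choose n) * fact n = real ((a i choose n) * fact n)" by simp
    also have "\<dots> \<le> real (a i ^ n)" using binomial_fact_pow of_nat_le_iff by blast
    also have "\<dots> \<le> (1 + real (weight a)) ^ n" using \<open>a i \<le> weight a\<close> by (simp add: power_mono)
    finally show ?thesis unfolding mult_1_right by (intro divide_right_mono) (simp_all add: pos_le_divide_eq)
  qed
  finally show ?thesis by simp
qed (simp add: divide_nonneg_nonneg)

lemma fibre_last_gt_sum_powr:
  assumes a: "a \<in> multi_index N0" and r: "0 \<le> r" "r \<le> 1"
  shows "(\<Sum>b\<in>fibre N0 N1 a \<inter> last_gt NN n. (R b)\<^sup>2)
    \<le> (1 + real (weight a)) powr (r * real n) / (fact n * real N1 ^ n) powr r"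
proof -
  define S where "S = (\<Sum>b\<in>fibre N0 N1 a \<inter> last_gt NN n. (R b)\<^sup>2)"
  define K where "K = (1 + real (weight a)) ^ n / (fact n * real N1 ^ n)"
  have pos: "0 < K" using N1 by (simp add: K_def)
  have "S \<le> (\<Sum>b\<in>fibre N0 N1 a. (R b)\<^sup>2)" unfolding S_def by (intro sum_mono2 finite_fibre[OF N1]) auto
  then have S1: "S \<le> 1" using fibre_sum[OF a] by simp
  have SK: "S \<le> K" unfolding S_def K_def by (rule fibre_last_gt_sum[OF a])
  \<comment> \<open>If \<open>K \<ge> 1\<close> then already \<open>1 \<le> K powr r\<close>;
    otherwise \<open>K \<le> K powr r\<close> because \<open>r \<le> 1\<close>.\<close>
  have "S \<le> K powr r"
  proof (cases "1 \<le> K")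
    case True
    then show ?thesis using S1 ge_one_powr_ge_zero[OF True r(1)] by linarith
  next
    case False
    then have "K powr 1 \<le> K powr r" using pos r by (intro powr_mono') auto
    then show ?thesis using SK pos by simp
  qed
  also have "K powr r = (1 + real (weight a)) powr (r * real n) / (fact n * real N1 ^ n) powr r"
    unfolding K_def using N1 by (simp add: powr_divide powr_powr mult.commute flip: powr_realpow)
  finally show ?thesis by (simp add: S_def)
qed

text \<open>Equality in Bessel's inequality: the squared coefficients sum to 1 over the fibre and
  all indices there have the same weight, so the squared norms of the product and of its expansion
  and their inner product all coincide.\<close>

lemma fine_expansion:
  assumes a: "a \<in> multi_index N0"
  shows "normP s (\<lambda>\<omega>. Hc a \<omega> - (\<Sum>b\<in>fibre N0 N1 a. R b * Hf b \<omega>)) = 0"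
proof -
  note fam = HH_eigen_family[OF on_fine]
  note S = finite_fibre[OF N1, of N0 a]
  have sub: "fibre N0 N1 a \<subseteq> multi_index NN" by (auto simp: fibre_def)
  let ?U = "\<lambda>\<omega>. \<Sum>b\<in>fibre N0 N1 a. R b * Hf b \<omega>"
  let ?w = "(1 + real (weight a)) powr s"
  have P: "Hc a \<in> \<P>" by (rule HH_in_P[OF L2H_coarse a])
  have U: "?U \<in> \<P>" using eigen_family_P[OF fam] sub by (intro P_sum P_scale) auto
  have w: "weight b = weight a" "expectation (\<lambda>\<omega>. Hc a \<omega> * Hf b \<omega>) = R b" if "b \<in> fibre N0 N1 a" for b
    using that weight_coarsen[OF N1, of b N0] by (auto simp: fibre_def rho_def)
  have "innerP s (Hc a) ?U = (\<Sum>b\<in>fibre N0 N1 a. ?w * (R b)\<^sup>2)"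
    unfolding innerP_family_right[OF fam S sub P] by (intro sum.cong) (auto simp: w power2_eq_square)
  also have "\<dots> = ?w" unfolding sum_distrib_left[symmetric] fibre_sum[OF a] by simp
  finally have PU: "innerP s (Hc a) ?U = ?w" .
  have "innerP s ?U ?U = (\<Sum>b\<in>fibre N0 N1 a. ?w * (R b)\<^sup>2)"
    unfolding normP_square[symmetric] normP_family_sum[OF fam S sub] by (intro sum.cong) (auto simp: w)
  also have "\<dots> = ?w" unfolding sum_distrib_left[symmetric] fibre_sum[OF a] by simp
  finally have UU: "innerP s ?U ?U = ?w" .
  have PP: "innerP s (Hc a) (Hc a) = ?w"
    unfolding innerP_eigen[OF P eigen_HH[OF on_coarse a]] HH_orthonormal[OF on_coarse a a] by simp
  have "(normP s (\<lambda>\<omega>. 1 * Hc a \<omega> + (-1) * ?U \<omega>))\<^sup>2 = 0"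
    unfolding normP_square innerP_lincomb_left[OF P U P_lincomb[OF P U]] innerP_lincomb_right[OF P U P]
      innerP_lincomb_right[OF P U U] innerP_commute[of s ?U "Hc a"] PU UU PP by simp
  then show ?thesis by simp
qed

lemma normP_sum_le:
  "(\<And>a. a \<in> S \<Longrightarrow> G a \<in> \<P>) \<Longrightarrow> normP s (\<lambda>\<omega>. \<Sum>a\<in>S. c a * G a \<omega>) \<le> (\<Sum>a\<in>S. \<bar>c a\<bar> * normP s (G a))"
proof (induction S rule: infinite_finite_induct)
  case (insert a S)
  have "normP s (\<lambda>\<omega>. c a * G a \<omega> + 1 * (\<Sum>a\<in>S. c a * G a \<omega>)) \<le> \<bar>c a\<bar> * normP s (G a) + \<bar>1\<bar> * normP s (\<lambda>\<omega>. \<Sum>a\<in>S. c a * G a \<omega>)"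
    using insert by (intro normP_lincomb_le P_sum P_scale) auto
  with insert show ?case by simp
qed auto

text \<open>Replacing each coarse product in an approximant by its fine expansion changes nothing in
  norm. The supports of different coarse indices are disjoint fibres, so the result is again a plain
  linear combination.\<close>

lemma family_dense_fine:
  assumes F: "family_dense t (multi_index N0) Hc F" and "s \<le> t"
  shows "family_dense s (multi_index NN) Hf F"
  unfolding family_dense_def
proof (intro conjI allI impI)
  have FD: "F \<in> \<D> t" using F by (simp add: family_dense_def)
  show FDs: "F \<in> \<D> s" by (rule D_mono[OF \<open>s \<le> t\<close> FD])
  fix e :: real assume "e > 0"
  then obtain S c where S: "finite S" "S \<subseteq> multi_index N0"
    and e: "normD t (\<lambda>k \<omega>. F k \<omega> - (\<Sum>a\<in>S. c a * Hc a \<omega>)) < e"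
    using F unfolding family_dense_def by blast
  define S' where "S' = (\<Union>a\<in>S. fibre N0 N1 a)"
  have S': "finite S'" "S' \<subseteq> multi_index NN" using S finite_fibre[OF N1] by (auto simp: S'_def fibre_def)
  let ?U = "\<lambda>\<omega>. \<Sum>a\<in>S. c a * Hc a \<omega>"
  let ?V = "\<lambda>\<omega>. \<Sum>b\<in>S'. (c (co b) * R b) * Hf b \<omega>"
  have PH: "Hc a \<in> \<P>" if "a \<in> S" for a using HH_in_P[OF L2H_coarse] S that by blast
  have PF: "(\<lambda>\<omega>. \<Sum>b\<in>B. u b * Hf b \<omega>) \<in> \<P>" if "B \<subseteq> multi_index NN" for B u
    using eigen_family_P[OF HH_eigen_family[OF on_fine]] that by (intro P_sum P_scale) auto
  have U: "?U \<in> \<P>" using PH by (intro P_sum P_scale) auto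
  have V: "?V \<in> \<P>" by (rule PF[OF S'(2)])
  have Veq: "?V \<omega> = (\<Sum>a\<in>S. c a * (\<Sum>b\<in>fibre N0 N1 a. R b * Hf b \<omega>))" for \<omega>
  proof -
    have "?V \<omega> = (\<Sum>a\<in>S. \<Sum>b\<in>fibre N0 N1 a. (c (co b) * R b) * Hf b \<omega>)"
      unfolding S'_def using S finite_fibre[OF N1] by (intro sum.UNION_disjoint) (auto simp: fibre_def)
    also have "\<dots> = (\<Sum>a\<in>S. c a * (\<Sum>b\<in>fibre N0 N1 a. R b * Hf b \<omega>))"
      unfolding sum_distrib_left by (intro sum.cong refl) (auto simp: fibre_def)
    finally show ?thesis .
  qed
  have "normP s (\<lambda>\<omega>. ?U \<omega> - ?V \<omega>) = normP s (\<lambda>\<omega>. \<Sum>a\<in>S. c a * (Hc a \<omega> - (\<Sum>b\<in>fibre N0 N1 a. R b * Hf b \<omega>)))"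
    unfolding Veq by (simp add: right_diff_distrib sum_subtractf)
  also have "\<dots> \<le> (\<Sum>a\<in>S. \<bar>c a\<bar> * normP s (\<lambda>\<omega>. Hc a \<omega> - (\<Sum>b\<in>fibre N0 N1 a. R b * Hf b \<omega>)))"
    by (intro normP_sum_le P_diff PH PF) (auto simp: fibre_def)
  also have "\<dots> = 0" using S(2) fine_expansion by (intro sum.neutral) auto
  finally have UV: "normP s (\<lambda>\<omega>. ?U \<omega> - ?V \<omega>) = 0" by (simp add: order_antisym)
  have FU: "(\<lambda>k \<omega>. F k \<omega> - ?U \<omega>) \<in> \<D> t" by (intro D_diff FD D_const U)
  have "normD s (\<lambda>k \<omega>. F k \<omega> - ?V \<omega>) = normD s (\<lambda>k \<omega>. F k \<omega> - ?U \<omega>)"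
  proof (rule D_perturb(2)[OF D_mono[OF \<open>s \<le> t\<close> FU]])
    show "(\<lambda>\<omega>. F k \<omega> - ?V \<omega>) \<in> \<P>" for k by (intro P_diff D_P[OF FD] V)
    show "(\<lambda>k. normP s (\<lambda>\<omega>. F k \<omega> - ?V \<omega> - (F k \<omega> - ?U \<omega>))) \<longlonglongrightarrow> 0" using UV by simp
  qed
  also have "\<dots> < e" using normD_mono[OF \<open>s \<le> t\<close> FU] e by simp
  finally show "\<exists>S c. finite S \<and> S \<subseteq> multi_index NN \<and> normD s (\<lambda>k \<omega>. F k \<omega> - (\<Sum>a\<in>S. c a * Hf a \<omega>)) < e"
    using S' by (intro exI[of _ S'] exI[of _ "\<lambda>b. c (co b) * R b"]) simp
qed

text \<open>Pair the coarse partial sums of \<open>F\<close> with a fine product: a single term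
  survives, and the error tends to zero because the partial sums approach \<open>F k\<close> in
  norm.\<close>

lemma coefficient_fine:
  assumes F: "family_dense t (multi_index N0) Hc F"
    and g: "\<And>a. a \<in> multi_index N0 \<Longrightarrow> (\<lambda>k. expectation (\<lambda>\<omega>. F k \<omega> * Hc a \<omega>)) \<longlonglongrightarrow> g a"
    and b: "b \<in> multi_index NN" and f: "(\<lambda>k. expectation (\<lambda>\<omega>. F k \<omega> * Hf b \<omega>)) \<longlonglongrightarrow> f"
  shows "f = g (co b) * R b"
proof -
  have FD: "F \<in> \<D> t" using F by (simp add: family_dense_def)
  define S where "S k = {a. a \<in> multi_index N0 \<and> weight a \<le> k}" for k
  let ?U = "\<lambda>k \<omega>. \<Sum>a\<in>S k. g a * Hc a \<omega>"
  have S: "finite (S k)" "S k \<subseteq> multi_index N0" for k by (auto simp: S_def finite_multi_index_le)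
  note eb = eigen_HH[OF on_fine b]
  have PH: "Hc a \<in> \<P>" if "a \<in> S k" for a k using HH_in_P[OF L2H_coarse] S that by blast
  have U: "?U k \<in> \<P>" for k using PH by (intro P_sum P_scale) auto
  let ?w = "(1 + real (weight b)) powr (- t)"
  \<comment> \<open>From \<open>weight b \<le> k\<close> on, the partial sum contains the index
    \<open>co b\<close>, which has the same weight as \<open>b\<close>.\<close>
  have bound: "\<bar>expectation (\<lambda>\<omega>. F k \<omega> * Hf b \<omega>) - g (co b) * R b\<bar>
      \<le> ?w * (normP t (\<lambda>\<omega>. F k \<omega> - ?U k \<omega>) * normP t (Hf b))" if "k \<ge> weight b" for k
  proof -
    have "expectation (\<lambda>\<omega>. ?U k \<omega> * Hf b \<omega>) = (\<Sum>a\<in>S k. g a * expectation (\<lambda>\<omega>. Hc a \<omega> * Hf b \<omega>))"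
      unfolding sum_distrib_right mult.assoc using PH P_mult_integrable eigen_P[OF eb] by simp
    also have "\<dots> = (\<Sum>a\<in>S k. if a = co b then g (co b) * R b else 0)"
      using S(2) cross_support[OF _ b] by (intro sum.cong) (auto simp: rho_def)
    also have "\<dots> = g (co b) * R b"
      using S(1) that coarsen_multi_index[OF N1] weight_coarsen[OF N1 b] by (simp add: sum.delta S_def)
    finally have 1: "expectation (\<lambda>\<omega>. ?U k \<omega> * Hf b \<omega>) = g (co b) * R b" .
    have 2: "expectation (\<lambda>\<omega>. (F k \<omega> - ?U k \<omega>) * Hf b \<omega>)
        = expectation (\<lambda>\<omega>. F k \<omega> * Hf b \<omega>) - expectation (\<lambda>\<omega>. ?U k \<omega> * Hf b \<omega>)"
      unfolding left_diff_distrib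
      by (rule Bochner_Integration.integral_diff[OF P_mult_integrable[OF D_P[OF FD] eigen_P[OF eb]]
            P_mult_integrable[OF U eigen_P[OF eb]]])
    have 3: "expectation (\<lambda>\<omega>. (F k \<omega> - ?U k \<omega>) * Hf b \<omega>) = ?w * innerP t (\<lambda>\<omega>. F k \<omega> - ?U k \<omega>) (Hf b)"
      unfolding innerP_eigen[OF P_diff[OF D_P[OF FD] U] eb] by (simp flip: mult.assoc powr_add)
    have "\<bar>?w * innerP t (\<lambda>\<omega>. F k \<omega> - ?U k \<omega>) (Hf b)\<bar> = ?w * \<bar>innerP t (\<lambda>\<omega>. F k \<omega> - ?U k \<omega>) (Hf b)\<bar>"
      by (simp add: abs_mult)
    also have "\<dots> \<le> ?w * (normP t (\<lambda>\<omega>. F k \<omega> - ?U k \<omega>) * normP t (Hf b))"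
      by (intro mult_left_mono innerP_abs_le P_diff D_P[OF FD] U eigen_P[OF eb]) simp
    finally show ?thesis using 1 2 3 by argo
  qed
  have "(\<lambda>k. normP t (\<lambda>\<omega>. F k \<omega> - ?U k \<omega>)) \<longlonglongrightarrow> 0"
    using S by (intro family_expansion[OF HH_eigen_family[OF on_coarse] F g]) (auto simp: S_def)
  then have lim: "(\<lambda>k. ?w * (normP t (\<lambda>\<omega>. F k \<omega> - ?U k \<omega>) * normP t (Hf b))) \<longlonglongrightarrow> 0"
    by (intro tendsto_mult_right_zero tendsto_mult_left_zero)
  have ev: "\<forall>\<^sub>F k in sequentially. norm (expectation (\<lambda>\<omega>. F k \<omega> * Hf b \<omega>) - g (co b) * R b)
      \<le> ?w * (normP t (\<lambda>\<omega>. F k \<omega> - ?U k \<omega>) * normP t (Hf b))"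
    using bound by (auto simp: eventually_sequentially)
  have "(\<lambda>k. expectation (\<lambda>\<omega>. F k \<omega> * Hf b \<omega>) - g (co b) * R b) \<longlonglongrightarrow> 0"
    by (rule Lim_null_comparison[OF ev lim])
  then have "(\<lambda>k. expectation (\<lambda>\<omega>. F k \<omega> * Hf b \<omega>)) \<longlonglongrightarrow> g (co b) * R b" by (simp add: LIM_zero_iff)
  with f show ?thesis by (rule LIMSEQ_unique)
qed

end

end

section \<open>The error as a series of Hermite products\<close>

lemma multi_index_mono: "a \<in> multi_index l \<Longrightarrow> l \<le> N \<Longrightarrow> a \<in> multi_index N"
  by (auto simp: multi_index_def)

lemma borel_measurable_hermite: "hermite m \<in> borel_measurable borel"
  by (intro borel_measurable_continuous_onI continuous_at_imp_continuous_on)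
    (blast intro: DERIV_isCont DERIV_hermite)

text \<open>The multi-indices \<open>b\<close> subtracted from \<open>F k\<close> in \<open>Err\<close>: the term of \<open>(a, m)\<close> occurs once \<open>weight a \<le> k\<close>.\<close>

definition clark_ocone_set :: "nat \<Rightarrow> nat \<Rightarrow> nat \<Rightarrow> (nat \<Rightarrow> nat) set" where
  "clark_ocone_set N n k = {b \<in> multi_index N. b \<noteq> (\<lambda>_. 0) \<and> b (lst b) \<le> n \<and> weight b \<le> k + b (lst b)}"

text \<open>The triple \<open>(m, l, a)\<close> corresponds to \<open>a(l := m)\<close>. As
  \<open>m\<close> is positive and \<open>a\<close> has length \<open>l - 1\<close>, the position
  \<open>l\<close> is recovered as the last nonzero one.\<close>

lemma sum_clark_ocone_set:
  fixes G :: "(nat \<Rightarrow> nat) \<Rightarrow> real"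
  shows "(\<Sum>m=1..n. \<Sum>l=1..N. \<Sum>a | a \<in> multi_index (l - 1) \<and> weight a \<le> k. G (a(l := m)))
    = (\<Sum>b\<in>clark_ocone_set N n k. G b)"
proof -
  let ?A = "\<lambda>l. {a. a \<in> multi_index (l - 1) \<and> weight a \<le> k}"
  have "(\<Sum>m=1..n. \<Sum>l=1..N. \<Sum>a\<in>?A l. G (a(l := m)))
      = (\<Sum>(m, l, a)\<in>(SIGMA m:{1..n}. SIGMA l:{1..N}. ?A l). G (a(l := m)))"
    by (subst sum.Sigma; (subst sum.Sigma)?) (auto simp: finite_multi_index_le intro!: sum.cong finite_SigmaI)
  also have "\<dots> = (\<Sum>b\<in>clark_ocone_set N n k. G b)"
  proof (rule sum.reindex_bij_witness[where i = "\<lambda>b. (b (lst b), lst b, b(lst b := 0))" and j = "\<lambda>(m, l, a). a(l := m)"])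
    fix x assume "x \<in> (SIGMA m:{1..n}. SIGMA l:{1..N}. ?A l)"
    then obtain m l a where x: "x = (m, l, a)" "m \<in> {1..n}" "l \<in> {1..N}" "a \<in> multi_index (l - 1)" "weight a \<le> k"
      by auto
    have aN: "a \<in> multi_index N" using x by (intro multi_index_mono[OF x(4)]) auto
    have al: "a j = 0" if "l \<le> j" for j
    proof (rule multi_index_zero[OF x(4)])
      show "j \<notin> {1..l - 1}" using that x(3) by auto
    qed
    have b: "a(l := m) \<in> multi_index N" by (rule multi_index_fun_upd[OF aN x(3)])
    have lst: "lst (a(l := m)) = l" using x(2) al by (intro lst_eqI[OF b]) auto
    show "(\<lambda>b. (b (lst b), lst b, b(lst b := 0))) ((\<lambda>(m, l, a). a(l := m)) x) = x"
      using x(1) al[of l] by (auto simp: lst)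
    have "a(l := m) \<noteq> (\<lambda>_. 0)" using x(2) by (auto simp: fun_eq_iff)
    moreover have "weight (a(l := m)) = weight a + m" using weight_fun_upd[OF aN x(3), of m] al[of l] by simp
    ultimately show "(\<lambda>(m, l, a). a(l := m)) x \<in> clark_ocone_set N n k"
      using x b by (simp add: clark_ocone_set_def lst)
    show "G ((\<lambda>(m, l, a). a(l := m)) x) = (case x of (m, l, a) \<Rightarrow> G (a(l := m)))" using x(1) by simp
  next
    fix b assume "b \<in> clark_ocone_set N n k"
    then have b: "b \<in> multi_index N" "b \<noteq> (\<lambda>_. 0)" "b (lst b) \<le> n" "weight b \<le> k + b (lst b)"
      by (auto simp: clark_ocone_set_def)
    note l = lst_props[OF b(1,2)]
    show "(\<lambda>(m, l, a). a(l := m)) (b (lst b), lst b, b(lst b := 0)) = b" by simp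
    have "b(lst b := 0) \<in> multi_index (lst b - 1)" unfolding multi_index_def
    proof (intro CollectI allI impI)
      fix i assume "i \<notin> {1..lst b - 1}"
      then have "i = 0 \<or> i = lst b \<or> lst b < i" using l(1) by auto
      then show "(b(lst b := 0)) i = 0" using l multi_index_zero[OF b(1), of 0] by auto
    qed
    then show "(b (lst b), lst b, b(lst b := 0)) \<in> (SIGMA m:{1..n}. SIGMA l:{1..N}. ?A l)"
      using l b weight_fun_upd[OF b(1) l(1), of 0] by auto
  qed
  finally show ?thesis .
qed

context wiener_space begin

lemma \<Delta>W_measurable: "0 \<le> T \<Longrightarrow> 1 \<le> l \<Longrightarrow> \<Delta>W T N l \<in> borel_measurable M"
  unfolding \<Delta>W_def by (intro borel_measurable_diff W_measurable) auto

context
  fixes T :: real and N :: nat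
  assumes T: "0 < T" and N: "1 \<le> N"
begin

lemma on_grid: "orthonormal N (grid_h T N)"
  by (rule orthonormal_grid[OF T N])

lemma gen_exp_tendsto:
  assumes F: "F \<in> \<D> s" and b: "b \<in> multi_index N"
  shows "(\<lambda>k. expectation (\<lambda>\<omega>. F k \<omega> * HH (grid_h T N) b \<omega>)) \<longlonglongrightarrow> gen_exp s F (grid_h T N) b"
  unfolding gen_exp_def by (rule gen_exp_limit[OF F eigen_HH[OF on_grid b]])

text \<open>Each derivative raises the entry \<open>l\<close> of the test product by one, and the
  square roots telescope to a quotient of factorials. The index \<open>c\<close> must vary, as the
  induction hypothesis is applied to a raised index.\<close>

lemma deriv_\<Delta>W_iterate:
  assumes F: "\<And>k. F k \<in> \<P>" and l: "l \<in> {1..N}"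
  shows "(deriv_\<Delta>W T N l ^^ m) F k \<in> \<P>"
    and "c \<in> multi_index N \<Longrightarrow> expectation (\<lambda>\<omega>. (deriv_\<Delta>W T N l ^^ m) F k \<omega> * HH (grid_h T N) c \<omega>)
      = (T / N) powr (- (real m / 2)) * sqrt (fact (c l + m) / fact (c l))
        * expectation (\<lambda>\<omega>. F k \<omega> * HH (grid_h T N) (c(l := c l + m)) \<omega>)"
proof (induction m arbitrary: c)
  case 0
  { case 1 then show ?case using F by simp }
  { case 2 then show ?case using T N by simp }
next
  case (Suc m)
  let ?G = "(deriv_\<Delta>W T N l ^^ m) F"
  let ?h = "grid_h T N"
  have eq: "(deriv_\<Delta>W T N l ^^ Suc m) F k = (\<lambda>\<omega>. (T / N) powr (- 1 / 2) * dir_deriv (?h l) (?G k) \<omega>)"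
    by (simp add: deriv_\<Delta>W_def)
  { case 1 show ?case unfolding eq by (intro P_scale dir_deriv_in_P Suc.IH(1)) }
  { case 2
    let ?c = "c(l := Suc (c l))"
    have cc: "?c(l := ?c l + m) = c(l := c l + Suc m)" "?c l + m = c l + Suc m" "?c l = Suc (c l)" by auto
    have "expectation (\<lambda>\<omega>. (deriv_\<Delta>W T N l ^^ Suc m) F k \<omega> * HH ?h c \<omega>)
        = (T / N) powr (- 1 / 2) * expectation (\<lambda>\<omega>. dir_deriv (?h l) (?G k) \<omega> * HH ?h c \<omega>)"
      unfolding eq mult.assoc by (rule integral_mult_right_zero)
    also have "expectation (\<lambda>\<omega>. dir_deriv (?h l) (?G k) \<omega> * HH ?h c \<omega>)
        = sqrt (Suc (c l)) * expectation (\<lambda>\<omega>. ?G k \<omega> * HH ?h ?c \<omega>)"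
      by (rule HH_dir_deriv_adjoint[OF on_grid 2 l Suc.IH(1)])
    also have "expectation (\<lambda>\<omega>. ?G k \<omega> * HH ?h ?c \<omega>)
        = (T / N) powr (- (real m / 2)) * sqrt (fact (c l + Suc m) / fact (Suc (c l)))
        * expectation (\<lambda>\<omega>. F k \<omega> * HH ?h (c(l := c l + Suc m)) \<omega>)"
      using Suc.IH(2)[OF multi_index_fun_upd[OF 2 l, of "Suc (c l)"]]
      unfolding cc(1) unfolding cc(2) unfolding cc(3) .
    finally have "expectation (\<lambda>\<omega>. (deriv_\<Delta>W T N l ^^ Suc m) F k \<omega> * HH ?h c \<omega>)
        = ((T / N) powr (- 1 / 2) * (T / N) powr (- (real m / 2)))
          * (sqrt (Suc (c l)) * sqrt (fact (c l + Suc m) / fact (Suc (c l))))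
          * expectation (\<lambda>\<omega>. F k \<omega> * HH ?h (c(l := c l + Suc m)) \<omega>)" by (simp only: mult_ac)
    moreover have "(T / N) powr (- 1 / 2) * (T / N) powr (- (real m / 2)) = (T / N) powr (- (real (Suc m) / 2))"
      unfolding powr_add[symmetric] by (rule arg_cong[where f = "\<lambda>u. (T / N) powr u"]) (simp add: field_simps)
    moreover have "sqrt (Suc (c l)) * sqrt (fact (c l + Suc m) / fact (Suc (c l))) = sqrt (fact (c l + Suc m) / fact (c l))"
      unfolding real_sqrt_mult[symmetric] fact_Suc[of "c l"] by (simp add: divide_simps del: fact_Suc)
    ultimately show ?case by (simp only:) }
qed

text \<open>Each term of the sequence is an explicit multiple of a coefficient of
  \<open>F k\<close>, so the limit is that of \<open>gen_exp_tendsto\<close>. The two weights of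
  order \<open>s - m\<close> cancel, and \<open>c l = 0\<close> reduces the factorial quotient to
  \<open>m!\<close>.\<close>

lemma gen_exp_deriv:
  assumes F: "F \<in> \<D> s" and l: "l \<in> {1..N}" and c: "c \<in> multi_index N" "c l = 0"
  shows "gen_exp (s - real m) ((deriv_\<Delta>W T N l ^^ m) F) (grid_h T N) c
    = (T / N) powr (- (real m / 2)) * sqrt (fact m) * gen_exp s F (grid_h T N) (c(l := m))"
proof -
  let ?h = "grid_h T N"
  let ?G = "(deriv_\<Delta>W T N l ^^ m) F"
  let ?K = "(T / N) powr (- (real m / 2)) * sqrt (fact m)"
  let ?w = "\<lambda>u. (1 + real (weight c)) powr u"
  have "(\<lambda>k. ?w (s - real m) * (?K * expectation (\<lambda>\<omega>. F k \<omega> * HH ?h (c(l := m)) \<omega>)))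
      \<longlonglongrightarrow> ?w (s - real m) * (?K * gen_exp s F ?h (c(l := m)))"
    by (intro tendsto_intros gen_exp_tendsto[OF F] multi_index_fun_upd c(1) l)
  moreover have "innerP (s - real m) (?G k) (HH ?h c)
      = ?w (s - real m) * (?K * expectation (\<lambda>\<omega>. F k \<omega> * HH ?h (c(l := m)) \<omega>))" for k
    unfolding innerP_eigen[OF deriv_\<Delta>W_iterate(1)[OF D_P[OF F] l] eigen_HH[OF on_grid c(1)]]
      deriv_\<Delta>W_iterate(2)[OF D_P[OF F] l c(1)] using c(2) by simp
  ultimately have "innerD (s - real m) ?G (\<lambda>_. HH ?h c) = ?w (s - real m) * (?K * gen_exp s F ?h (c(l := m)))"
    unfolding innerD_def by (simp add: limI)
  then have "gen_exp (s - real m) ?G ?h c = (?w (- (s - real m)) * ?w (s - real m)) * (?K * gen_exp s F ?h (c(l := m)))"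
    unfolding gen_exp_def by (simp only: mult.assoc)
  also have "?w (- (s - real m)) * ?w (s - real m) = 1" by (simp flip: powr_add)
  finally show ?thesis by (simp only: mult_1_left mult.assoc)
qed

lemma HH_mult_hermite:
  assumes a: "a \<in> multi_index N" "a l = 0" and l: "l \<in> {1..N}"
  shows "HH h a \<omega> * hermite m (WI (h l) \<omega>) = HH h (a(l := m)) \<omega>"
  unfolding HH_hprod[OF a(1)] HH_hprod[OF multi_index_fun_upd[OF a(1) l]] hprod_fun_upd[OF l]
    hprod_remove[OF l, of a] by (simp add: a(2))

text \<open>\<open>Err\<close> evaluates Hermite polynomials at the increments themselves,
  \<open>HH\<close> at chosen versions of Wiener integrals; outside a null set both agree, and the
  conditional expectations combine into full Hermite products.\<close>

lemma Err_AE: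
  assumes F: "F \<in> \<D> s"
  shows "AE \<omega> in M. Err s T N n F k \<omega> = F k \<omega>
    - (\<Sum>b\<in>insert (\<lambda>_. 0) (clark_ocone_set N n k). gen_exp s F (grid_h T N) b * HH (grid_h T N) b \<omega>)"
proof -
  let ?h = "grid_h T N"
  let ?f = "gen_exp s F ?h"
  have fin: "finite (clark_ocone_set N n k)"
    by (rule finite_subset[OF _ finite_multi_index_le[of N "k + n"]]) (auto simp: clark_ocone_set_def)
  have "AE \<omega> in M. \<forall>l\<in>{1..N}. WI (?h l) \<omega> = \<Delta>W T N l \<omega> / sqrt (T / N)"
    using WI_grid[OF T N] by (intro AE_finite_allI) auto
  then show ?thesis
  proof eventually_elim
    case (elim \<omega>)
    have summand: "(T / N) powr (real m / 2) / sqrt (fact m) *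
        gen_cond_exp (s - real m) T N (l - 1) ((deriv_\<Delta>W T N l ^^ m) F) k \<omega> *
        hermite m (\<Delta>W T N l \<omega> / sqrt (T / N))
      = (\<Sum>a | a \<in> multi_index (l - 1) \<and> weight a \<le> k. ?f (a(l := m)) * HH ?h (a(l := m)) \<omega>)"
      if l: "l \<in> {1..N}" for l m
    proof -
      \<comment> \<open>The prefactor in the formula is the inverse of the factor produced by
        \<open>gen_exp_deriv\<close>.\<close>
      have coef: "(T / N) powr (real m / 2) / sqrt (fact m) * ((T / N) powr (- (real m / 2)) * sqrt (fact m)) = 1"
      proof -
        have "(T / N) powr (real m / 2) * (T / N) powr (- (real m / 2)) = 1"
          using T N by (simp flip: powr_add)
        then show ?thesis by (simp add: field_simps)
      qed
      have "(T / N) powr (real m / 2) / sqrt (fact m) *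
          (gen_exp (s - real m) ((deriv_\<Delta>W T N l ^^ m) F) ?h a * HH ?h a \<omega>) * hermite m (WI (?h l) \<omega>)
          = ?f (a(l := m)) * HH ?h (a(l := m)) \<omega>" if a: "a \<in> multi_index (l - 1)" for a
      proof -
        have aN: "a \<in> multi_index N" using l by (intro multi_index_mono[OF a]) auto
        have al: "a l = 0" by (rule multi_index_zero[OF a]) (use l in auto)
        have "(T / N) powr (real m / 2) / sqrt (fact m) *
          (gen_exp (s - real m) ((deriv_\<Delta>W T N l ^^ m) F) ?h a * HH ?h a \<omega>) * hermite m (WI (?h l) \<omega>)
          = ((T / N) powr (real m / 2) / sqrt (fact m) * ((T / N) powr (- (real m / 2)) * sqrt (fact m)))
            * ?f (a(l := m)) * (HH ?h a \<omega> * hermite m (WI (?h l) \<omega>))"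
          unfolding gen_exp_deriv[OF F l aN al] by (simp only: mult_ac)
        then show ?thesis unfolding coef HH_mult_hermite[OF aN al l] by simp
      qed
      then show ?thesis using elim l unfolding gen_cond_exp_def sum_distrib_left sum_distrib_right
        by (intro sum.cong refl) auto
    qed
    \<comment> \<open>The mean is the term of the zero multi-index, which has no last nonzero entry
      and is therefore inserted separately.\<close>
    have mean: "gen_mean s F = ?f (\<lambda>_. 0) * HH ?h (\<lambda>_. 0) \<omega>"
      using weight_zero[OF multi_index_zero_mem] by (simp add: gen_mean_def gen_exp_def HH_zero)
    have "Err s T N n F k \<omega> = F k \<omega> - (gen_mean s F + (\<Sum>m=1..n. \<Sum>l=1..N.
        \<Sum>a | a \<in> multi_index (l - 1) \<and> weight a \<le> k. ?f (a(l := m)) * HH ?h (a(l := m)) \<omega>))"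
      unfolding Err_def using summand by (intro arg_cong2[where f = "(-)"] arg_cong2[where f = "(+)"] refl sum.cong) auto
    also have "\<dots> = F k \<omega> - (\<Sum>b\<in>insert (\<lambda>_. 0) (clark_ocone_set N n k). ?f b * HH ?h b \<omega>)"
      unfolding sum_clark_ocone_set[of "\<lambda>b. ?f b * HH ?h b \<omega>"] mean using fin
      by (subst sum.insert) (auto simp: clark_ocone_set_def)
    finally show ?case .
  qed
qed

lemma HH_grid_in_P: "b \<in> multi_index N \<Longrightarrow> HH (grid_h T N) b \<in> \<P>"
  using HH_in_P on_grid by (auto simp: orthonormal_def)

text \<open>The identity with a polynomial random variable holds only almost everywhere, so
  measurability is checked from the definition of \<open>Err\<close>.\<close>

lemma Err_in_P:
  assumes F: "F \<in> \<D> s"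
  shows "Err s T N n F k \<in> \<P>"
proof (rule P_AE_cong)
  show "(\<lambda>\<omega>. F k \<omega> - (\<Sum>b\<in>insert (\<lambda>_. 0) (clark_ocone_set N n k). gen_exp s F (grid_h T N) b * HH (grid_h T N) b \<omega>)) \<in> \<P>"
    using HH_grid_in_P multi_index_zero_mem
    by (intro P_diff D_P[OF F] P_sum P_scale) (auto simp: clark_ocone_set_def)
  show "AE \<omega> in M. F k \<omega> - (\<Sum>b\<in>insert (\<lambda>_. 0) (clark_ocone_set N n k). gen_exp s F (grid_h T N) b * HH (grid_h T N) b \<omega>)
      = Err s T N n F k \<omega>" using Err_AE[OF F, of n k] by eventually_elim simp
  have H: "HH (grid_h T N) a \<in> borel_measurable M" if "a \<in> multi_index (l - 1)" "l \<in> {1..N}" for a l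
    using that by (intro P_measurable HH_grid_in_P multi_index_mono[OF that(1)]) auto
  have D: "(\<lambda>\<omega>. hermite m (\<Delta>W T N l \<omega> / sqrt (T / N))) \<in> borel_measurable M" if "l \<in> {1..N}" for l m
    using T that by (intro measurable_compose[OF _ borel_measurable_hermite] borel_measurable_divide
        borel_measurable_const \<Delta>W_measurable) auto
  show "Err s T N n F k \<in> borel_measurable M"
    unfolding Err_def gen_cond_exp_def
    by (intro borel_measurable_diff borel_measurable_add borel_measurable_sum borel_measurable_times
        borel_measurable_const P_measurable[OF D_P[OF F]]) (auto intro: H D)
qed

end

section \<open>The error estimate\<close>

lemma DN_family_dense: "F \<in> \<D>N s T N \<longleftrightarrow> family_dense s (multi_index N) (HH (grid_h T N)) F"
proof -
  have "(\<exists>G\<in>grid_span T N. Q G) \<longleftrightarrow>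
      (\<exists>S c. finite S \<and> S \<subseteq> multi_index N \<and> Q (\<lambda>\<omega>. \<Sum>a\<in>S. c a * HH (grid_h T N) a \<omega>))" for Q
    unfolding grid_span_def by blast
  then show ?thesis unfolding \<D>N_def family_dense_def by simp
qed

text \<open>The sequence \<open>Err\<close> is asymptotic to the partial sums \<open>U k\<close>
  over the kept indices \<open>V k\<close>. Hence it represents the same element, and both claims
  are proved for \<open>U\<close>, where norms are sums of squares.\<close>

lemma Err_bound:
  assumes T: "0 < T" and N0: "1 \<le> N0" and N1: "1 \<le> N1" and r: "0 \<le> r" "r \<le> 1"
    and F: "F \<in> \<D>N (s + r * real n) T N0"
  shows "Err s T (N0 * N1) n F \<in> \<D>N s T (N0 * N1)"
    and "normD s (Err s T (N0 * N1) n F) \<le> normD (s + r * real n) F / (sqrt (fact n * real N1 ^ n)) powr r"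
proof -
  define N where "N = N0 * N1"
  define t where "t = s + r * real n"
  have N: "1 \<le> N" using N0 N1 by (simp add: N_def)
  have st: "s \<le> t" using r by (simp add: t_def)
  let ?H = "HH (grid_h T N)"
  let ?f = "gen_exp s F (grid_h T N)"
  let ?g = "gen_exp t F (grid_h T N0)"
  let ?E = "Err s T N n F"
  have Fc: "family_dense t (multi_index N0) (HH (grid_h T N0)) F"
    using F by (simp add: DN_family_dense t_def)
  then have FDt: "F \<in> \<D> t" by (simp add: family_dense_def)
  have FD: "F \<in> \<D> s" by (rule D_mono[OF st FDt])
  have Ff: "family_dense s (multi_index N) ?H F"
    unfolding N_def by (rule family_dense_fine[OF T N0 N1 Fc st])
  note fam = HH_eigen_family[OF orthonormal_grid[OF T N]]
  note flim = gen_exp_tendsto[OF T N FD]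
  note glim = gen_exp_tendsto[OF T N0 FDt]
  have fg: "?f b = ?g (coarsen N0 N1 b) * rho T N0 N1 b" if "b \<in> multi_index N" for b
    using coefficient_fine[OF T N0 N1 Fc glim that[unfolded N_def] flim[OF that, unfolded N_def]]
    by (simp add: N_def)
  define V where "V k = {b \<in> last_gt N n. weight b \<le> k}" for k
  \<comment> \<open>All indices subtracted in \<open>Err\<close> or kept in \<open>U k\<close>. Some
    subtracted ones have weight above \<open>k\<close>, but every index of weight at most
    \<open>k\<close> occurs, which is what \<open>family_expansion\<close> asks for.\<close>
  define S where "S k = insert (\<lambda>_. 0) (clark_ocone_set N n k) \<union> V k" for k
  have VI: "V k \<subseteq> multi_index N" and SI: "S k \<subseteq> multi_index N" for k
    using multi_index_zero_mem by (auto simp: V_def S_def last_gt_def clark_ocone_set_def)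
  have finS: "finite (S k)" for k
    by (rule finite_subset[OF _ finite_multi_index_le[of N "k + n"]])
      (use SI weight_zero[OF multi_index_zero_mem] in \<open>auto simp: S_def V_def clark_ocone_set_def last_gt_def\<close>)
  have finV: "finite (V k)" for k using finS[of k] by (rule finite_subset[rotated]) (auto simp: S_def)
  have cover: "b \<in> S k" if "b \<in> multi_index N" "weight b \<le> k" for b k
    using that by (auto simp: S_def V_def clark_ocone_set_def last_gt_def)
  have disj: "insert (\<lambda>_. 0) (clark_ocone_set N n k) \<inter> V k = {}" for k
    by (auto simp: V_def clark_ocone_set_def last_gt_def)
  define U where "U k = (\<lambda>\<omega>. \<Sum>b\<in>V k. ?f b * ?H b \<omega>)" for k
  have PH: "?H b \<in> \<P>" if "b \<in> multi_index N" for b by (rule HH_grid_in_P[OF T N that])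
  have UP: "U k \<in> \<P>" for k unfolding U_def using PH VI[of k] by (intro P_sum P_scale) auto
  have EP: "?E k \<in> \<P>" for k by (rule Err_in_P[OF T N FD])
  have norm_eq: "normP s (\<lambda>\<omega>. ?E k \<omega> - U k \<omega>) = normP s (\<lambda>\<omega>. F k \<omega> - (\<Sum>b\<in>S k. ?f b * ?H b \<omega>))" for k
  proof (rule normP_AE_cong)
    show "(\<lambda>\<omega>. ?E k \<omega> - U k \<omega>) \<in> \<P>" by (intro P_diff EP UP)
    show "(\<lambda>\<omega>. F k \<omega> - (\<Sum>b\<in>S k. ?f b * ?H b \<omega>)) \<in> \<P>"
      using PH SI[of k] by (intro P_diff D_P[OF FD] P_sum P_scale) auto
    have split: "(\<Sum>b\<in>S k. ?f b * ?H b \<omega>)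
        = (\<Sum>b\<in>insert (\<lambda>_. 0) (clark_ocone_set N n k). ?f b * ?H b \<omega>) + U k \<omega>" for \<omega>
      unfolding S_def U_def using finS[of k] finV disj by (intro sum.union_disjoint) (auto simp: S_def)
    show "AE \<omega> in M. ?E k \<omega> - U k \<omega> = F k \<omega> - (\<Sum>b\<in>S k. ?f b * ?H b \<omega>)"
      using Err_AE[OF T N FD, of n k] unfolding split by eventually_elim simp
  qed
  have lim: "(\<lambda>k. normP s (\<lambda>\<omega>. ?E k \<omega> - U k \<omega>)) \<longlonglongrightarrow> 0"
    unfolding norm_eq by (rule family_expansion[OF fam Ff flim finS SI cover])
  \<comment> \<open>The square of the denominator in the claim.\<close>
  define C where "C = (fact n * real N1 ^ n) powr r"
  have Cpos: "0 < C" using N1 by (simp add: C_def)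
  \<comment> \<open>Group the fine indices by their block sums. Within a group the weight and the
    coarse coefficient are constant, so only the mass of the group remains to be estimated.\<close>
  have bound: "(\<Sum>b\<in>V k. (1 + real (weight b)) powr s * (?f b)\<^sup>2) \<le> (normD t F)\<^sup>2 / C" for k
  proof -
    define A where "A = {a. a \<in> multi_index N0 \<and> weight a \<le> k}"
    have A: "finite A" "A \<subseteq> multi_index N0" by (auto simp: A_def finite_multi_index_le)
    have co: "coarsen N0 N1 b \<in> A" if "b \<in> V k" for b
      using that coarsen_multi_index[OF N1] weight_coarsen[OF N1, of b N0]
      by (auto simp: V_def A_def last_gt_def N_def)
    have "(\<Sum>b\<in>V k. (1 + real (weight b)) powr s * (?f b)\<^sup>2)
        = (\<Sum>a\<in>A. \<Sum>b\<in>{b \<in> V k. coarsen N0 N1 b = a}. (1 + real (weight b)) powr s * (?f b)\<^sup>2)"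
      using finV A(1) co by (intro sum.group[symmetric]) auto
    also have "\<dots> \<le> (\<Sum>a\<in>A. (1 + real (weight a)) powr t * (?g a)\<^sup>2 / C)"
    proof (rule sum_mono)
      fix a assume a: "a \<in> A"
      then have aI: "a \<in> multi_index N0" using A by auto
      have "(\<Sum>b\<in>{b \<in> V k. coarsen N0 N1 b = a}. (1 + real (weight b)) powr s * (?f b)\<^sup>2)
          = (\<Sum>b\<in>{b \<in> V k. coarsen N0 N1 b = a}. (1 + real (weight a)) powr s * (?g a)\<^sup>2 * (rho T N0 N1 b)\<^sup>2)"
      proof (rule sum.cong[OF refl])
        fix b assume b: "b \<in> {b \<in> V k. coarsen N0 N1 b = a}"
        then have "b \<in> multi_index N" using VI by auto
        moreover from this have "weight b = weight a" using b weight_coarsen[OF N1, of b N0] by (simp add: N_def)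
        ultimately show "(1 + real (weight b)) powr s * (?f b)\<^sup>2
            = (1 + real (weight a)) powr s * (?g a)\<^sup>2 * (rho T N0 N1 b)\<^sup>2"
          using fg[of b] b by (simp add: power_mult_distrib)
      qed
      also have "\<dots> = (1 + real (weight a)) powr s * (?g a)\<^sup>2 * (\<Sum>b\<in>{b \<in> V k. coarsen N0 N1 b = a}. (rho T N0 N1 b)\<^sup>2)"
        by (simp add: sum_distrib_left)
      \<comment> \<open>The factor \<open>powr (r * real n)\<close> gained here raises the Sobolev
        weight from order \<open>s\<close> to order \<open>t\<close>, for which Bessel's inequality
        on the coarse grid finishes the estimate.\<close>
      also have "\<dots> \<le> (1 + real (weight a)) powr s * (?g a)\<^sup>2 * ((1 + real (weight a)) powr (r * real n) / C)"
      proof (rule mult_left_mono)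
        have "(\<Sum>b\<in>{b \<in> V k. coarsen N0 N1 b = a}. (rho T N0 N1 b)\<^sup>2)
            \<le> (\<Sum>b\<in>fibre N0 N1 a \<inter> last_gt (N0 * N1) n. (rho T N0 N1 b)\<^sup>2)"
          using finite_fibre[OF N1] by (intro sum_mono2) (auto simp: V_def fibre_def last_gt_def N_def)
        also have "\<dots> \<le> (1 + real (weight a)) powr (r * real n) / C"
          unfolding C_def by (rule fibre_last_gt_sum_powr[OF T N0 N1 aI r])
        finally show "(\<Sum>b\<in>{b \<in> V k. coarsen N0 N1 b = a}. (rho T N0 N1 b)\<^sup>2)
            \<le> (1 + real (weight a)) powr (r * real n) / C" .
      qed simp
      also have "\<dots> = (1 + real (weight a)) powr t * (?g a)\<^sup>2 / C"
        by (simp add: t_def powr_add)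
      finally show "(\<Sum>b\<in>{b \<in> V k. coarsen N0 N1 b = a}. (1 + real (weight b)) powr s * (?f b)\<^sup>2)
          \<le> (1 + real (weight a)) powr t * (?g a)\<^sup>2 / C" .
    qed
    also have "\<dots> = (\<Sum>a\<in>A. (1 + real (weight a)) powr t * (?g a)\<^sup>2) / C"
      by (simp add: sum_divide_distrib)
    also have "\<dots> \<le> (normD t F)\<^sup>2 / C"
      using Cpos A glim
      by (intro divide_right_mono bessel_D[OF HH_eigen_family[OF orthonormal_grid[OF T N0]] A FDt]) auto
    finally show ?thesis .
  qed
  have UD: "U \<in> \<D> s"
    unfolding U_def by (rule family_sums_Cauchy[OF fam finV VI _ bound]) (auto simp: V_def)
  note E = D_perturb[OF UD EP lim]
  have "normD s ?E \<le> normD t F / sqrt C"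
    unfolding E(2)
  proof (rule LIMSEQ_le_const2[OF normP_tendsto_normD[OF UD]])
    have "normP s (U k) \<le> normD t F / sqrt C" for k
    proof (rule power2_le_imp_le)
      have "(normP s (U k))\<^sup>2 \<le> (normD t F)\<^sup>2 / C"
        unfolding U_def normP_family_sum[OF fam finV VI] by (rule bound)
      then show "(normP s (U k))\<^sup>2 \<le> (normD t F / sqrt C)\<^sup>2" using Cpos by (simp add: power_divide)
      show "0 \<le> normD t F / sqrt C" using normD_nonneg[OF FDt] Cpos by simp
    qed
    then show "\<exists>K. \<forall>k\<ge>K. normP s (U k) \<le> normD t F / sqrt C" by blast
  qed
  moreover have "sqrt C = (sqrt (fact n * real N1 ^ n)) powr r"
    using N1 by (simp add: C_def powr_half_sqrt[symmetric] powr_powr mult.commute)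
  ultimately show "normD s (Err s T (N0 * N1) n F)
      \<le> normD (s + r * real n) F / (sqrt (fact n * real N1 ^ n)) powr r"
    by (simp add: N_def t_def)
  \<comment> \<open>A partial sum \<open>U K\<close> far out in the sequence is itself a finite
    combination of Hermite products on the fine grid.\<close>
  have "family_dense s (multi_index N) ?H ?E"
    unfolding family_dense_def
  proof (intro conjI allI impI E(1))
    fix e :: real assume "e > 0"
    then obtain K where K: "\<And>i j. i \<ge> K \<Longrightarrow> j \<ge> K \<Longrightarrow> normP s (\<lambda>\<omega>. U i \<omega> - U j \<omega>) < e / 2"
      using D_Cauchy[OF UD, of "e / 2"] half_gt_zero by blast
    have UK: "(\<lambda>k \<omega>. U k \<omega> - U K \<omega>) \<in> \<D> s" by (intro D_diff UD D_const UP)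
    have "normD s (\<lambda>k \<omega>. ?E k \<omega> - U K \<omega>) = normD s (\<lambda>k \<omega>. U k \<omega> - U K \<omega>)"
    proof (rule D_perturb(2)[OF UK])
      show "(\<lambda>\<omega>. ?E k \<omega> - U K \<omega>) \<in> \<P>" for k by (intro P_diff EP UP)
      show "(\<lambda>k. normP s (\<lambda>\<omega>. ?E k \<omega> - U K \<omega> - (U k \<omega> - U K \<omega>))) \<longlonglongrightarrow> 0" using lim by simp
    qed
    also have "\<dots> \<le> e / 2"
      using K by (intro LIMSEQ_le_const2[OF normP_tendsto_normD[OF UK]]) (auto intro!: exI[of _ K] less_imp_le)
    also have "\<dots> < e" using \<open>e > 0\<close> by simp
    finally show "\<exists>S c. finite S \<and> S \<subseteq> multi_index N \<and> normD s (\<lambda>k \<omega>. ?E k \<omega> - (\<Sum>a\<in>S. c a * ?H a \<omega>)) < e"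
      using finV[of K] VI[of K] unfolding U_def by blast
  qed
  then show "Err s T (N0 * N1) n F \<in> \<D>N s T (N0 * N1)" by (simp add: DN_family_dense N_def)
qed

end

theorem theorem3p2:
  fixes M :: "'a measure" and W :: "real \<Rightarrow> 'a \<Rightarrow> real"
    and T s r :: real and N0 N1 n :: nat and F :: "nat \<Rightarrow> 'a \<Rightarrow> real"
  assumes "wiener_space M W"
    and "T > 0" and "N0 \<ge> 1" and "N1 \<ge> 1" and "n \<ge> 1"
    and "0 \<le> r" and "r \<le> 1"
    and "F \<in> wiener_space.\<D>N M W (s + r * real n) T N0"
  shows "wiener_space.Err M W s T (N0 * N1) n F \<in> wiener_space.\<D>N M W s T (N0 * N1) \<and>
    wiener_space.normD M W s (wiener_space.Err M W s T (N0 * N1) n F)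
      \<le> wiener_space.normD M W (s + r * real n) F / (sqrt (fact n * real N1 ^ n)) powr r"
  using wiener_space.Err_bound[OF assms(1,2,3,4,6,7,8)] by blast

end
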